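(* Let $p$ be an odd prime and let $G$ be a finite nilpotent group of class at most $2$ and exponent $p$, minimally generated by $g_1,\ldots,g_n$, with $n>1$. Let $V$, $W$ be the $\mathbb{F}_p$-vector spaces and $\varphi_1,\ldots,\varphi_n\colon V\to W$ the linear maps defined in the context (for this $n$), and let $X$ be the subspace of $V$ determined by $G$ (and the generators $g_1,\ldots,g_n$), i.e. the subspace corresponding to the kernel of the natural map $\langle x_1\rangle\amalg^{\mathfrak{N}_2}\cdots\amalg^{\mathfrak{N}_2}\langle x_n\rangle\to G$, $x_i\mapsto g_i$, where each $x_i$ has order $p$. Let $Y_X=\langle\varphi_1(X),\ldots,\varphi_n(X)\rangle\subseteq W$ and $Z_X=\bigcap_{i=1}^n\varphi_i^{-1}(Y_X)\subseteq V$. Then $G$ is capable if and only if $X=Z_X$.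
   Context: A group $G$ is capable if there is a group $H$ with $G\cong H/Z(H)$. Commutators are $[x,y]=x^{-1}y^{-1}xy$; "class $2$" means class at most $2$. "Minimally generated by $g_1,\ldots,g_n$" means these elements generate $G$ and $G$ cannot be generated by fewer than $n$ elements. The $2$-nilpotent product $\langle x_1\rangle\amalg^{\mathfrak{N}_2}\cdots\amalg^{\mathfrak{N}_2}\langle x_n\rangle$ of cyclic groups is $F/F_3$, where $F=\langle x_1\rangle*\cdots*\langle x_n\rangle$ is the free product and $F_3=[[F,F],F]$ is the third term of the lower central series. When all $x_i$ have order $p$, its commutator subgroup is an elementary abelian $p$-group, i.e. an $\mathbb{F}_p$-vector space, with basis $[x_j,x_i]$, $1\le i<j\le n$. $V$ is the $\mathbb{F}_p$-vector space with basis $\{v_{ji}: 1\le i<j\le n\}$. $W$ is the $\mathbb{F}_p$-vector space with basis $\{w_{jik}: 1\le i<j\le n,\ i\le k\le n\}$. For $r=1,\ldots,n$, $\varphi_r\colon V\to W$ is the linear map with $\varphi_r(v_{ji})=w_{jir}$ if $r\ge i$, and $\varphi_r(v_{ji})=w_{jri}-w_{irj}$ if $r<i$. The kernel $N$ of the map $x_i\mapsto g_i$ from the $2$-nilpotent product to $G$ is contained in the commutator subgroup; the subspace $X\subseteq V$ determined by $G$ is the image of $N$ under the isomorphism from the commutator subgroup to $V$ sending $[x_j,x_i]$ to $v_{ji}$. *)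

theory Defs
  imports "HOL-Algebra.Algebra" "HOL-Number_Theory.Residues"
begin

section \<open>Commutators, centre, exponent, generation\<close>

definition group_commutator :: "('a, 'm) monoid_scheme \<Rightarrow> 'a \<Rightarrow> 'a \<Rightarrow> 'a" where
  "group_commutator G x y = inv\<^bsub>G\<^esub> x \<otimes>\<^bsub>G\<^esub> inv\<^bsub>G\<^esub> y \<otimes>\<^bsub>G\<^esub> x \<otimes>\<^bsub>G\<^esub> y"

definition commutator_subgroup :: "('a, 'm) monoid_scheme \<Rightarrow> 'a set \<Rightarrow> 'a set \<Rightarrow> 'a set" where
  "commutator_subgroup G A B = generate G {group_commutator G a b | a b. a \<in> A \<and> b \<in> B}"

text \<open>Indexed so that the first term is the whole group; the value at 0 is a dummy.\<close>

fun lower_central_series :: "('a, 'm) monoid_scheme \<Rightarrow> nat \<Rightarrow> 'a set" where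
  "lower_central_series G 0 = carrier G"
| "lower_central_series G (Suc 0) = carrier G"
| "lower_central_series G (Suc (Suc k)) =
     commutator_subgroup G (lower_central_series G (Suc k)) (carrier G)"

definition nilpotent_of_class_at_most :: "('a, 'm) monoid_scheme \<Rightarrow> nat \<Rightarrow> bool" where
  "nilpotent_of_class_at_most G c \<longleftrightarrow> lower_central_series G (Suc c) = {\<one>\<^bsub>G\<^esub>}"

definition has_exponent :: "('a, 'm) monoid_scheme \<Rightarrow> nat \<Rightarrow> bool" where
  "has_exponent G e \<longleftrightarrow> 0 < e \<and> (\<forall>x\<in>carrier G. x [^]\<^bsub>G\<^esub> e = \<one>\<^bsub>G\<^esub>) \<and>
     (\<forall>d>0. (\<forall>x\<in>carrier G. x [^]\<^bsub>G\<^esub> d = \<one>\<^bsub>G\<^esub>) \<longrightarrow> e \<le> d)"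

definition minimally_generated_by :: "('a, 'm) monoid_scheme \<Rightarrow> nat \<Rightarrow> (nat \<Rightarrow> 'a) \<Rightarrow> bool" where
  "minimally_generated_by G n g \<longleftrightarrow>
     g ` {1..n} \<subseteq> carrier G \<and> generate G (g ` {1..n}) = carrier G \<and>
     (\<forall>S. S \<subseteq> carrier G \<and> finite S \<and> card S < n \<longrightarrow> generate G S \<noteq> carrier G)"

definition group_center :: "('a, 'm) monoid_scheme \<Rightarrow> 'a set" where
  "group_center G = {z \<in> carrier G. \<forall>x\<in>carrier G. z \<otimes>\<^bsub>G\<^esub> x = x \<otimes>\<^bsub>G\<^esub> z}"

section \<open>Capability\<close>

text \<open>
  A formula cannot quantify over the carrier type of \<open>H\<close>, so one type is fixed that depends only
  on the type of \<open>G\<close>. This loses nothing: by \<open>capableI\<close> below, a witness \<open>H\<close> over any type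
  whatsoever yields one over this type.
\<close>

definition capable :: "('a, 'm) monoid_scheme \<Rightarrow> bool" where
  "capable G \<longleftrightarrow> (\<exists>H :: ('a \<times> bool) list monoid. group H \<and> G \<cong> H Mod group_center H)"

lemma group_centerI:
  assumes "z \<in> carrier H" "\<And>x. x \<in> carrier H \<Longrightarrow> z \<otimes>\<^bsub>H\<^esub> x = x \<otimes>\<^bsub>H\<^esub> z"
  shows "z \<in> group_center H"
  using assms unfolding group_center_def by blast

lemma group_centerD:
  assumes "z \<in> group_center H"
  shows "z \<in> carrier H" and "x \<in> carrier H \<Longrightarrow> z \<otimes>\<^bsub>H\<^esub> x = x \<otimes>\<^bsub>H\<^esub> z"
  using assms unfolding group_center_def by blast+

lemma center_normal:
  assumes "group H"
  shows "group_center H \<lhd> H"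
proof -
  interpret group H by fact
  have sub: "subgroup (group_center H) H"
  proof (rule subgroupI)
    show "group_center H \<subseteq> carrier H" by (auto simp: group_center_def)
    show "group_center H \<noteq> {}" using group_centerI[of "\<one>\<^bsub>H\<^esub>" H] by auto
  next
    fix a assume a: "a \<in> group_center H"
    have "inv\<^bsub>H\<^esub> a \<otimes>\<^bsub>H\<^esub> x = x \<otimes>\<^bsub>H\<^esub> inv\<^bsub>H\<^esub> a" if x: "x \<in> carrier H" for x
    proof -
      have "a \<in> carrier H" "a \<otimes>\<^bsub>H\<^esub> inv\<^bsub>H\<^esub> x = inv\<^bsub>H\<^esub> x \<otimes>\<^bsub>H\<^esub> a"
        using group_centerD[OF a] x by blast+
      thus ?thesis using x by (metis inv_closed inv_inv inv_mult_group)
    qed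
    thus "inv\<^bsub>H\<^esub> a \<in> group_center H" using group_centerI group_centerD(1)[OF a] by (metis inv_closed)
  next
    fix a b assume ab: "a \<in> group_center H" "b \<in> group_center H"
    have "a \<otimes>\<^bsub>H\<^esub> b \<otimes>\<^bsub>H\<^esub> x = x \<otimes>\<^bsub>H\<^esub> (a \<otimes>\<^bsub>H\<^esub> b)" if x: "x \<in> carrier H" for x
    proof -
      have "a \<in> carrier H" "b \<in> carrier H" "a \<otimes>\<^bsub>H\<^esub> x = x \<otimes>\<^bsub>H\<^esub> a" "b \<otimes>\<^bsub>H\<^esub> x = x \<otimes>\<^bsub>H\<^esub> b"
        using group_centerD[OF ab(1)] group_centerD[OF ab(2)] x by blast+
      thus ?thesis using x by (metis m_assoc)
    qed
    thus "a \<otimes>\<^bsub>H\<^esub> b \<in> group_center H" using group_centerI group_centerD(1)[OF ab(1)] group_centerD(1)[OF ab(2)] by (metis m_closed)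
  qed
  show ?thesis
    unfolding normal_inv_iff
  proof (intro conjI ballI sub)
    fix x h assume x: "x \<in> carrier H" and h: "h \<in> group_center H"
    have "h \<in> carrier H" "x \<otimes>\<^bsub>H\<^esub> h = h \<otimes>\<^bsub>H\<^esub> x"
      using group_centerD[OF h] x by auto
    thus "x \<otimes>\<^bsub>H\<^esub> h \<otimes>\<^bsub>H\<^esub> inv\<^bsub>H\<^esub> x \<in> group_center H"
      using x h by (simp add: m_assoc)
  qed
qed

lemma central_quotient_iso:
  assumes K: "group K" and Q: "group Q" and q: "q \<in> hom K Q" "q ` carrier K = carrier Q"
    and ker: "\<And>k. k \<in> carrier K \<Longrightarrow> q k = \<one>\<^bsub>Q\<^esub> \<longleftrightarrow> k \<in> group_center K"
  shows "Q \<cong> K Mod group_center K"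
proof -
  interpret group_hom K Q q
    using K Q q by (simp add: group_hom_def group_hom_axioms_def)
  have "kernel K Q q = group_center K"
    unfolding kernel_def using ker by (auto simp: group_center_def)
  hence "K Mod group_center K \<cong> Q" using FactGroup_iso q by simp
  thus ?thesis
    using group.iso_sym normal.factorgroup_is_group[OF center_normal[OF K]] by blast
qed

lemma capableI:
  fixes G :: "('a, 'm) monoid_scheme" and H :: "('b, 'k) monoid_scheme"
  assumes H: "group H" and iso: "G \<cong> H Mod group_center H"
  shows "capable G"
proof -
  interpret H: group H by fact
  let ?Z = "group_center H"
  interpret Z: normal ?Z H using center_normal[OF H] .
  let ?Q = "H Mod ?Z"
  obtain \<theta> where \<theta>: "\<theta> \<in> hom G ?Q" "bij_betw \<theta> (carrier G) (carrier ?Q)"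
    using iso by (auto simp: is_iso_def iso_def)
  have "\<exists>t. t \<in> carrier H \<and> ?Z #>\<^bsub>H\<^esub> t = \<theta> a" if "a \<in> carrier G" for a
  proof -
    have "\<theta> a \<in> carrier ?Q" using \<theta>(2) that by (auto simp: bij_betw_def)
    thus ?thesis by (auto simp: FactGroup_def RCOSETS_def)
  qed
  then obtain t where t: "\<And>a. a \<in> carrier G \<Longrightarrow> t a \<in> carrier H \<and> ?Z #>\<^bsub>H\<^esub> t a = \<theta> a"
    by metis
  let ?letter = "\<lambda>(a, b). if b then t a else inv\<^bsub>H\<^esub> t a"
  define ev where "ev w = foldr (\<lambda>l x. ?letter l \<otimes>\<^bsub>H\<^esub> x) w \<one>\<^bsub>H\<^esub>" for w
  define W where "W = lists (carrier G \<times> (UNIV :: bool set))"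
  have letter: "?letter l \<in> carrier H" if "l \<in> carrier G \<times> UNIV" for l
    using that t by auto
  have ev_closed: "ev w \<in> carrier H" if "w \<in> W" for w
    using that unfolding W_def
  proof (induction w rule: lists.induct)
    case (Cons l w)
    then show ?case using letter[of l] by (simp add: ev_def)
  qed (simp add: ev_def)
  have ev_append: "ev (u @ v) = ev u \<otimes>\<^bsub>H\<^esub> ev v" if "u \<in> W" "v \<in> W" for u v
    using that(1) unfolding W_def
  proof (induction u rule: lists.induct)
    case Nil
    then show ?case using ev_closed[OF that(2)] by (simp add: ev_def)
  next
    case (Cons l u)
    then have "ev u \<in> carrier H" using ev_closed by (simp add: W_def)
    then show ?case using Cons letter[of l] ev_closed[OF that(2)] by (simp add: ev_def H.m_assoc)
  qed
  define K where "K = generate H (t ` carrier G)"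
  have tH: "t ` carrier G \<subseteq> carrier H" using t by auto
  have K: "subgroup K H" unfolding K_def by (rule H.generate_is_subgroup[OF tH])
  have KW: "K \<subseteq> ev ` W"
  proof
    fix k assume "k \<in> K"
    thus "k \<in> ev ` W" unfolding K_def
    proof (induction k rule: generate.induct)
      case one
      then show ?case by (auto simp: ev_def W_def intro!: image_eqI[of _ _ "[]"])
    next
      case (incl h)
      then obtain a where "a \<in> carrier G" "h = t a" by auto
      then show ?case
        using t by (auto simp: ev_def W_def intro!: image_eqI[of _ _ "[(a, True)]"])
    next
      case (inv h)
      then obtain a where "a \<in> carrier G" "h = t a" by auto
      then show ?case
        using t by (auto simp: ev_def W_def intro!: image_eqI[of _ _ "[(a, False)]"])
    next
      case (eng h1 h2)
      then obtain u v where "u \<in> W" "v \<in> W" "h1 = ev u" "h2 = ev v" by auto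
      moreover from this have "u @ v \<in> W" by (simp add: W_def)
      ultimately show ?case using ev_append by (metis image_eqI)
    qed
  qed
  let ?K = "H\<lparr>carrier := K\<rparr>"
  have grpK: "group ?K" using H.subgroup_imp_group[OF K] .
  define f where "f = inv_into W ev"
  have inj: "inj_on f K" unfolding f_def by (rule inj_on_inv_into[OF KW])
  define L where "L = image_group f ?K"
  have grpL: "group L"
    unfolding L_def using group.inj_imp_image_group_is_group[OF grpK] inj by simp
  have fiso: "f \<in> Group.iso ?K L"
    unfolding L_def using inj_imp_image_group_iso[of f ?K] inj by simp
  have giso: "inv_into K f \<in> Group.iso L ?K"
    using group.iso_set_sym[OF grpK fiso] by simp
  have decomp: "\<exists>k\<in>K. \<exists>z\<in>?Z. x = z \<otimes>\<^bsub>H\<^esub> k" if x: "x \<in> carrier H" for x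
  proof -
    have "?Z #>\<^bsub>H\<^esub> x \<in> carrier ?Q" using x by (auto simp: FactGroup_def RCOSETS_def)
    then obtain a where a: "a \<in> carrier G" "\<theta> a = ?Z #>\<^bsub>H\<^esub> x"
      using \<theta>(2) unfolding bij_betw_def by (metis imageE)
    have "x \<in> ?Z #>\<^bsub>H\<^esub> t a"
      using t[OF a(1)] a(2) H.rcos_self[OF x Z.subgroup_axioms] by simp
    moreover have "t a \<in> K" unfolding K_def using a by (auto intro: generate.incl)
    ultimately show ?thesis by (auto simp: r_coset_def)
  qed
  have center: "k \<in> group_center ?K \<longleftrightarrow> k \<in> ?Z" if k: "k \<in> K" for k
  proof
    have kH: "k \<in> carrier H" using k K by (meson subgroup.mem_carrier)
    assume kc: "k \<in> group_center ?K"
    have "k \<otimes>\<^bsub>H\<^esub> x = x \<otimes>\<^bsub>H\<^esub> k" if x: "x \<in> carrier H" for x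
    proof -
      obtain y z where yz: "y \<in> K" "z \<in> ?Z" "x = z \<otimes>\<^bsub>H\<^esub> y" using decomp[OF x] by blast
      have c: "y \<in> carrier H" "z \<in> carrier H" using subgroup.mem_carrier[OF K yz(1)] Z.mem_carrier[OF yz(2)] by auto
      have "k \<otimes>\<^bsub>H\<^esub> y = y \<otimes>\<^bsub>H\<^esub> k" using group_centerD(2)[OF kc, of y] yz(1) by simp
      moreover have "z \<otimes>\<^bsub>H\<^esub> k = k \<otimes>\<^bsub>H\<^esub> z"
        using group_centerD(2)[OF yz(2) kH] .
      ultimately have "k \<otimes>\<^bsub>H\<^esub> (z \<otimes>\<^bsub>H\<^esub> y) = (z \<otimes>\<^bsub>H\<^esub> y) \<otimes>\<^bsub>H\<^esub> k"
        using c kH H.m_assoc[of k z y] H.m_assoc[of z k y] H.m_assoc[of z y k] by simp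
      thus ?thesis by (simp add: yz(3))
    qed
    thus "k \<in> ?Z" using kH by (rule group_centerI[rotated])
  next
    assume kZ: "k \<in> ?Z"
    show "k \<in> group_center ?K"
    proof (rule group_centerI)
      fix x assume "x \<in> carrier ?K"
      hence "x \<in> carrier H" using subgroup.mem_carrier[OF K] by simp
      thus "k \<otimes>\<^bsub>?K\<^esub> x = x \<otimes>\<^bsub>?K\<^esub> k" using group_centerD(2)[OF kZ] by simp
    qed (use k in simp)
  qed
  define q where "q = (\<lambda>l. ?Z #>\<^bsub>H\<^esub> inv_into K f l)"
  have cL: "carrier L = f ` K" by (simp add: L_def image_group_carrier)
  have g: "inv_into K f l \<in> K" if "l \<in> carrier L" for l
    using that by (simp add: cL inv_into_into)
  have gH: "inv_into K f l \<in> carrier H" if "l \<in> carrier L" for l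
    using g[OF that] K by (meson subgroup.mem_carrier)
  have hom: "q \<in> hom L ?Q"
  proof (rule homI)
    fix x assume "x \<in> carrier L"
    thus "q x \<in> carrier ?Q" using gH by (auto simp: q_def FactGroup_def RCOSETS_def)
  next
    fix x y assume xy: "x \<in> carrier L" "y \<in> carrier L"
    have "inv_into K f (x \<otimes>\<^bsub>L\<^esub> y) = inv_into K f x \<otimes>\<^bsub>H\<^esub> inv_into K f y"
      using giso xy by (auto simp: iso_def hom_def)
    thus "q (x \<otimes>\<^bsub>L\<^esub> y) = q x \<otimes>\<^bsub>?Q\<^esub> q y"
      using xy gH by (simp add: q_def FactGroup_def Z.rcos_sum)
  qed
  have surj: "q ` carrier L = carrier ?Q"
  proof
    show "q ` carrier L \<subseteq> carrier ?Q" using hom by (auto simp: hom_def)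
    show "carrier ?Q \<subseteq> q ` carrier L"
    proof
      fix c assume "c \<in> carrier ?Q"
      then obtain a where a: "a \<in> carrier G" "\<theta> a = c"
        using \<theta>(2) unfolding bij_betw_def by (metis imageE)
      have "t a \<in> K" unfolding K_def using a by (auto intro: generate.incl)
      hence "f (t a) \<in> carrier L" "inv_into K f (f (t a)) = t a"
        using inj by (auto simp: cL)
      thus "c \<in> q ` carrier L" using t[OF a(1)] a(2)
        by (intro image_eqI[of _ _ "f (t a)"]) (simp_all add: q_def)
    qed
  qed
  have ker: "q l = \<one>\<^bsub>?Q\<^esub> \<longleftrightarrow> l \<in> group_center L" if l: "l \<in> carrier L" for l
  proof -
    let ?k = "inv_into K f l"
    have "q l = \<one>\<^bsub>?Q\<^esub> \<longleftrightarrow> ?k \<in> ?Z"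
      using H.coset_join1[OF _ gH[OF l] Z.subgroup_axioms]
        H.coset_join2[OF gH[OF l] Z.subgroup_axioms]
      by (auto simp: q_def FactGroup_def)
    also have "\<dots> \<longleftrightarrow> ?k \<in> group_center ?K" using center[OF g[OF l]] by simp
    also have "\<dots> \<longleftrightarrow> l \<in> group_center L"
    proof -
      have m: "inv_into K f (x \<otimes>\<^bsub>L\<^esub> y) = inv_into K f x \<otimes>\<^bsub>H\<^esub> inv_into K f y"
        if "x \<in> carrier L" "y \<in> carrier L" for x y
        using giso that by (auto simp: iso_def hom_def)
      have b: "bij_betw (inv_into K f) (carrier L) K" using giso by (simp add: iso_def)
      have cl: "x \<otimes>\<^bsub>L\<^esub> y \<in> carrier L" if "x \<in> carrier L" "y \<in> carrier L" for x y
        using that grpL by (simp add: group.subgroup_self subgroup.m_closed)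
      have "(l \<otimes>\<^bsub>L\<^esub> x = x \<otimes>\<^bsub>L\<^esub> l) \<longleftrightarrow>
          ?k \<otimes>\<^bsub>H\<^esub> inv_into K f x = inv_into K f x \<otimes>\<^bsub>H\<^esub> ?k" if x: "x \<in> carrier L" for x
        using inj_on_eq_iff[OF bij_betw_imp_inj_on[OF b] cl[OF l x] cl[OF x l]] m[OF l x] m[OF x l]
        by simp
      moreover have "(\<forall>y\<in>K. ?k \<otimes>\<^bsub>H\<^esub> y = y \<otimes>\<^bsub>H\<^esub> ?k) \<longleftrightarrow>
          (\<forall>x\<in>carrier L. ?k \<otimes>\<^bsub>H\<^esub> inv_into K f x = inv_into K f x \<otimes>\<^bsub>H\<^esub> ?k)"
      proof (intro iffI ballI)
        fix y assume all: "\<forall>x\<in>carrier L. ?k \<otimes>\<^bsub>H\<^esub> inv_into K f x = inv_into K f x \<otimes>\<^bsub>H\<^esub> ?k"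
        assume "y \<in> K"
        then obtain x where "x \<in> carrier L" "y = inv_into K f x"
          using bij_betw_imp_surj_on[OF b] by blast
        thus "?k \<otimes>\<^bsub>H\<^esub> y = y \<otimes>\<^bsub>H\<^esub> ?k" using all by blast
      qed (use g in blast)
      ultimately show ?thesis using l g[OF l] unfolding group_center_def by simp
    qed
    finally show ?thesis .
  qed
  have "?Q \<cong> L Mod group_center L"
    by (rule central_quotient_iso[OF grpL Z.factorgroup_is_group hom surj ker])
  hence "G \<cong> L Mod group_center L" using iso iso_trans by blast
  thus ?thesis using grpL unfolding capable_def by blast
qed

section \<open>Free products and 2-nilpotent products of cyclic groups\<close>

text \<open>
  The free product is the set of words in the disjoint union of the factors, modulo the congruence
  that deletes identity letters and multiplies adjacent letters of the same factor.
\<close>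

definition free_words :: "'i set \<Rightarrow> ('i \<Rightarrow> 'a monoid) \<Rightarrow> ('i \<times> 'a) list set" where
  "free_words I G = lists (SIGMA i:I. carrier (G i))"

inductive word_equiv :: "'i set \<Rightarrow> ('i \<Rightarrow> 'a monoid) \<Rightarrow> ('i \<times> 'a) list \<Rightarrow> ('i \<times> 'a) list \<Rightarrow> bool"
  for I :: "'i set" and G :: "'i \<Rightarrow> 'a monoid" where
  refl: "w \<in> free_words I G \<Longrightarrow> word_equiv I G w w"
| sym: "word_equiv I G u v \<Longrightarrow> word_equiv I G v u"
| trans: "word_equiv I G u v \<Longrightarrow> word_equiv I G v w \<Longrightarrow> word_equiv I G u w"
| one: "u \<in> free_words I G \<Longrightarrow> v \<in> free_words I G \<Longrightarrow> i \<in> I \<Longrightarrow>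
    word_equiv I G (u @ [(i, \<one>\<^bsub>G i\<^esub>)] @ v) (u @ v)"
| mult: "u \<in> free_words I G \<Longrightarrow> v \<in> free_words I G \<Longrightarrow> i \<in> I \<Longrightarrow>
    a \<in> carrier (G i) \<Longrightarrow> b \<in> carrier (G i) \<Longrightarrow>
    word_equiv I G (u @ [(i, a), (i, b)] @ v) (u @ [(i, a \<otimes>\<^bsub>G i\<^esub> b)] @ v)"

definition word_class :: "'i set \<Rightarrow> ('i \<Rightarrow> 'a monoid) \<Rightarrow> ('i \<times> 'a) list \<Rightarrow> ('i \<times> 'a) list set" where
  "word_class I G w = {u. word_equiv I G w u}"

definition free_product :: "'i set \<Rightarrow> ('i \<Rightarrow> 'a monoid) \<Rightarrow> ('i \<times> 'a) list set monoid" where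
  "free_product I G =
     \<lparr>carrier = word_class I G ` free_words I G,
      monoid.mult = (\<lambda>A B. \<Union>u\<in>A. \<Union>v\<in>B. word_class I G (u @ v)),
      one = word_class I G []\<rparr>"

definition free_product_cyclic :: "nat \<Rightarrow> nat \<Rightarrow> (nat \<times> int) list set monoid" where
  "free_product_cyclic p n = free_product {1..n} (\<lambda>_. integer_mod_group p)"

definition nilpotent_product :: "nat \<Rightarrow> nat \<Rightarrow> (nat \<times> int) list set set monoid" where
  "nilpotent_product p n =
     free_product_cyclic p n Mod lower_central_series (free_product_cyclic p n) 3"

definition nilpotent_product_gen :: "nat \<Rightarrow> nat \<Rightarrow> nat \<Rightarrow> (nat \<times> int) list set set" where
  "nilpotent_product_gen p n i =
     lower_central_series (free_product_cyclic p n) 3 #>\<^bsub>free_product_cyclic p n\<^esub>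
       word_class {1..n} (\<lambda>_. integer_mod_group p) [(i, 1)]"

text \<open>
  The values of the next map on the carrier are determined, because the \<open>x\<^sub>i\<close> generate the
  2-nilpotent product.
\<close>

definition natural_map ::
    "nat \<Rightarrow> nat \<Rightarrow> ('a, 'm) monoid_scheme \<Rightarrow> (nat \<Rightarrow> 'a) \<Rightarrow> (nat \<times> int) list set set \<Rightarrow> 'a" where
  "natural_map p n G g =
     (SOME h. h \<in> hom (nilpotent_product p n) G \<and>
        (\<forall>i\<in>{1..n}. h (nilpotent_product_gen p n i) = g i))"

section \<open>The vector spaces \<open>V\<close> and \<open>W\<close> and the maps between them\<close>

text \<open>
  The module of all functions from \<open>S\<close> to \<open>R\<close>; for finite \<open>S\<close> it is free with basis
  \<open>basis_vector R S s\<close>, \<open>s \<in> S\<close>. The record type of modules extends that of rings, so the ring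
  multiplication and unit have to be given some value; they play no role.
\<close>

definition function_module :: "('r, 'm) ring_scheme \<Rightarrow> 's set \<Rightarrow> ('r, 's \<Rightarrow> 'r) module" where
  "function_module R S =
     \<lparr>carrier = S \<rightarrow>\<^sub>E carrier R,
      monoid.mult = (\<lambda>f h. undefined),
      one = undefined,
      ring.zero = (\<lambda>s\<in>S. \<zero>\<^bsub>R\<^esub>),
      ring.add = (\<lambda>f h. \<lambda>s\<in>S. f s \<oplus>\<^bsub>R\<^esub> h s),
      smult = (\<lambda>a f. \<lambda>s\<in>S. a \<otimes>\<^bsub>R\<^esub> f s)\<rparr>"

definition basis_vector :: "('r, 'm) ring_scheme \<Rightarrow> 's set \<Rightarrow> 's \<Rightarrow> 's \<Rightarrow> 'r" where
  "basis_vector R S t = (\<lambda>s\<in>S. if s = t then \<one>\<^bsub>R\<^esub> else \<zero>\<^bsub>R\<^esub>)"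

definition linear_extension ::
    "('r, 'b, 'm) module_scheme \<Rightarrow> 's set \<Rightarrow> ('s \<Rightarrow> 'b) \<Rightarrow> ('s \<Rightarrow> 'r) \<Rightarrow> 'b" where
  "linear_extension M S b f = (\<Oplus>\<^bsub>M\<^esub>s\<in>S. f s \<odot>\<^bsub>M\<^esub> b s)"

definition V_index :: "nat \<Rightarrow> (nat \<times> nat) set" where
  "V_index n = {(j, i). 1 \<le> i \<and> i < j \<and> j \<le> n}"

definition W_index :: "nat \<Rightarrow> (nat \<times> nat \<times> nat) set" where
  "W_index n = {(j, i, k). 1 \<le> i \<and> i < j \<and> j \<le> n \<and> i \<le> k \<and> k \<le> n}"

definition V_space :: "nat \<Rightarrow> nat \<Rightarrow> (int, nat \<times> nat \<Rightarrow> int) module" where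
  "V_space p n = function_module (residue_ring (int p)) (V_index n)"

definition W_space :: "nat \<Rightarrow> nat \<Rightarrow> (int, nat \<times> nat \<times> nat \<Rightarrow> int) module" where
  "W_space p n = function_module (residue_ring (int p)) (W_index n)"

definition v_basis :: "nat \<Rightarrow> nat \<Rightarrow> nat \<Rightarrow> nat \<Rightarrow> (nat \<times> nat \<Rightarrow> int)" where
  "v_basis p n j i = basis_vector (residue_ring (int p)) (V_index n) (j, i)"

definition w_basis :: "nat \<Rightarrow> nat \<Rightarrow> nat \<Rightarrow> nat \<Rightarrow> nat \<Rightarrow> (nat \<times> nat \<times> nat \<Rightarrow> int)" where
  "w_basis p n j i k = basis_vector (residue_ring (int p)) (W_index n) (j, i, k)"

definition phi_map :: "nat \<Rightarrow> nat \<Rightarrow> nat \<Rightarrow> (nat \<times> nat \<Rightarrow> int) \<Rightarrow> (nat \<times> nat \<times> nat \<Rightarrow> int)" where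
  "phi_map p n r = linear_extension (W_space p n) (V_index n)
     (\<lambda>(j, i). if i \<le> r then w_basis p n j i r
               else w_basis p n j r i \<ominus>\<^bsub>W_space p n\<^esub> w_basis p n i r j)"

definition Y_space :: "nat \<Rightarrow> nat \<Rightarrow> (nat \<times> nat \<Rightarrow> int) set \<Rightarrow> (nat \<times> nat \<times> nat \<Rightarrow> int) set" where
  "Y_space p n U =
     (\<lambda>T. submodule T (residue_ring (int p)) (W_space p n)) hull (\<Union>r\<in>{1..n}. phi_map p n r ` U)"

definition Z_space :: "nat \<Rightarrow> nat \<Rightarrow> (nat \<times> nat \<Rightarrow> int) set \<Rightarrow> (nat \<times> nat \<Rightarrow> int) set" where
  "Z_space p n U = (\<Inter>r\<in>{1..n}. {v \<in> carrier (V_space p n). phi_map p n r v \<in> Y_space p n U})"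

section \<open>The subspace determined by a group and its generators\<close>

text \<open>The \<open>[x\<^sub>j, x\<^sub>i]\<close> generate the commutator subgroup, so this isomorphism is unique on it.\<close>

definition commutator_iso :: "nat \<Rightarrow> nat \<Rightarrow> (nat \<times> int) list set set \<Rightarrow> (nat \<times> nat \<Rightarrow> int)" where
  "commutator_iso p n =
     (SOME h. h \<in> iso ((nilpotent_product p n)
                          \<lparr>carrier := commutator_subgroup (nilpotent_product p n)
                             (carrier (nilpotent_product p n)) (carrier (nilpotent_product p n))\<rparr>)
                      (add_monoid (V_space p n)) \<and>
        (\<forall>(j, i)\<in>V_index n.
           h (group_commutator (nilpotent_product p n)
                (nilpotent_product_gen p n j) (nilpotent_product_gen p n i)) = v_basis p n j i))"

definition determined_subspace ::
    "nat \<Rightarrow> nat \<Rightarrow> ('a, 'm) monoid_scheme \<Rightarrow> (nat \<Rightarrow> 'a) \<Rightarrow> (nat \<times> nat \<Rightarrow> int) set" where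
  "determined_subspace p n G g =
     commutator_iso p n ` kernel (nilpotent_product p n) G (natural_map p n G g)"

end

theory Submission
  imports Defs
begin

text \<open>
  Both directions compare triple commutators in a group \<open>H\<close> of class three with the vectors
  \<open>w\<^sub>j\<^sub>i\<^sub>k\<close>: the map \<open>\<phi>\<^sub>r\<close> describes the commutator with the \<open>r\<close>-th generator. Throughout,
  \<open>X\<close> is read as the set of exponent vectors \<open>v\<close> with \<open>\<Prod> [g\<^sub>j, g\<^sub>i]\<^bsup>v\<^esup> = 1\<close>
  (\<open>determined_subspace_eq\<close>). This rests on the normal form
  \<open>\<Prod> x\<^sub>i\<^bsup>a\<^esup> \<Prod> [x\<^sub>j, x\<^sub>i]\<^bsup>b\<^esup>\<close> in groups of class two, on the universal property of the nilpotent
  product, and on minimal generation, which makes every relation among the \<open>g\<^sub>i\<close> a relation among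
  their commutators. Since \<open>\<phi>\<^sub>r(X) \<subseteq> Y\<^sub>X\<close> by definition, \<open>X \<subseteq> Z\<^sub>X\<close> always holds, and only the other
  inclusion is at stake.

  Suppose \<open>G \<cong> H/Z(H)\<close>, and let \<open>h\<^sub>i\<close> lift \<open>g\<^sub>i\<close>. Then \<open>H\<close> has class at most three, the triple
  commutators \<open>[h\<^sub>j, h\<^sub>i, h\<^sub>k]\<close> are central of exponent \<open>p\<close>, and \<open>w\<^sub>j\<^sub>i\<^sub>k \<mapsto> [h\<^sub>j, h\<^sub>i, h\<^sub>k]\<close> defines a
  homomorphism \<open>\<psi>\<close> from \<open>W\<close> to \<open>Z(H)\<close>. Write \<open>c(v) = \<Prod> [h\<^sub>j, h\<^sub>i]\<^bsup>v\<^esup>\<close>. The Jacobi identity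
  gives \<open>[c(v), h\<^sub>r] = \<psi>(\<phi>\<^sub>r(v))\<close>, while \<open>v \<in> X\<close> means that \<open>c(v)\<close> is central. So \<open>\<psi>\<close> vanishes on
  \<open>\<phi>\<^sub>r(X)\<close>, hence on \<open>Y\<^sub>X\<close>, and for \<open>v \<in> Z\<^sub>X\<close> the element \<open>c(v)\<close> commutes with all \<open>h\<^sub>r\<close>; together
  with \<open>Z(H)\<close> these generate \<open>H\<close>, so \<open>v \<in> X\<close> (\<open>capable_imp_subspace_closed\<close>).

  Conversely, a witness is constructed for \<open>X = Z\<^sub>X\<close>. Magnus's embedding \<open>x\<^sub>i \<mapsto> 1 + X\<^sub>i\<close> into the
  free associative ring over the integers, truncated in degree four, gives a group of class three
  that maps onto \<open>G\<close>: the coefficients of \<open>X\<^sub>i\<close>, and of \<open>X\<^sub>j X\<^sub>i\<close> for \<open>i < j\<close>, serve as the exponents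
  \<open>a\<close> and \<open>b\<close> of a normal form. Reduce it modulo \<open>p\<close> and, in degree three, modulo the image of \<open>Y\<^sub>X\<close> under
  \<open>w\<^sub>j\<^sub>i\<^sub>k \<mapsto> [[X\<^sub>j, X\<^sub>i], X\<^sub>k]\<close>. An element is central in the quotient iff its linear part vanishes
  modulo \<open>p\<close> (here \<open>n > 1\<close> is needed) and its quadratic part \<open>v\<close> satisfies \<open>\<phi>\<^sub>r(v) \<in> Y\<^sub>X\<close> for all
  \<open>r\<close>, that is \<open>v \<in> Z\<^sub>X = X\<close>; this says precisely that it maps to \<open>1\<close> in \<open>G\<close>
  (\<open>subspace_closed_imp_capable\<close>). That \<open>\<phi>\<^sub>r(v)\<close> can be recovered from its tensor uses that the
  \<open>[[X\<^sub>j, X\<^sub>i], X\<^sub>k]\<close> are independent modulo every odd \<open>p\<close>.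
\<close>


section \<open>Commutators and central factors\<close>

context group
begin

lemma inv_mult_cancel_left:
  "x \<in> carrier G \<Longrightarrow> y \<in> carrier G \<Longrightarrow> inv x \<otimes> (x \<otimes> y) = y"
  by (simp flip: m_assoc)

lemma mult_inv_cancel_left:
  "x \<in> carrier G \<Longrightarrow> y \<in> carrier G \<Longrightarrow> x \<otimes> (inv x \<otimes> y) = y"
  by (simp flip: m_assoc)

lemmas word_simps = m_assoc inv_mult_group inv_mult_cancel_left mult_inv_cancel_left

lemma commutator_closed [simp]:
  "x \<in> carrier G \<Longrightarrow> y \<in> carrier G \<Longrightarrow> group_commutator G x y \<in> carrier G"
  by (simp add: group_commutator_def)

lemma mult_commutator:
  "x \<in> carrier G \<Longrightarrow> y \<in> carrier G \<Longrightarrow> x \<otimes> y = y \<otimes> x \<otimes> group_commutator G x y"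
  by (simp add: group_commutator_def word_simps)

lemma commutator_unique:
  assumes "x \<in> carrier G" "y \<in> carrier G" "c \<in> carrier G" "x \<otimes> y = y \<otimes> x \<otimes> c"
  shows "group_commutator G x y = c"
  using assms mult_commutator[of x y] by (metis commutator_closed l_cancel m_closed)

lemma commutator_eq_one_iff:
  assumes "x \<in> carrier G" "y \<in> carrier G"
  shows "group_commutator G x y = \<one> \<longleftrightarrow> x \<otimes> y = y \<otimes> x"
  using assms mult_commutator[of x y] commutator_unique[of x y \<one>] by auto

lemma inv_commutator:
  "x \<in> carrier G \<Longrightarrow> y \<in> carrier G \<Longrightarrow>
    inv (group_commutator G x y) = group_commutator G y x"
  by (simp add: group_commutator_def word_simps)

lemma center_closed [simp]: "z \<in> group_center G \<Longrightarrow> z \<in> carrier G"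
  by (rule group_centerD)

lemma center_subgroup: "subgroup (group_center G) G"
  using center_normal[OF is_group] by (simp add: normal_imp_subgroup)

lemma center_commutes:
  "z \<in> group_center G \<Longrightarrow> x \<in> carrier G \<Longrightarrow> z \<otimes> x = x \<otimes> z"
  by (rule group_centerD(2))

lemma center_commutes_left:
  "z \<in> group_center G \<Longrightarrow> x \<in> carrier G \<Longrightarrow> y \<in> carrier G \<Longrightarrow> x \<otimes> (z \<otimes> y) = z \<otimes> (x \<otimes> y)"
  by (metis center_closed center_commutes m_assoc)

lemma center_int_pow: "z \<in> group_center G \<Longrightarrow> z [^] (k::int) \<in> group_center G"
  by (rule subgroup_int_pow_closed[OF center_subgroup])

text \<open>Only the first commutator on the right has to be central, because
  \<open>[x, yz] = [x, z] [x, y]\<^sup>z\<close> holds in every group.\<close>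

lemma commutator_mult_right:
  assumes "x \<in> carrier G" "y \<in> carrier G" "z \<in> carrier G"
    and "group_commutator G x y \<in> group_center G"
  shows "group_commutator G x (y \<otimes> z) = group_commutator G x y \<otimes> group_commutator G x z"
proof (rule commutator_unique)
  let ?c = "group_commutator G x y" and ?d = "group_commutator G x z"
  have "x \<otimes> (y \<otimes> z) = y \<otimes> x \<otimes> ?c \<otimes> z"
    using assms mult_commutator[of x y] by (metis m_assoc)
  also have "\<dots> = y \<otimes> (x \<otimes> z) \<otimes> ?c"
    using assms center_commutes[of ?c z] by (simp add: m_assoc)
  also have "\<dots> = y \<otimes> (z \<otimes> x \<otimes> ?d) \<otimes> ?c"
    using assms mult_commutator[of x z] by simp
  also have "\<dots> = y \<otimes> z \<otimes> x \<otimes> (?c \<otimes> ?d)"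
    using assms center_commutes[of ?c ?d] by (simp add: m_assoc)
  finally show "x \<otimes> (y \<otimes> z) = y \<otimes> z \<otimes> x \<otimes> (?c \<otimes> ?d)" .
qed (use assms in auto)

lemma commutator_mult_left:
  assumes "x \<in> carrier G" "y \<in> carrier G" "z \<in> carrier G"
    and "group_commutator G x z \<in> group_center G"
  shows "group_commutator G (x \<otimes> y) z = group_commutator G x z \<otimes> group_commutator G y z"
proof (rule commutator_unique)
  let ?c = "group_commutator G x z" and ?d = "group_commutator G y z"
  have "x \<otimes> y \<otimes> z = x \<otimes> (z \<otimes> y \<otimes> ?d)"
    using assms mult_commutator[of y z] by (simp add: m_assoc)
  also have "\<dots> = (x \<otimes> z) \<otimes> (y \<otimes> ?d)"
    using assms by (simp add: m_assoc)
  also have "\<dots> = (z \<otimes> x \<otimes> ?c) \<otimes> (y \<otimes> ?d)"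
    using assms mult_commutator[of x z] by simp
  also have "\<dots> = z \<otimes> (x \<otimes> y) \<otimes> (?c \<otimes> ?d)"
    using assms center_commutes_left[of ?c y ?d] by (simp add: m_assoc)
  finally show "x \<otimes> y \<otimes> z = z \<otimes> (x \<otimes> y) \<otimes> (?c \<otimes> ?d)" .
qed (use assms in auto)

lemma commutator_one_right [simp]: "x \<in> carrier G \<Longrightarrow> group_commutator G x \<one> = \<one>"
  by (simp add: group_commutator_def)

lemma commutator_one_left [simp]: "x \<in> carrier G \<Longrightarrow> group_commutator G \<one> x = \<one>"
  by (simp add: group_commutator_def)

lemma commutator_hom_right:
  assumes "x \<in> carrier G" "\<And>y. y \<in> carrier G \<Longrightarrow> group_commutator G x y \<in> group_center G"
  shows "group_hom G G (group_commutator G x)"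
  using assms by unfold_locales (auto intro!: homI simp: commutator_mult_right)

lemma commutator_int_pow_right:
  assumes "x \<in> carrier G" "\<And>y. y \<in> carrier G \<Longrightarrow> group_commutator G x y \<in> group_center G"
    and "y \<in> carrier G"
  shows "group_commutator G x (y [^] (k::int)) = group_commutator G x y [^] k"
  using group_hom.hom_int_pow[OF commutator_hom_right[OF assms(1,2)] assms(3)] by simp

lemma center_absorbed_right:
  assumes "x \<in> carrier G" "y \<in> carrier G" "z \<in> group_center G"
  shows "group_commutator G x (z \<otimes> y) = group_commutator G x y"
  using assms commutator_mult_right[of x z y] commutator_eq_one_iff[of x z]
    center_commutes[of z x] group_centerI[of \<one> G] by simp

lemma center_absorbed_left:
  assumes "x \<in> carrier G" "y \<in> carrier G" "z \<in> group_center G"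
  shows "group_commutator G (z \<otimes> x) y = group_commutator G x y"
  using assms commutator_mult_left[of z x y] commutator_eq_one_iff[of z y]
    center_commutes[of z y] group_centerI[of \<one> G] by simp

lemma hall_witt:
  assumes "x \<in> carrier G" "y \<in> carrier G" "z \<in> carrier G"
  shows "(inv y \<otimes> group_commutator G (group_commutator G x (inv y)) z \<otimes> y) \<otimes>
     (inv z \<otimes> group_commutator G (group_commutator G y (inv z)) x \<otimes> z) \<otimes>
     (inv x \<otimes> group_commutator G (group_commutator G z (inv x)) y \<otimes> x) = \<one>"
  using assms by (simp add: group_commutator_def word_simps)

end

text \<open>Class at most three, in the form in which it is used: the group modulo its centre has
  class at most two.\<close>

locale class_3_group = group +
  assumes triple_commutator_central:
    "x \<in> carrier G \<Longrightarrow> y \<in> carrier G \<Longrightarrow> z \<in> carrier G \<Longrightarrow>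
      group_commutator G (group_commutator G x y) z \<in> group_center G"
begin

abbreviation "triple x y z \<equiv> group_commutator G (group_commutator G x y) z"

text \<open>Modulo the centre, \<open>[x, y\<inverse>]\<close> and \<open>[y, x]\<close> agree.\<close>

lemma triple_inv_middle:
  assumes "x \<in> carrier G" "y \<in> carrier G" "z \<in> carrier G"
  shows "triple x (inv y) z = triple y x z"
proof -
  have 1: "triple y x (inv y) \<in> group_center G"
    using assms triple_commutator_central by simp
  have 2: "group_commutator G x (inv y) = group_commutator G y x \<otimes> triple y x (inv y)"
    using assms by (simp add: group_commutator_def word_simps)
  also have "\<dots> = triple y x (inv y) \<otimes> group_commutator G y x"
    using 1 assms center_commutes by simp
  finally show ?thesis
    using 1 assms by (simp add: center_absorbed_left)
qed

lemma triple_swap: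
  assumes "x \<in> carrier G" "y \<in> carrier G" "z \<in> carrier G"
  shows "triple y x z = inv (triple x y z)"
proof -
  have "triple x y z \<otimes> triple y x z = group_commutator G (group_commutator G x y \<otimes> group_commutator G y x) z"
    using assms by (simp add: commutator_mult_left triple_commutator_central)
  also have "group_commutator G x y \<otimes> group_commutator G y x = \<one>"
    using assms by (simp flip: inv_commutator[of x y])
  finally have "triple x y z \<otimes> triple y x z = \<one>" using assms by simp
  from inv_comm[OF this] show ?thesis using assms by (simp add: inv_equality)
qed

text \<open>The Hall--Witt identity: all its factors are central here, so the conjugations disappear.\<close>

lemma jacobi:
  assumes "x \<in> carrier G" "y \<in> carrier G" "z \<in> carrier G"
  shows "triple x y z \<otimes> triple y z x \<otimes> triple z x y = \<one>"
proof -
  have conj: "inv u \<otimes> c \<otimes> u = c" if "c \<in> group_center G" "u \<in> carrier G" for c u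
    using that center_commutes[of c u] by (simp add: m_assoc inv_mult_cancel_left)
  have "triple y x z \<otimes> triple z y x \<otimes> triple x z y = \<one>"
    using hall_witt[OF assms] assms
    by (simp add: triple_inv_middle conj triple_commutator_central)
  from this[THEN arg_cong, of "\<lambda>t. inv t"]
  have "inv (triple x z y) \<otimes> (inv (triple z y x) \<otimes> inv (triple y x z)) = \<one>"
    using assms by (simp add: inv_mult_group m_assoc)
  then have "triple z x y \<otimes> (triple y z x \<otimes> triple x y z) = \<one>"
    using assms by (simp flip: triple_swap)
  moreover have "triple y z x \<otimes> triple x y z = triple x y z \<otimes> triple y z x"
    using assms by (intro center_commutes triple_commutator_central) auto
  moreover have "triple z x y \<otimes> (triple x y z \<otimes> triple y z x) =
      triple x y z \<otimes> triple y z x \<otimes> triple z x y"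
    using assms by (intro center_commutes triple_commutator_central) auto
  ultimately show ?thesis by metis
qed

end

section \<open>Ordered products over lists\<close>

text \<open>The generators of a non-abelian group do not commute, so the order of the factors matters.\<close>

primrec list_mult :: "('a, 'm) monoid_scheme \<Rightarrow> ('i \<Rightarrow> 'a) \<Rightarrow> 'i list \<Rightarrow> 'a" where
  "list_mult G f [] = \<one>\<^bsub>G\<^esub>"
| "list_mult G f (x # xs) = f x \<otimes>\<^bsub>G\<^esub> list_mult G f xs"

lemma list_mult_cong:
  "(\<And>i. i \<in> set xs \<Longrightarrow> f i = e i) \<Longrightarrow> list_mult G f xs = list_mult G e xs"
  by (induction xs) auto

lemma list_mult_map: "list_mult G f (map h xs) = list_mult G (f \<circ> h) xs"
  by (induction xs) auto

lemma list_mult_update_carrier [simp]: "list_mult (G\<lparr>carrier := S\<rparr>) f xs = list_mult G f xs"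
  by (induction xs) auto

lemma list_mult_in_subgroup:
  "subgroup T G \<Longrightarrow> (\<And>i. i \<in> set xs \<Longrightarrow> f i \<in> T) \<Longrightarrow> list_mult G f xs \<in> T"
  by (induction xs) (auto simp: subgroup.one_closed subgroup.m_closed)

lemma (in group_hom) hom_list_mult:
  assumes "\<And>i. i \<in> set xs \<Longrightarrow> f i \<in> carrier G"
  shows "h (list_mult G f xs) = list_mult H (\<lambda>i. h (f i)) xs"
  using assms
proof (induction xs)
  case (Cons a xs)
  have "list_mult G f xs \<in> carrier G"
    using Cons.prems by (intro list_mult_in_subgroup G.subgroup_self) auto
  with Cons show ?case by simp
qed simp

context group
begin

lemma list_mult_closed [simp]:
  "(\<And>i. i \<in> set xs \<Longrightarrow> f i \<in> carrier G) \<Longrightarrow> list_mult G f xs \<in> carrier G"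
  by (intro list_mult_in_subgroup subgroup_self)

lemma list_mult_append:
  assumes "\<And>i. i \<in> set xs \<union> set ys \<Longrightarrow> f i \<in> carrier G"
  shows "list_mult G f (xs @ ys) = list_mult G f xs \<otimes> list_mult G f ys"
  using assms by (induction xs) (auto simp: m_assoc)

lemma list_mult_one: "(\<And>i. i \<in> set xs \<Longrightarrow> f i = \<one>) \<Longrightarrow> list_mult G f xs = \<one>"
  by (induction xs) auto

lemma list_mult_single:
  assumes "distinct xs" "t \<in> set xs" "f t \<in> carrier G" "\<And>i. i \<in> set xs \<Longrightarrow> i \<noteq> t \<Longrightarrow> f i = \<one>"
  shows "list_mult G f xs = f t"
  using assms
proof (induction xs)
  case (Cons a xs)
  show ?case
  proof (cases "a = t")
    case True
    then have "list_mult G f xs = \<one>" using Cons.prems by (intro list_mult_one) auto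
    then show ?thesis using True Cons.prems by simp
  next
    case False
    then show ?thesis using Cons by auto
  qed
qed simp

lemma list_mult_central:
  assumes "\<And>i. i \<in> set xs \<Longrightarrow> f i \<in> group_center G"
  shows "list_mult G f xs \<in> group_center G"
  using assms by (intro list_mult_in_subgroup center_subgroup)

lemma list_mult_distrib:
  assumes "\<And>i. i \<in> set xs \<Longrightarrow> f i \<in> carrier G" "\<And>i. i \<in> set xs \<Longrightarrow> e i \<in> group_center G"
  shows "list_mult G (\<lambda>i. f i \<otimes> e i) xs = list_mult G f xs \<otimes> list_mult G e xs"
  using assms
proof (induction xs)
  case (Cons a xs)
  have "list_mult G e xs \<in> carrier G"
    using Cons.prems list_mult_central[of xs e] by simp
  moreover have "list_mult G f xs \<in> carrier G" using Cons.prems by simp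
  ultimately show ?case
    using Cons by (simp add: m_assoc center_commutes_left)
qed simp

lemma list_mult_int_pow:
  assumes "\<And>i. i \<in> set xs \<Longrightarrow> f i \<in> group_center G"
  shows "list_mult G (\<lambda>i. f i [^] (k::int)) xs = list_mult G f xs [^] k"
  using assms
proof (induction xs)
  case (Cons a xs)
  have "list_mult G f xs \<in> group_center G"
    using Cons.prems by (intro list_mult_central) auto
  then show ?case
    using Cons by (simp add: int_pow_mult_distrib center_commutes)
qed simp

end


section \<open>Normal forms in groups of class two\<close>

definition index_pairs :: "nat \<Rightarrow> (nat \<times> nat) list" where
  "index_pairs n = concat (map (\<lambda>j. map (\<lambda>i. (j, i)) [1..<j]) [1..<Suc n])"

lemma index_pairs_Suc: "index_pairs (Suc n) = index_pairs n @ map (\<lambda>i. (Suc n, i)) [1..<Suc n]"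
  by (simp add: index_pairs_def)

lemma set_index_pairs [simp]: "set (index_pairs n) = V_index n"
proof (induction n)
  case 0
  show ?case by (auto simp: index_pairs_def V_index_def)
next
  case (Suc n)
  have "V_index (Suc n) = V_index n \<union> (\<lambda>i. (Suc n, i)) ` set [1..<Suc n]"
    by (auto simp: V_index_def image_iff)
  with Suc show ?case unfolding index_pairs_Suc by (metis set_append set_map)
qed

lemma distinct_index_pairs: "distinct (index_pairs n)"
proof (induction n)
  case (Suc n)
  then show ?case unfolding index_pairs_Suc by (auto simp: distinct_map inj_on_def V_index_def)
qed (simp add: index_pairs_def)

definition ordered_product :: "('a, 'm) monoid_scheme \<Rightarrow> (nat \<Rightarrow> 'a) \<Rightarrow> nat \<Rightarrow> (nat \<Rightarrow> int) \<Rightarrow> 'a" where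
  "ordered_product G x n a = list_mult G (\<lambda>i. x i [^]\<^bsub>G\<^esub> a i) [1..<Suc n]"

definition commutator_product ::
    "('a, 'm) monoid_scheme \<Rightarrow> (nat \<Rightarrow> 'a) \<Rightarrow> nat \<Rightarrow> (nat \<times> nat \<Rightarrow> int) \<Rightarrow> 'a" where
  "commutator_product G x n b =
     list_mult G (\<lambda>(j, i). group_commutator G (x j) (x i) [^]\<^bsub>G\<^esub> b (j, i)) (index_pairs n)"

definition normal_form ::
    "('a, 'm) monoid_scheme \<Rightarrow> (nat \<Rightarrow> 'a) \<Rightarrow> nat \<Rightarrow> (nat \<Rightarrow> int) \<Rightarrow> (nat \<times> nat \<Rightarrow> int) \<Rightarrow> 'a" where
  "normal_form G x n a b = ordered_product G x n a \<otimes>\<^bsub>G\<^esub> commutator_product G x n b"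

lemma commutator_product_cong:
  "(\<And>j i. (j, i) \<in> V_index n \<Longrightarrow> b (j, i) = b' (j, i)) \<Longrightarrow>
    commutator_product G x n b = commutator_product G x n b'"
  unfolding commutator_product_def by (intro list_mult_cong) auto

lemma index_bounds:
  assumes "(j, i) \<in> V_index n" shows "j \<in> {1..n}" "i \<in> {1..n}"
  using assms by (auto simp: V_index_def)

context group_hom
begin

lemma hom_commutator:
  "x \<in> carrier G \<Longrightarrow> y \<in> carrier G \<Longrightarrow>
    h (group_commutator G x y) = group_commutator H (h x) (h y)"
  by (simp add: group_commutator_def)

lemma hom_ordered_product:
  assumes "x ` {1..n} \<subseteq> carrier G"
  shows "h (ordered_product G x n a) = ordered_product H (h \<circ> x) n a"
proof -
  have x: "x i \<in> carrier G" if "i \<in> set [1..<Suc n]" for i using assms that by auto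
  have "h (ordered_product G x n a) = list_mult H (\<lambda>i. h (x i [^]\<^bsub>G\<^esub> a i)) [1..<Suc n]"
    unfolding ordered_product_def using x by (intro hom_list_mult) (simp del: upt_Suc)
  also have "\<dots> = ordered_product H (h \<circ> x) n a"
    unfolding ordered_product_def using x by (intro list_mult_cong) (simp del: upt_Suc add: hom_int_pow)
  finally show ?thesis .
qed

lemma hom_commutator_product:
  assumes "x ` {1..n} \<subseteq> carrier G"
  shows "h (commutator_product G x n b) = commutator_product H (h \<circ> x) n b"
proof -
  have x: "x j \<in> carrier G" "x i \<in> carrier G" if "(j, i) \<in> V_index n" for j i
    using assms index_bounds[OF that] by auto
  have "h (commutator_product G x n b) =
      list_mult H (\<lambda>s. h (case s of (j, i) \<Rightarrow> group_commutator G (x j) (x i) [^]\<^bsub>G\<^esub> b (j, i)))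
        (index_pairs n)"
    unfolding commutator_product_def
    using x by (intro hom_list_mult) auto
  also have "\<dots> = commutator_product H (h \<circ> x) n b"
    unfolding commutator_product_def using x
    by (intro list_mult_cong) (auto simp: hom_int_pow hom_commutator)
  finally show ?thesis .
qed

end

locale class_2_group = group +
  assumes commutator_central:
    "x \<in> carrier G \<Longrightarrow> y \<in> carrier G \<Longrightarrow> group_commutator G x y \<in> group_center G"

lemma class_2_groupI:
  assumes "group G" "nilpotent_of_class_at_most G 2"
  shows "class_2_group G"
proof -
  interpret group G by fact
  show ?thesis
  proof
    fix x y assume xy: "x \<in> carrier G" "y \<in> carrier G"
    show "group_commutator G x y \<in> group_center G"
    proof (rule group_centerI)
      fix z assume z: "z \<in> carrier G"
      let ?c = "group_commutator G x y"
      have "?c \<in> lower_central_series G 2"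
        using xy by (auto simp: numeral_2_eq_2 commutator_subgroup_def intro!: generate.incl)
      then have "group_commutator G ?c z \<in> lower_central_series G 3"
        using z by (auto simp: numeral_2_eq_2 numeral_3_eq_3 commutator_subgroup_def intro!: generate.incl)
      then have "group_commutator G ?c z = \<one>\<^bsub>G\<^esub>"
        using assms(2) by (simp add: nilpotent_of_class_at_most_def)
      then show "?c \<otimes>\<^bsub>G\<^esub> z = z \<otimes>\<^bsub>G\<^esub> ?c"
        using xy z commutator_eq_one_iff by simp
    qed (use xy in simp)
  qed
qed

context class_2_group
begin

lemma commutator_list_mult_right:
  assumes "y \<in> carrier G" "\<And>i. i \<in> set xs \<Longrightarrow> f i \<in> carrier G"
  shows "group_commutator G y (list_mult G f xs) = list_mult G (\<lambda>i. group_commutator G y (f i)) xs"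
  using assms commutator_central
  by (intro group_hom.hom_list_mult[of G G "group_commutator G y"] commutator_hom_right) auto

lemma commutator_int_pows:
  assumes "x \<in> carrier G" "y \<in> carrier G"
  shows "group_commutator G (x [^] (k::int)) (y [^] (l::int)) = group_commutator G x y [^] (k * l)"
proof -
  have "group_commutator G (x [^] k) y = inv (group_commutator G y (x [^] k))"
    using assms by (simp add: inv_commutator)
  also have "\<dots> = group_commutator G x y [^] k"
    using assms commutator_central
    by (simp add: commutator_int_pow_right int_pow_inv[symmetric] inv_commutator)
  finally have "group_commutator G (x [^] k) y = group_commutator G x y [^] k" .
  then show ?thesis
    using assms commutator_central by (simp add: commutator_int_pow_right int_pow_pow)
qed

end

locale class_2_family = class_2_group +
  fixes x :: "nat \<Rightarrow> 'a" and n :: nat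
  assumes x_closed: "i \<in> {1..n} \<Longrightarrow> x i \<in> carrier G"
begin

lemma pair_closed:
  assumes "(j, i) \<in> V_index n" shows "x j \<in> carrier G" "x i \<in> carrier G"
  using x_closed index_bounds[OF assms] by auto

lemma commutator_pow_central:
  "(j, i) \<in> V_index n \<Longrightarrow> group_commutator G (x j) (x i) [^] (k::int) \<in> group_center G"
  by (auto intro!: center_int_pow commutator_central intro: pair_closed)

lemma commutator_product_central: "commutator_product G x n b \<in> group_center G"
  unfolding commutator_product_def
  by (intro list_mult_central) (auto intro: commutator_pow_central)

lemma commutator_product_closed [simp]: "commutator_product G x n b \<in> carrier G"
  using commutator_product_central by simp

lemma ordered_product_closed [simp]: "ordered_product G x n a \<in> carrier G"
  unfolding ordered_product_def by (intro list_mult_closed int_pow_closed x_closed) auto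

lemma normal_form_closed [simp]: "normal_form G x n a b \<in> carrier G"
  by (simp add: normal_form_def)

lemma commutator_product_add:
  "commutator_product G x n (\<lambda>s. b s + b' s) = commutator_product G x n b \<otimes> commutator_product G x n b'"
proof -
  have "commutator_product G x n (\<lambda>s. b s + b' s) =
     list_mult G (\<lambda>s. (case s of (j, i) \<Rightarrow> group_commutator G (x j) (x i) [^] b (j, i)) \<otimes>
        (case s of (j, i) \<Rightarrow> group_commutator G (x j) (x i) [^] b' (j, i))) (index_pairs n)"
    unfolding commutator_product_def using pair_closed
    by (intro list_mult_cong) (auto simp: int_pow_mult)
  also have "\<dots> = commutator_product G x n b \<otimes> commutator_product G x n b'"
    unfolding commutator_product_def using commutator_pow_central
    by (intro list_mult_distrib) (auto intro: center_closed)
  finally show ?thesis .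
qed

lemma commutator_product_zero [simp]: "commutator_product G x n (\<lambda>s. 0) = \<one>"
  unfolding commutator_product_def by (intro list_mult_one) auto

end

lemma (in class_2_family) smaller_family: "m \<le> n \<Longrightarrow> class_2_family G x m"
  by unfold_locales (auto intro: x_closed)

text \<open>Collecting equal generators costs one commutator for every pair that is exchanged.\<close>

lemma (in class_2_family) ordered_product_mult:
  "ordered_product G x n a \<otimes> ordered_product G x n a' =
    ordered_product G x n (\<lambda>i. a i + a' i) \<otimes> commutator_product G x n (\<lambda>(j, i). a j * a' i)"
proof -
  have "m \<le> n \<Longrightarrow> ordered_product G x m a \<otimes> ordered_product G x m a' =
    ordered_product G x m (\<lambda>i. a i + a' i) \<otimes> commutator_product G x m (\<lambda>(j, i). a j * a' i)" for m
  proof (induction m)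
    case 0
    show ?case by (simp add: ordered_product_def commutator_product_def index_pairs_def)
  next
    case (Suc m)
    interpret m: class_2_family G x m using Suc.prems by (intro smaller_family) simp
    let ?y = "x (Suc m)"
    have y: "?y \<in> carrier G" using Suc.prems by (intro x_closed) simp
    have step: "ordered_product G x (Suc m) e = ordered_product G x m e \<otimes> ?y [^] e (Suc m)" for e
    proof -
      have "[1..<Suc (Suc m)] = [1..<Suc m] @ [Suc m]" by simp
      then show ?thesis
        unfolding ordered_product_def using y m.x_closed
        by (simp only:, subst list_mult_append) (auto simp del: upt_Suc)
    qed
    let ?P = "ordered_product G x m" and ?C = "commutator_product G x m (\<lambda>(j, i). a j * a' i)"
    let ?s = "a (Suc m)" and ?t = "a' (Suc m)"
    \<comment> \<open>Moving \<open>y\<^sup>s\<close> past the second product creates the commutators that belong to the new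
      index pairs.\<close>
    define D where "D = group_commutator G (?y [^] ?s) (?P a')"
    have D: "D \<in> group_center G" unfolding D_def using y by (intro commutator_central) auto
    have C: "?C \<in> group_center G" by (rule m.commutator_product_central)
    have "D = list_mult G (\<lambda>i. group_commutator G (?y [^] ?s) (x i [^] a' i)) [1..<Suc m]"
      unfolding D_def ordered_product_def using y m.x_closed
      by (intro commutator_list_mult_right) (auto simp del: upt_Suc)
    also have "\<dots> = list_mult G (\<lambda>i. group_commutator G ?y (x i) [^] (?s * a' i)) [1..<Suc m]"
      using y m.x_closed by (intro list_mult_cong) (auto simp: commutator_int_pows simp del: upt_Suc)
    finally have D_eq: "D = list_mult G (\<lambda>i. group_commutator G ?y (x i) [^] (?s * a' i)) [1..<Suc m]" .
    have "commutator_product G x (Suc m) (\<lambda>(j, i). a j * a' i) = ?C \<otimes> D"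
      unfolding commutator_product_def index_pairs_Suc D_eq using y m.x_closed m.pair_closed
      by (subst list_mult_append) (auto simp: list_mult_map comp_def simp del: upt_Suc)
    moreover have "?P a \<otimes> ?y [^] ?s \<otimes> (?P a' \<otimes> ?y [^] ?t) =
        ?P (\<lambda>i. a i + a' i) \<otimes> ?y [^] (?s + ?t) \<otimes> (?C \<otimes> D)"
    proof -
      have "?P a \<otimes> ?y [^] ?s \<otimes> (?P a' \<otimes> ?y [^] ?t) = ?P a \<otimes> (?y [^] ?s \<otimes> ?P a') \<otimes> ?y [^] ?t"
        using y by (simp add: m_assoc)
      also have "?y [^] ?s \<otimes> ?P a' = ?P a' \<otimes> ?y [^] ?s \<otimes> D"
        unfolding D_def using y by (intro mult_commutator) auto
      also have "?P a \<otimes> (?P a' \<otimes> ?y [^] ?s \<otimes> D) \<otimes> ?y [^] ?t =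
          (?P a \<otimes> ?P a') \<otimes> (?y [^] ?s \<otimes> ?y [^] ?t) \<otimes> D"
        using y D by (simp add: m_assoc center_commutes[of D])
      also have "\<dots> = (?P (\<lambda>i. a i + a' i) \<otimes> ?C) \<otimes> ?y [^] (?s + ?t) \<otimes> D"
        using Suc y by (simp add: int_pow_mult)
      also have "\<dots> = ?P (\<lambda>i. a i + a' i) \<otimes> ?y [^] (?s + ?t) \<otimes> (?C \<otimes> D)"
        using y D C
        by (simp add: m_assoc center_commutes_left[of ?C "?P (\<lambda>i. a i + a' i)"]
            center_commutes_left[of ?C "?y [^] (?s + ?t)"])
      finally show ?thesis .
    qed
    ultimately show ?case by (simp add: step)
  qed
  then show ?thesis by simp
qed

context class_2_family
begin

text \<open>The right-hand side is the multiplication of the free group of class two in integer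
  coordinates, so \<open>normal_form\<close> is the homomorphism from that group that sends its generators to
  the given elements.\<close>

lemma normal_form_mult:
  "normal_form G x n a b \<otimes> normal_form G x n a' b' =
    normal_form G x n (\<lambda>i. a i + a' i) (\<lambda>(j, i). b (j, i) + b' (j, i) + a j * a' i)"
proof -
  let ?P = "ordered_product G x n" and ?C = "commutator_product G x n"
  have "normal_form G x n a b \<otimes> normal_form G x n a' b' = (?P a \<otimes> ?P a') \<otimes> (?C b \<otimes> ?C b')"
    unfolding normal_form_def using commutator_product_central[of b]
    by (simp add: m_assoc center_commutes_left)
  also have "\<dots> = ?P (\<lambda>i. a i + a' i) \<otimes> (?C (\<lambda>(j, i). a j * a' i) \<otimes> (?C b \<otimes> ?C b'))"
    by (simp add: ordered_product_mult m_assoc)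
  also have "?C (\<lambda>(j, i). a j * a' i) \<otimes> (?C b \<otimes> ?C b') =
      ?C (\<lambda>(j, i). b (j, i) + b' (j, i) + a j * a' i)"
    by (subst commutator_product_add[symmetric])+ (auto intro: commutator_product_cong)
  finally show ?thesis by (simp add: normal_form_def)
qed

lemma normal_form_one: "normal_form G x n (\<lambda>i. 0) (\<lambda>s. 0) = \<one>"
  unfolding normal_form_def ordered_product_def by (simp add: list_mult_one del: upt_Suc)

lemma normal_form_central: "normal_form G x n (\<lambda>i. 0) b = commutator_product G x n b"
  unfolding normal_form_def ordered_product_def by (simp add: list_mult_one del: upt_Suc)

lemma normal_form_generator:
  assumes "r \<in> {1..n}"
  shows "normal_form G x n (\<lambda>i. if i = r then 1 else 0) (\<lambda>s. 0) = x r"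
proof -
  have "list_mult G (\<lambda>i. x i [^] (if i = r then 1 else 0 :: int)) [1..<Suc n] =
      x r [^] (if r = r then 1 else 0 :: int)"
    using assms x_closed by (intro list_mult_single) (auto simp del: upt_Suc)
  then show ?thesis
    using assms x_closed by (simp add: normal_form_def ordered_product_def del: upt_Suc)
qed

lemma inv_normal_form:
  "inv (normal_form G x n a b) = normal_form G x n (\<lambda>i. - a i) (\<lambda>(j, i). a j * a i - b (j, i))"
proof (rule inv_equality)
  show "normal_form G x n (\<lambda>i. - a i) (\<lambda>(j, i). a j * a i - b (j, i)) \<otimes> normal_form G x n a b = \<one>"
    unfolding normal_form_mult by (simp flip: normal_form_one add: case_prod_beta')
qed auto

lemma generate_normal_form:
  assumes "y \<in> generate G (x ` {1..n})"
  shows "\<exists>a b. y = normal_form G x n a b"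
  using assms
proof (induction y rule: generate.induct)
  case one
  show ?case by (intro exI) (rule normal_form_one[symmetric])
next
  case (incl h)
  then obtain r where "r \<in> {1..n}" "h = x r" by blast
  then have "h = normal_form G x n (\<lambda>i. if i = r then 1 else 0) (\<lambda>s. 0)"
    by (simp add: normal_form_generator)
  then show ?case by blast
next
  case (inv h)
  then obtain r where "r \<in> {1..n}" "h = x r" by blast
  then have "h = normal_form G x n (\<lambda>i. if i = r then 1 else 0) (\<lambda>s. 0)"
    by (simp add: normal_form_generator)
  then show ?case using inv_normal_form by blast
next
  case (eng h1 h2)
  then show ?case using normal_form_mult by blast
qed

lemma commutator_normal_form:
  "group_commutator G (normal_form G x n a b) (normal_form G x n a' b') =
    commutator_product G x n (\<lambda>(j, i). a j * a' i - a' j * a i)"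
  by (rule commutator_unique)
    (simp_all flip: normal_form_central add: normal_form_mult case_prod_beta algebra_simps)

text \<open>The commutators inherit the exponent of the given elements by bilinearity.\<close>

lemma normal_form_mod:
  assumes "\<And>i. i \<in> {1..n} \<Longrightarrow> x i [^] p = \<one>"
    and "\<And>i. i \<in> {1..n} \<Longrightarrow> int p dvd a i - a' i"
    and "\<And>j i. (j, i) \<in> V_index n \<Longrightarrow> int p dvd b (j, i) - b' (j, i)"
  shows "normal_form G x n a b = normal_form G x n a' b'"
proof -
  have pow: "y [^] k = y [^] l" if "y \<in> carrier G" "y [^] p = \<one>" "int p dvd k - l" for y and k l :: int
  proof -
    obtain m where "k = int p * m + l" using \<open>int p dvd k - l\<close> by (auto simp: dvd_def algebra_simps)
    moreover have "y [^] (int p * m) = \<one>"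
      using that(1,2) by (metis int_pow_int int_pow_one int_pow_pow)
    ultimately show ?thesis using that(1) by (simp add: int_pow_mult[symmetric] int_pow_mult)
  qed
  have "group_commutator G (x j) (x i) [^] p = \<one>" if "(j, i) \<in> V_index n" for j i
  proof -
    have "x j \<in> carrier G" "x i \<in> carrier G" "x i [^] p = \<one>"
      using that assms(1) index_bounds(2)[OF that] pair_closed by auto
    then show ?thesis
      using commutator_int_pow_right[of "x j" "x i" "int p"] commutator_central
      by (simp add: int_pow_int)
  qed
  then have "commutator_product G x n b = commutator_product G x n b'"
    unfolding commutator_product_def using pair_closed assms(3)
    by (intro list_mult_cong) (auto intro!: pow)
  moreover have "ordered_product G x n a = ordered_product G x n a'"
    unfolding ordered_product_def using x_closed assms(1,2)
    by (intro list_mult_cong) (auto intro!: pow simp del: upt_Suc)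
  ultimately show ?thesis by (simp add: normal_form_def)
qed

text \<open>If \<open>p\<close> did not divide \<open>a\<^sub>m\<close>, the relation would place \<open>x\<^sub>m\<close> in \<open>T Z(G)\<close>, where \<open>T\<close> is
  generated by the other elements. Then \<open>G = T Z(G)\<close>, so all commutators lie in \<open>T\<close>, and the same
  relation places \<open>x\<^sub>m\<close> in \<open>T\<close> itself, against minimality.\<close>

lemma minimal_generation_exponents:
  assumes p: "Factorial_Ring.prime p" and exponent: "\<And>y. y \<in> carrier G \<Longrightarrow> y [^] p = \<one>"
    and minimal: "minimally_generated_by G n x"
    and relation: "normal_form G x n a b = \<one>" and m: "m \<in> {1..n}"
  shows "int p dvd a m"
proof (rule ccontr)
  assume "\<not> int p dvd a m"
  with p have "coprime (a m) (int p)"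
    by (metis coprime_commute prime_imp_coprime prime_nat_int_transfer)
  then obtain u where u: "int p dvd a m * u - 1"
    using cong_solve_coprime_int[of "a m" "int p"] by (auto simp: cong_iff_dvd_diff)
  have gen: "generate G (x ` {1..n}) = carrier G"
    using minimal by (simp add: minimally_generated_by_def)
  define S where "S = x ` ({1..n} - {m})"
  define T where "T = generate G S"
  have S: "S \<subseteq> carrier G" using x_closed by (auto simp: S_def)
  have T: "subgroup T G" unfolding T_def using S by (rule generate_is_subgroup)
  have xT: "x i \<in> T" if "i \<in> {1..n}" "i \<noteq> m" for i
    using that by (auto simp: T_def S_def intro: generate.incl)
  have powT: "y [^] k \<in> T" if "y \<in> T" for y and k :: int
    using T that by (rule subgroup_int_pow_closed)
  note TI = subgroup.m_closed[OF T] subgroup.m_inv_closed[OF T] subgroup.mem_carrier[OF T]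
  let ?Z = "group_center G"
  have xm: "x m \<in> carrier G" using m by (rule x_closed)
  have split: "[1..<Suc n] = [1..<m] @ m # [Suc m..<Suc n]"
    using m upt_add_eq_append[of 1 m "Suc n - m"] upt_conv_Cons[of m "Suc n"] by auto
  define A where "A = list_mult G (\<lambda>i. x i [^] a i) [1..<m]"
  define B where "B = list_mult G (\<lambda>i. x i [^] a i) [Suc m..<Suc n]"
  have A: "A \<in> T" unfolding A_def using m by (intro list_mult_in_subgroup[OF T] powT xT) auto
  have B: "B \<in> T" unfolding B_def using m by (intro list_mult_in_subgroup[OF T] powT xT) auto
  let ?C = "commutator_product G x n b"
  have "ordered_product G x n a = A \<otimes> (x m [^] a m \<otimes> B)"
    unfolding ordered_product_def split A_def B_def using m x_closed
    by (subst list_mult_append) (auto simp del: upt_Suc)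
  with relation have rel: "A \<otimes> (x m [^] a m \<otimes> B) \<otimes> ?C = \<one>" by (simp add: normal_form_def)
  have xm_pow: "x m [^] a m = inv A \<otimes> (inv ?C \<otimes> inv B)"
  proof -
    have "A \<otimes> (x m [^] a m \<otimes> B) = inv ?C"
      using rel xm TI A B inv_equality[OF rel] by simp
    then have "inv A \<otimes> (inv ?C \<otimes> inv B) = inv A \<otimes> (A \<otimes> (x m [^] a m \<otimes> B) \<otimes> inv B)" by simp
    then show ?thesis using xm TI A B
      by (simp add: m_assoc inv_mult_cancel_left)
  qed
  have xm_from_pow: "x m = (x m [^] a m) [^] u"
  proof -
    obtain k where "a m * u = int p * k + 1" using u by (auto simp: dvd_def algebra_simps)
    moreover have "x m [^] (int p * k) = \<one>"
      using xm exponent by (metis int_pow_int int_pow_one int_pow_pow)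
    ultimately have "x m [^] (a m * u) = x m" using xm by (simp add: int_pow_mult)
    then show ?thesis using xm by (simp add: int_pow_pow)
  qed
  define TZ where "TZ = {t \<otimes> z | t z. t \<in> T \<and> z \<in> ?Z}"
  have TZ: "subgroup TZ G"
  proof (rule subgroupI)
    show "TZ \<subseteq> carrier G" using TI by (auto simp: TZ_def)
    show "TZ \<noteq> {}" using subgroup.one_closed[OF T] subgroup.one_closed[OF center_subgroup] by (auto simp: TZ_def)
  next
    fix y assume "y \<in> TZ"
    then obtain t z where tz: "t \<in> T" "z \<in> ?Z" "y = t \<otimes> z" by (auto simp: TZ_def)
    then have "inv y = inv t \<otimes> inv z"
      using tz TI center_commutes[of "inv z" "inv t"] subgroup.m_inv_closed[OF center_subgroup]
      by (simp add: inv_mult_group)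
    then show "inv y \<in> TZ"
      using TI(2)[OF tz(1)] subgroup.m_inv_closed[OF center_subgroup tz(2)]
      by (auto simp: TZ_def)
  next
    fix y y' assume "y \<in> TZ" "y' \<in> TZ"
    then obtain t z t' z' where tz: "t \<in> T" "z \<in> ?Z" "y = t \<otimes> z" "t' \<in> T" "z' \<in> ?Z" "y' = t' \<otimes> z'"
      by (auto simp: TZ_def)
    then have "y \<otimes> y' = (t \<otimes> t') \<otimes> (z \<otimes> z')"
      using TI center_commutes_left[of z t' z'] by (simp add: m_assoc)
    then show "y \<otimes> y' \<in> TZ"
      using TI(1)[OF tz(1,4)] subgroup.m_closed[OF center_subgroup tz(2,5)] by (auto simp: TZ_def)
  qed
  have TTZ: "T \<subseteq> TZ"
    using TI subgroup.one_closed[OF center_subgroup] by (force simp: TZ_def)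
  have ZTZ: "?Z \<subseteq> TZ"
    using subgroup.one_closed[OF T] by (force simp: TZ_def)
  have "x m [^] a m \<in> TZ"
    unfolding xm_pow using TTZ ZTZ A B TI commutator_product_central[of b]
    by (intro subgroup.m_closed[OF TZ] subgroup.m_inv_closed[OF TZ]) auto
  then have "x m \<in> TZ" using subgroup_int_pow_closed[OF TZ] xm_from_pow by metis
  then have "x ` {1..n} \<subseteq> TZ" using xT TTZ by blast
  then have G_TZ: "carrier G \<subseteq> TZ"
    using generate_subgroup_incl[OF _ TZ] gen by blast
  have commT: "group_commutator G y y' \<in> T" if yy: "y \<in> carrier G" "y' \<in> carrier G" for y y'
  proof -
    obtain t z t' z' where tz: "t \<in> T" "z \<in> ?Z" "y = t \<otimes> z" "t' \<in> T" "z' \<in> ?Z" "y' = t' \<otimes> z'"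
      using yy G_TZ by (auto simp: TZ_def subset_iff) metis
    then have "group_commutator G y y' = group_commutator G (z \<otimes> t) (z' \<otimes> t')"
      using TI by (simp add: center_commutes)
    also have "\<dots> = group_commutator G t t'"
      using tz TI by (simp add: center_absorbed_left center_absorbed_right)
    finally show ?thesis using tz TI by (simp add: group_commutator_def)
  qed
  have "?C \<in> T"
    unfolding commutator_product_def using x_closed
    by (intro list_mult_in_subgroup[OF T]) (auto intro!: powT commT intro: pair_closed)
  then have "x m [^] a m \<in> T" unfolding xm_pow using A B TI by auto
  then have "x m \<in> T" using powT xm_from_pow by metis
  then have "x ` {1..n} \<subseteq> T" using xT by blast
  then have "carrier G \<subseteq> T" using generate_subgroup_incl[OF _ T] gen by blast
  then have "generate G S = carrier G" using T_def TI by blast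
  moreover have "card S < n"
    using m card_image_le[of "{1..n} - {m}" x] by (auto simp: S_def)
  ultimately show False
    using minimal S by (auto simp: minimally_generated_by_def S_def)
qed

end


section \<open>The free product and its universal property\<close>

locale group_family =
  fixes I :: "'i set" and F :: "'i \<Rightarrow> 'a monoid"
  assumes group_F: "i \<in> I \<Longrightarrow> group (F i)"
begin

abbreviation "words \<equiv> free_words I F"
abbreviation "equivalent \<equiv> word_equiv I F"

lemma Nil_words [simp]: "[] \<in> words"
  by (simp add: free_words_def)

lemma append_words [simp]: "u @ v \<in> words \<longleftrightarrow> u \<in> words \<and> v \<in> words"
  by (auto simp: free_words_def)

lemma Cons_words [simp]: "(i, a) # u \<in> words \<longleftrightarrow> i \<in> I \<and> a \<in> carrier (F i) \<and> u \<in> words"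
  by (auto simp: free_words_def)

lemma factor_one [simp]: "i \<in> I \<Longrightarrow> \<one>\<^bsub>F i\<^esub> \<in> carrier (F i)"
  using group_F by (simp add: group.is_monoid)

lemma factor_mult [simp]:
  "i \<in> I \<Longrightarrow> a \<in> carrier (F i) \<Longrightarrow> b \<in> carrier (F i) \<Longrightarrow> a \<otimes>\<^bsub>F i\<^esub> b \<in> carrier (F i)"
  using group_F by (simp add: group.is_monoid monoid.m_closed)

lemma equivalent_words: "equivalent u v \<Longrightarrow> u \<in> words \<and> v \<in> words"
  by (induction rule: word_equiv.induct) auto

lemma equivalent_context:
  assumes "equivalent u v" "s \<in> words" "t \<in> words"
  shows "equivalent (s @ u @ t) (s @ v @ t)"
  using assms(1)
proof (induction rule: word_equiv.induct)
  case (refl w)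
  then show ?case using assms by (intro word_equiv.refl) simp
next
  case (one u v i)
  then show ?case using assms word_equiv.one[of "s @ u" I F "v @ t" i] by simp
next
  case (mult u v i a b)
  then show ?case using assms word_equiv.mult[of "s @ u" I F "v @ t" i a b] by simp
qed (blast intro: word_equiv.sym word_equiv.trans)+

lemma equivalent_append:
  assumes "equivalent u u'" "equivalent v v'"
  shows "equivalent (u @ v) (u' @ v')"
proof -
  have "equivalent ([] @ u @ v) ([] @ u' @ v)"
    using assms equivalent_words by (intro equivalent_context) auto
  moreover have "equivalent (u' @ v @ []) (u' @ v' @ [])"
    using assms equivalent_words by (intro equivalent_context) auto
  ultimately show ?thesis by (auto intro: word_equiv.trans)
qed

lemma word_class_eq: "equivalent u v \<Longrightarrow> word_class I F u = word_class I F v"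
  unfolding word_class_def by (auto intro: word_equiv.sym word_equiv.trans)

lemma word_class_mult:
  assumes "u \<in> words" "v \<in> words"
  shows "word_class I F u \<otimes>\<^bsub>free_product I F\<^esub> word_class I F v = word_class I F (u @ v)"
proof -
  have "word_class I F (u' @ v') = word_class I F (u @ v)"
    if "u' \<in> word_class I F u" "v' \<in> word_class I F v" for u' v'
    using that unfolding word_class_def[of I F u] word_class_def[of I F v]
    by (intro word_class_eq[symmetric] equivalent_append) auto
  then have "(\<Union>u'\<in>word_class I F u. \<Union>v'\<in>word_class I F v. word_class I F (u' @ v')) =
      (\<Union>u'\<in>word_class I F u. \<Union>v'\<in>word_class I F v. word_class I F (u @ v))"
    by simp
  also have "u \<in> word_class I F u" "v \<in> word_class I F v"
    using assms by (auto simp: word_class_def intro: word_equiv.refl)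
  then have "(\<Union>u'\<in>word_class I F u. \<Union>v'\<in>word_class I F v. word_class I F (u @ v)) =
      word_class I F (u @ v)"
    by blast
  finally show ?thesis by (simp add: free_product_def)
qed

lemma carrier_free_product: "carrier (free_product I F) = word_class I F ` words"
  by (simp add: free_product_def)

lemma one_free_product: "\<one>\<^bsub>free_product I F\<^esub> = word_class I F []"
  by (simp add: free_product_def)

lemma word_class_closed: "u \<in> words \<Longrightarrow> word_class I F u \<in> carrier (free_product I F)"
  by (simp add: carrier_free_product)

lemma left_inverse_word: "u \<in> words \<Longrightarrow> \<exists>v\<in>words. equivalent (v @ u) []"
proof (induction u)
  case Nil
  show ?case by (rule bexI[of _ "[]"]) (auto intro: word_equiv.refl)
next
  case (Cons l u)
  obtain i a where l: "l = (i, a)" by (cases l)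
  with Cons obtain v where v: "v \<in> words" "equivalent (v @ u) []" by auto
  have ia: "i \<in> I" "a \<in> carrier (F i)" "u \<in> words" using Cons.prems l by auto
  let ?b = "inv\<^bsub>F i\<^esub> a"
  have b: "?b \<in> carrier (F i)" "?b \<otimes>\<^bsub>F i\<^esub> a = \<one>\<^bsub>F i\<^esub>"
    using group_F[OF ia(1)] ia(2) by (auto simp: group.inv_closed group.l_inv)
  have "equivalent (v @ [(i, ?b), (i, a)] @ u) (v @ [(i, ?b \<otimes>\<^bsub>F i\<^esub> a)] @ u)"
    using v ia b by (intro word_equiv.mult) auto
  moreover have "equivalent (v @ [(i, ?b \<otimes>\<^bsub>F i\<^esub> a)] @ u) (v @ u)"
    unfolding b(2) using v ia by (intro word_equiv.one) auto
  ultimately have "equivalent ((v @ [(i, ?b)]) @ l # u) []"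
    using v(2) l by (auto intro: word_equiv.trans)
  moreover have "v @ [(i, ?b)] \<in> words" using v ia b by simp
  ultimately show ?case by blast
qed

lemma group_free_product: "group (free_product I F)"
proof (rule groupI)
  fix A assume "A \<in> carrier (free_product I F)"
  then obtain u where u: "u \<in> words" "A = word_class I F u" by (auto simp: carrier_free_product)
  show "\<one>\<^bsub>free_product I F\<^esub> \<otimes>\<^bsub>free_product I F\<^esub> A = A"
    using u by (simp add: one_free_product word_class_mult)
  obtain v where "v \<in> words" "equivalent (v @ u) []" using left_inverse_word u by blast
  moreover from this(2) have "word_class I F (v @ u) = word_class I F []" by (rule word_class_eq)
  ultimately have "word_class I F v \<otimes>\<^bsub>free_product I F\<^esub> A = \<one>\<^bsub>free_product I F\<^esub>"
    "word_class I F v \<in> carrier (free_product I F)"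
    using u by (simp_all add: word_class_mult one_free_product word_class_closed)
  then show "\<exists>B\<in>carrier (free_product I F). B \<otimes>\<^bsub>free_product I F\<^esub> A = \<one>\<^bsub>free_product I F\<^esub>"
    by blast
next
  fix A B assume "A \<in> carrier (free_product I F)" "B \<in> carrier (free_product I F)"
  then obtain u v where "u \<in> words" "v \<in> words" "A = word_class I F u" "B = word_class I F v"
    unfolding carrier_free_product by blast
  then show "A \<otimes>\<^bsub>free_product I F\<^esub> B \<in> carrier (free_product I F)"
    by (simp add: word_class_mult word_class_closed)
next
  fix A B C
  assume "A \<in> carrier (free_product I F)" "B \<in> carrier (free_product I F)" "C \<in> carrier (free_product I F)"
  then obtain u v w where "u \<in> words" "v \<in> words" "w \<in> words"
    "A = word_class I F u" "B = word_class I F v" "C = word_class I F w"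
    unfolding carrier_free_product by blast
  then show "A \<otimes>\<^bsub>free_product I F\<^esub> B \<otimes>\<^bsub>free_product I F\<^esub> C =
      A \<otimes>\<^bsub>free_product I F\<^esub> (B \<otimes>\<^bsub>free_product I F\<^esub> C)"
    by (simp add: word_class_mult)
next
  show "\<one>\<^bsub>free_product I F\<^esub> \<in> carrier (free_product I F)"
    unfolding one_free_product by (rule word_class_closed) (rule Nil_words)
qed

text \<open>Evaluating a word letter by letter is invariant under the two elementary moves.\<close>

lemma free_product_universal:
  assumes Q: "group Q" and f: "\<And>i. i \<in> I \<Longrightarrow> f i \<in> hom (F i) Q"
  shows "\<exists>h \<in> hom (free_product I F) Q. \<forall>i\<in>I. \<forall>a\<in>carrier (F i). h (word_class I F [(i, a)]) = f i a"
proof -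
  interpret Q: group Q by fact
  define ev where "ev u = list_mult Q (\<lambda>(i, a). f i a) u" for u
  have letter: "f i a \<in> carrier Q" if "i \<in> I" "a \<in> carrier (F i)" for i a
    using f[OF that(1)] that(2) by (auto simp: hom_def)
  have letters: "(\<lambda>(i, a). f i a) l \<in> carrier Q" if "u \<in> words" "l \<in> set u" for u l
    using that letter by (auto simp: free_words_def)
  have closed: "ev u \<in> carrier Q" if "u \<in> words" for u
    unfolding ev_def using letters[OF that] by (rule Q.list_mult_closed)
  have append: "ev (u @ v) = ev u \<otimes>\<^bsub>Q\<^esub> ev v" if "u \<in> words" "v \<in> words" for u v
    unfolding ev_def using letters that by (intro Q.list_mult_append) blast
  have append3: "ev (u @ w @ v) = ev u \<otimes>\<^bsub>Q\<^esub> (ev w \<otimes>\<^bsub>Q\<^esub> ev v)"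
    if "u \<in> words" "v \<in> words" "w \<in> words" for u v w
    using that by (simp add: append)
  have single: "ev [(i, a)] = f i a" if "i \<in> I" "a \<in> carrier (F i)" for i a
    using letter[OF that] by (simp add: ev_def)
  have respects: "ev u = ev v" if "equivalent u v" for u v
    using that
  proof (induction rule: word_equiv.induct)
    case (one u v i)
    have "f i \<one>\<^bsub>F i\<^esub> = \<one>\<^bsub>Q\<^esub>" using f one group_F Q by (intro hom_one) auto
    then have "ev [(i, \<one>\<^bsub>F i\<^esub>)] = \<one>\<^bsub>Q\<^esub>" using one by (simp add: single)
    then show ?case using one closed[of v] append3[of u v "[(i, \<one>\<^bsub>F i\<^esub>)]"] append[of u v] by simp
  next
    case (mult u v i a b)
    have "ev [(i, a), (i, b)] = ev [(i, a \<otimes>\<^bsub>F i\<^esub> b)]"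
      using f[of i] mult letter by (simp add: ev_def hom_mult)
    then show ?case
      using mult append3[of u v "[(i, a), (i, b)]"] append3[of u v "[(i, a \<otimes>\<^bsub>F i\<^esub> b)]"] by simp
  qed auto
  have on_class: "the_elem (ev ` word_class I F u) = ev u" if "u \<in> words" for u
  proof -
    have "ev v = ev u" if "v \<in> word_class I F u" for v
      using that respects[of u v] by (simp add: word_class_def)
    moreover have "u \<in> word_class I F u"
      using that by (simp add: word_class_def word_equiv.refl)
    ultimately have "ev ` word_class I F u = {ev u}" by blast
    then show ?thesis by simp
  qed
  define h where "h A = the_elem (ev ` A)" for A
  have h: "h (word_class I F u) = ev u" if "u \<in> words" for u
    using on_class[OF that] by (simp add: h_def)
  have "h \<in> hom (free_product I F) Q"
  proof (rule homI)
    fix A assume "A \<in> carrier (free_product I F)"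
    then obtain u where "u \<in> words" "A = word_class I F u"
      unfolding carrier_free_product by blast
    then show "h A \<in> carrier Q" by (simp add: h closed)
  next
    fix A B assume "A \<in> carrier (free_product I F)" "B \<in> carrier (free_product I F)"
    then obtain u v where "u \<in> words" "v \<in> words" "A = word_class I F u" "B = word_class I F v"
      unfolding carrier_free_product by blast
    then show "h (A \<otimes>\<^bsub>free_product I F\<^esub> B) = h A \<otimes>\<^bsub>Q\<^esub> h B"
      by (simp add: word_class_mult h append)
  qed
  moreover have "h (word_class I F [(i, a)]) = f i a" if "i \<in> I" "a \<in> carrier (F i)" for i a
    using that by (simp add: h single)
  ultimately show ?thesis by blast
qed

lemma letter_hom:
  assumes "i \<in> I"
  shows "(\<lambda>a. word_class I F [(i, a)]) \<in> hom (F i) (free_product I F)"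
proof (rule homI)
  fix a b assume "a \<in> carrier (F i)" "b \<in> carrier (F i)"
  then show "word_class I F [(i, a \<otimes>\<^bsub>F i\<^esub> b)] =
      word_class I F [(i, a)] \<otimes>\<^bsub>free_product I F\<^esub> word_class I F [(i, b)]"
    using assms word_equiv.mult[of "[]" I F "[]" i a b]
    by (simp add: word_class_mult word_class_eq)
qed (use assms in \<open>simp add: word_class_closed\<close>)

end

section \<open>The nilpotent product\<close>

(* Index sets keep the form {1..n} under simplification. *)
declare One_nat_def [simp del]

lemma (in group) commutator_conj:
  assumes "a \<in> carrier G" "b \<in> carrier G" "y \<in> carrier G"
  shows "y \<otimes> group_commutator G a b \<otimes> inv y =
    group_commutator G (y \<otimes> a \<otimes> inv y) (y \<otimes> b \<otimes> inv y)"
  using assms by (simp add: group_commutator_def word_simps)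

lemma (in group) lower_central_series_normal: "lower_central_series G (Suc k) \<lhd> G"
proof (induction k)
  case 0
  show ?case by (simp add: normal_self)
next
  case (Suc k)
  let ?A = "lower_central_series G (Suc k)"
  have sub: "a \<in> carrier G" if "a \<in> ?A" for a
    using Suc that by (meson normal_imp_subgroup subgroup.mem_carrier)
  have conj: "y \<otimes> a \<otimes> inv y \<in> ?A" if "a \<in> ?A" "y \<in> carrier G" for a y
    using Suc that by (simp add: normal_inv_iff)
  show ?case
    unfolding lower_central_series.simps commutator_subgroup_def
  proof (rule normal_generateI)
    fix c y assume y: "y \<in> carrier G" and
      "c \<in> {group_commutator G a b |a b. a \<in> ?A \<and> b \<in> carrier G}"
    then obtain a b where "a \<in> ?A" "b \<in> carrier G" "c = group_commutator G a b" by blast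
    then show "y \<otimes> c \<otimes> inv y \<in> {group_commutator G a b |a b. a \<in> ?A \<and> b \<in> carrier G}"
      using y sub conj by (force simp: commutator_conj)
  qed (use sub in auto)
qed

text \<open>Products of commutators go to the centre of a group of class two, so their commutators with
  anything are killed.\<close>

lemma (in group_hom) lower_central_series_3_kernel:
  assumes "class_2_group H" "y \<in> lower_central_series G 3"
  shows "h y = \<one>\<^bsub>H\<^esub>"
proof -
  interpret H: class_2_group H by fact
  let ?A = "lower_central_series G 2"
  have A: "subgroup ?A G"
    using G.lower_central_series_normal[of 1] by (simp add: numeral_2_eq_2 normal_imp_subgroup)
  have central: "h a \<in> group_center H" if "a \<in> ?A" for a
  proof -
    have "h ` {group_commutator G a b |a b. a \<in> carrier G \<and> b \<in> carrier G} \<subseteq> group_center H"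
      using H.commutator_central by (auto simp: hom_commutator)
    then have "generate H (h ` {group_commutator G a b |a b. a \<in> carrier G \<and> b \<in> carrier G})
        \<subseteq> group_center H"
      using H.center_subgroup by (rule H.generate_subgroup_incl)
    moreover have "h ` ?A = generate H (h ` {group_commutator G a b |a b. a \<in> carrier G \<and> b \<in> carrier G})"
      unfolding numeral_2_eq_2 lower_central_series.simps commutator_subgroup_def
      by (rule generate_img[symmetric]) auto
    ultimately show ?thesis using that by auto
  qed
  have sub: "{group_commutator G a b |a b. a \<in> ?A \<and> b \<in> carrier G} \<subseteq> kernel G H h"
  proof safe
    fix a b assume ab: "a \<in> ?A" "b \<in> carrier G"
    then have "a \<in> carrier G" using A subgroup.mem_carrier by metis
    then show "group_commutator G a b \<in> kernel G H h"
      using ab central[of a] H.center_commutes[of "h a" "h b"]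
      by (simp add: kernel_def hom_commutator H.commutator_eq_one_iff)
  qed
  have "lower_central_series G 3 = generate G {group_commutator G a b |a b. a \<in> ?A \<and> b \<in> carrier G}"
    by (simp add: numeral_3_eq_3 numeral_2_eq_2 commutator_subgroup_def)
  also have "\<dots> \<subseteq> kernel G H h"
    using sub subgroup_kernel by (rule G.generate_subgroup_incl)
  finally show ?thesis using assms(2) by (auto simp: kernel_def)
qed

locale cyclic_factors =
  fixes p n :: nat
  assumes p_gt_1: "1 < p"
begin

sublocale family: group_family "{1..n}" "\<lambda>_. integer_mod_group p"
  by (rule group_family.intro) (rule group_integer_mod_group)

abbreviation "FP \<equiv> free_product_cyclic p n"
abbreviation "NP \<equiv> nilpotent_product p n"
abbreviation "gen \<equiv> nilpotent_product_gen p n"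
abbreviation "letter i \<equiv> word_class {1..n} (\<lambda>_. integer_mod_group p) [(i, 1)]"
abbreviation "third_term \<equiv> lower_central_series FP 3"

lemma FP_group: "group FP"
  unfolding free_product_cyclic_def by (rule family.group_free_product)

lemma third_term_normal: "third_term \<lhd> FP"
  using group.lower_central_series_normal[OF FP_group, of 2] by (simp add: numeral_3_eq_3)

lemma NP_group: "group NP"
  unfolding nilpotent_product_def by (rule normal.factorgroup_is_group[OF third_term_normal])

lemma letter_closed: "i \<in> {1..n} \<Longrightarrow> letter i \<in> carrier FP"
  unfolding free_product_cyclic_def using p_gt_1 by (intro family.word_class_closed) simp

lemma projection_hom: "group_hom FP NP (\<lambda>a. third_term #>\<^bsub>FP\<^esub> a)"
  using normal.r_coset_hom_Mod[OF third_term_normal] FP_group NP_group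
  by (simp add: group_hom_def group_hom_axioms_def nilpotent_product_def)

lemma carrier_NP: "carrier NP = (\<lambda>a. third_term #>\<^bsub>FP\<^esub> a) ` carrier FP"
  unfolding nilpotent_product_def by (rule carrier_FactGroup)

lemma gen_eq: "gen i = third_term #>\<^bsub>FP\<^esub> letter i"
  by (simp add: nilpotent_product_gen_def)

text \<open>The generators \<open>[(i, 1)]\<close> suffice because a letter \<open>(i, a)\<close> is their \<open>a\<close>-th power.\<close>

lemma FP_generated: "generate FP (letter ` {1..n}) = carrier FP"
proof
  interpret FP: group FP by (rule FP_group)
  let ?T = "generate FP (letter ` {1..n})"
  have sub: "letter ` {1..n} \<subseteq> carrier FP" using letter_closed by blast
  have T: "subgroup ?T FP" using sub by (rule FP.generate_is_subgroup)
  show "?T \<subseteq> carrier FP" by (rule FP.generate_incl[OF sub])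
  have single: "word_class {1..n} (\<lambda>_. integer_mod_group p) [(i, a)] \<in> ?T"
    if i: "i \<in> {1..n}" and a: "a \<in> carrier (integer_mod_group p)" for i a
  proof -
    have "word_class {1..n} (\<lambda>_. integer_mod_group p) [(i, 1 [^]\<^bsub>integer_mod_group p\<^esub> a)] =
        letter i [^]\<^bsub>FP\<^esub> a"
      using p_gt_1 FP_group family.letter_hom[OF i] unfolding free_product_cyclic_def[symmetric]
      by (intro Group.hom_int_pow[where G = "integer_mod_group p"]) auto
    moreover have "1 [^]\<^bsub>integer_mod_group p\<^esub> a = a"
      using a p_gt_1 by (simp add: int_pow_integer_mod_group carrier_integer_mod_group)
    moreover have "letter i [^]\<^bsub>FP\<^esub> a \<in> ?T"
      using i by (intro FP.subgroup_int_pow_closed[OF T] generate.incl) auto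
    ultimately show ?thesis by simp
  qed
  show "carrier FP \<subseteq> ?T"
  proof
    fix A assume "A \<in> carrier FP"
    then obtain u where "u \<in> family.words" "A = word_class {1..n} (\<lambda>_. integer_mod_group p) u"
      by (auto simp: free_product_cyclic_def family.carrier_free_product)
    moreover have "word_class {1..n} (\<lambda>_. integer_mod_group p) u \<in> ?T" if "u \<in> family.words" for u
      using that
    proof (induction u)
      case Nil
      then show ?case
        using subgroup.one_closed[OF T] by (simp add: free_product_cyclic_def family.one_free_product)
    next
      case (Cons l u)
      obtain i a where l: "l = (i, a)" by (cases l)
      with Cons.prems have "word_class {1..n} (\<lambda>_. integer_mod_group p) (l # u) =
          word_class {1..n} (\<lambda>_. integer_mod_group p) [(i, a)] \<otimes>\<^bsub>FP\<^esub>
          word_class {1..n} (\<lambda>_. integer_mod_group p) u"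
        unfolding free_product_cyclic_def by (subst family.word_class_mult) auto
      then show ?case
        using Cons l single[of i a] subgroup.m_closed[OF T] by simp
    qed
    ultimately show "A \<in> ?T" by simp
  qed
qed

lemma NP_generated: "generate NP (gen ` {1..n}) = carrier NP"
proof -
  interpret group_hom FP NP "\<lambda>a. third_term #>\<^bsub>FP\<^esub> a" by (rule projection_hom)
  have "generate NP ((\<lambda>a. third_term #>\<^bsub>FP\<^esub> a) ` letter ` {1..n}) =
      (\<lambda>a. third_term #>\<^bsub>FP\<^esub> a) ` generate FP (letter ` {1..n})"
    using letter_closed by (intro generate_img) blast
  then show ?thesis
    by (simp add: FP_generated carrier_NP gen_eq image_image)
qed

lemma NP_class_2: "class_2_group NP"
proof -
  interpret group_hom FP NP "\<lambda>a. third_term #>\<^bsub>FP\<^esub> a" by (rule projection_hom)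
  show ?thesis
  proof
    fix A B assume "A \<in> carrier NP" "B \<in> carrier NP"
    then obtain a b where ab: "a \<in> carrier FP" "b \<in> carrier FP"
      "A = third_term #>\<^bsub>FP\<^esub> a" "B = third_term #>\<^bsub>FP\<^esub> b" by (auto simp: carrier_NP)
    show "group_commutator NP A B \<in> group_center NP"
    proof (rule group_centerI)
      fix C assume "C \<in> carrier NP"
      then obtain c where c: "c \<in> carrier FP" "C = third_term #>\<^bsub>FP\<^esub> c" by (auto simp: carrier_NP)
      let ?d = "group_commutator FP a b"
      have "?d \<in> lower_central_series FP 2"
        using ab by (auto simp: numeral_2_eq_2 commutator_subgroup_def intro!: generate.incl)
      then have "group_commutator FP ?d c \<in> third_term"
        using c by (auto simp: numeral_2_eq_2 numeral_3_eq_3 commutator_subgroup_def intro!: generate.incl)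
      then have "third_term #>\<^bsub>FP\<^esub> group_commutator FP ?d c = \<one>\<^bsub>NP\<^esub>"
        using ab c by (simp add: nilpotent_product_def G.coset_join2 normal_imp_subgroup[OF third_term_normal])
      then have "group_commutator NP (group_commutator NP A B) C = \<one>\<^bsub>NP\<^esub>"
        using ab c by (simp add: hom_commutator)
      then show "group_commutator NP A B \<otimes>\<^bsub>NP\<^esub> C = C \<otimes>\<^bsub>NP\<^esub> group_commutator NP A B"
        using \<open>A \<in> carrier NP\<close> \<open>B \<in> carrier NP\<close> \<open>C \<in> carrier NP\<close> H.commutator_eq_one_iff by simp
    qed (use \<open>A \<in> carrier NP\<close> \<open>B \<in> carrier NP\<close> in simp)
  qed
qed

sublocale NP: class_2_family NP gen n
proof -
  interpret class_2_group NP by (rule NP_class_2)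
  show "class_2_family NP gen n"
    using letter_closed by unfold_locales (auto simp: gen_eq carrier_NP)
qed

lemma gen_pow: 
  assumes "i \<in> {1..n}"
  shows "gen i [^]\<^bsub>NP\<^esub> p = \<one>\<^bsub>NP\<^esub>"
proof -
  interpret group_hom FP NP "\<lambda>a. third_term #>\<^bsub>FP\<^esub> a" by (rule projection_hom)
  have "word_class {1..n} (\<lambda>_. integer_mod_group p) [(i, 1 [^]\<^bsub>integer_mod_group p\<^esub> int p)] =
      letter i [^]\<^bsub>FP\<^esub> int p"
    using p_gt_1 FP_group family.letter_hom[OF assms] unfolding free_product_cyclic_def[symmetric]
    by (intro Group.hom_int_pow[where G = "integer_mod_group p"]) auto
  moreover have "1 [^]\<^bsub>integer_mod_group p\<^esub> int p = \<one>\<^bsub>integer_mod_group p\<^esub>"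
    by (simp add: int_pow_integer_mod_group)
  moreover have "word_class {1..n} (\<lambda>_. integer_mod_group p) [(i, \<one>\<^bsub>integer_mod_group p\<^esub>)] = \<one>\<^bsub>FP\<^esub>"
    using Group.hom_one[OF family.letter_hom[OF assms]] FP_group unfolding free_product_cyclic_def by simp
  ultimately have "letter i [^]\<^bsub>FP\<^esub> int p = \<one>\<^bsub>FP\<^esub>" by simp
  then have "gen i [^]\<^bsub>NP\<^esub> int p = \<one>\<^bsub>NP\<^esub>"
    unfolding gen_eq using letter_closed[OF assms] hom_one by (simp flip: hom_int_pow)
  then show ?thesis by (simp add: int_pow_int)
qed

text \<open>The powers of \<open>q\<^sub>i\<close> define a homomorphism from the \<open>i\<close>-th cyclic factor; together they give one
  from the free product, which kills the third term of the lower central series.\<close>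

lemma NP_universal:
  assumes Q: "class_2_group Q" and q: "\<And>i. i \<in> {1..n} \<Longrightarrow> q i \<in> carrier Q"
    and pow: "\<And>i. i \<in> {1..n} \<Longrightarrow> q i [^]\<^bsub>Q\<^esub> p = \<one>\<^bsub>Q\<^esub>"
  shows "\<exists>h \<in> hom NP Q. \<forall>i\<in>{1..n}. h (gen i) = q i"
proof -
  interpret Q: class_2_group Q by fact
  have "(\<lambda>a. q i [^]\<^bsub>Q\<^esub> a) \<in> hom (integer_mod_group p) Q" if i: "i \<in> {1..n}" for i
  proof (rule homI)
    fix a b :: int
    have "(a + b) = int p * ((a + b) div int p) + (a + b) mod int p" by simp
    then have "q i [^]\<^bsub>Q\<^esub> (a + b) =
        (q i [^]\<^bsub>Q\<^esub> int p) [^]\<^bsub>Q\<^esub> ((a + b) div int p) \<otimes>\<^bsub>Q\<^esub> q i [^]\<^bsub>Q\<^esub> ((a + b) mod int p)"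
      using q[OF i] by (metis Q.int_pow_mult Q.int_pow_pow)
    also have "q i [^]\<^bsub>Q\<^esub> int p = \<one>\<^bsub>Q\<^esub>" using pow[OF i] by (simp add: int_pow_int)
    finally show "q i [^]\<^bsub>Q\<^esub> (a \<otimes>\<^bsub>integer_mod_group p\<^esub> b) = q i [^]\<^bsub>Q\<^esub> a \<otimes>\<^bsub>Q\<^esub> q i [^]\<^bsub>Q\<^esub> b"
      using q[OF i] by (simp add: Q.int_pow_mult)
  qed (use q[OF i] in simp)
  then obtain k where k: "k \<in> hom FP Q"
    "\<And>i a. i \<in> {1..n} \<Longrightarrow> a \<in> carrier (integer_mod_group p) \<Longrightarrow>
      k (word_class {1..n} (\<lambda>_. integer_mod_group p) [(i, a)]) = q i [^]\<^bsub>Q\<^esub> a"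
    using family.free_product_universal[OF Q.is_group, of "\<lambda>i a. q i [^]\<^bsub>Q\<^esub> a"]
    unfolding free_product_cyclic_def by blast
  interpret k: group_hom FP Q k
    using k(1) FP_group Q.is_group by (simp add: group_hom_def group_hom_axioms_def)
  have "k a = k b" if "a \<in> carrier FP" "b \<in> carrier FP"
    "third_term #>\<^bsub>FP\<^esub> a = third_term #>\<^bsub>FP\<^esub> b" for a b
  proof -
    have "a \<in> third_term #>\<^bsub>FP\<^esub> b"
      using that k.G.rcos_self normal_imp_subgroup[OF third_term_normal] by blast
    then obtain c where c: "c \<in> third_term" "a = c \<otimes>\<^bsub>FP\<^esub> b" by (auto simp: r_coset_def)
    then have "c \<in> carrier FP"
      using normal_imp_subgroup[OF third_term_normal] subgroup.mem_carrier by metis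
    then show ?thesis
      using c that k.lower_central_series_3_kernel[OF Q c(1)] by simp
  qed
  then obtain h where "h \<in> hom NP Q" "\<And>a. a \<in> carrier FP \<Longrightarrow> h (third_term #>\<^bsub>FP\<^esub> a) = k a"
    using FactGroup_universal[OF k(1) third_term_normal] unfolding nilpotent_product_def by blast
  then show ?thesis
    using k(2) letter_closed p_gt_1 q by (intro bexI[of _ h]) (auto simp: gen_eq)
qed

lemma NP_normal_form: "A \<in> carrier NP \<Longrightarrow> \<exists>a b. A = normal_form NP gen n a b"
  using NP.generate_normal_form by (simp add: NP_generated)

end


section \<open>Coordinate spaces over the residue ring\<close>

definition reduce :: "nat \<Rightarrow> 's set \<Rightarrow> ('s \<Rightarrow> int) \<Rightarrow> 's \<Rightarrow> int" where
  "reduce p S f = (\<lambda>s\<in>S. f s mod int p)"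

lemma reduce_eq_iff: "reduce p S f = reduce p S f' \<longleftrightarrow> (\<forall>s\<in>S. int p dvd f s - f' s)"
  by (auto simp: reduce_def fun_eq_iff mod_eq_dvd_iff restrict_def)

lemma dvd_reduce_diff: "s \<in> S \<Longrightarrow> int p dvd f s - reduce p S f s"
  by (simp add: reduce_def mod_eq_dvd_iff[symmetric])

locale modulus =
  fixes p :: nat
  assumes p_gt_1: "1 < p"
begin

sublocale R: residues "int p" "residue_ring (int p)"
  using p_gt_1 by (intro residues.intro) auto

abbreviation "space S \<equiv> function_module (residue_ring (int p)) S"

lemma carrier_space: "carrier (space S) = S \<rightarrow>\<^sub>E {0..int p - 1}"
  by (simp add: function_module_def R.res_carrier_eq)

lemma reduce_closed [simp]: "reduce p S f \<in> carrier (space S)"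
  using p_gt_1 by (auto simp: carrier_space reduce_def)

lemma reduce_id: "v \<in> carrier (space S) \<Longrightarrow> reduce p S v = v"
  by (auto simp: carrier_space reduce_def PiE_iff fun_eq_iff extensional_def restrict_def)

lemma add_space:
  "reduce p S f \<oplus>\<^bsub>space S\<^esub> reduce p S f' = reduce p S (\<lambda>s. f s + f' s)"
  by (auto simp: function_module_def reduce_def R.res_add_eq mod_simps)

lemma zero_space: "\<zero>\<^bsub>space S\<^esub> = reduce p S (\<lambda>s. 0)"
  by (auto simp: function_module_def reduce_def R.res_zero_eq)

lemma smult_space: "a \<odot>\<^bsub>space S\<^esub> reduce p S f = reduce p S (\<lambda>s. a * f s)"
  by (auto simp: function_module_def reduce_def R.res_mult_eq mod_simps)

lemma in_spaceE:
  assumes "v \<in> carrier (space S)"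
  obtains f where "v = reduce p S f"
  using reduce_id[OF assms] by metis

lemma abelian_group_space: "abelian_group (space S)"
proof (rule abelian_groupI)
  fix v assume "v \<in> carrier (space S)"
  then obtain f where "v = reduce p S f" by (rule in_spaceE)
  then have "reduce p S (\<lambda>s. - f s) \<oplus>\<^bsub>space S\<^esub> v = \<zero>\<^bsub>space S\<^esub>"
    by (simp add: add_space zero_space)
  then show "\<exists>w\<in>carrier (space S). w \<oplus>\<^bsub>space S\<^esub> v = \<zero>\<^bsub>space S\<^esub>" by (meson reduce_closed)
qed (auto elim!: in_spaceE simp: add_space zero_space add_ac)

lemma module_space: "module (residue_ring (int p)) (space S)"
proof (rule moduleI)
  show "abelian_group (space S)" by (rule abelian_group_space)
  fix a b v w
  assume ab: "a \<in> carrier (residue_ring (int p))" "b \<in> carrier (residue_ring (int p))"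
    and v: "v \<in> carrier (space S)" and w: "w \<in> carrier (space S)"
  obtain f f' where f: "v = reduce p S f" "w = reduce p S f'" using v w by (metis in_spaceE)
  show "a \<odot>\<^bsub>space S\<^esub> v \<in> carrier (space S)" by (simp add: f smult_space)
  show "a \<odot>\<^bsub>space S\<^esub> (v \<oplus>\<^bsub>space S\<^esub> w) = a \<odot>\<^bsub>space S\<^esub> v \<oplus>\<^bsub>space S\<^esub> a \<odot>\<^bsub>space S\<^esub> w"
    by (simp add: f smult_space add_space distrib_left)
  show "(a \<oplus>\<^bsub>residue_ring (int p)\<^esub> b) \<odot>\<^bsub>space S\<^esub> v = a \<odot>\<^bsub>space S\<^esub> v \<oplus>\<^bsub>space S\<^esub> b \<odot>\<^bsub>space S\<^esub> v"
    by (simp add: f smult_space add_space R.res_add_eq) (simp add: reduce_def mod_simps distrib_right)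
  show "(a \<otimes>\<^bsub>residue_ring (int p)\<^esub> b) \<odot>\<^bsub>space S\<^esub> v = a \<odot>\<^bsub>space S\<^esub> (b \<odot>\<^bsub>space S\<^esub> v)"
    by (simp add: f smult_space R.res_mult_eq) (simp add: reduce_def mod_simps mult.assoc)
next
  fix v assume "v \<in> carrier (space S)"
  then show "\<one>\<^bsub>residue_ring (int p)\<^esub> \<odot>\<^bsub>space S\<^esub> v = v"
    by (auto elim!: in_spaceE simp: smult_space R.res_one_eq)
qed (rule R.cring)

lemma minus_space:
  "reduce p S f \<ominus>\<^bsub>space S\<^esub> reduce p S f' = reduce p S (\<lambda>s. f s - f' s)"
proof -
  interpret abelian_group "space S" by (rule abelian_group_space)
  have "\<ominus>\<^bsub>space S\<^esub> reduce p S f' = reduce p S (\<lambda>s. - f' s)"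
    by (rule minus_equality) (simp_all add: add_space zero_space)
  then show ?thesis by (simp add: a_minus_def add_space)
qed

lemma finsum_space:
  assumes "finite A"
  shows "(\<Oplus>\<^bsub>space S\<^esub>t\<in>A. reduce p S (F t)) = reduce p S (\<lambda>s. \<Sum>t\<in>A. F t s)"
proof -
  interpret abelian_group "space S" by (rule abelian_group_space)
  show ?thesis
    using assms by (induction A) (simp_all add: zero_space add_space Pi_def)
qed

lemma int_pow_space:
  "reduce p S f [^]\<^bsub>add_monoid (space S)\<^esub> (k::int) = reduce p S (\<lambda>s. k * f s)"
proof -
  interpret abelian_group "space S" by (rule abelian_group_space)
  have "(\<lambda>k::int. reduce p S (\<lambda>s. k * f s)) \<in> hom integer_group (add_monoid (space S))"
    by (rule homI) (simp_all add: add_space distrib_right)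
  from Group.hom_int_pow[OF this, of 1 k] show ?thesis
    using a_group by simp
qed

lemma list_mult_space:
  "list_mult (add_monoid (space S)) (\<lambda>t. reduce p S (F t)) ts =
    reduce p S (\<lambda>s. \<Sum>t\<leftarrow>ts. F t s)"
  by (induction ts) (simp_all add: zero_space add_space)

end

lemma finite_V_index [simp]: "finite (V_index n)"
  by (rule finite_subset[of _ "{1..n} \<times> {1..n}"]) (auto simp: V_index_def)

lemma finite_W_index [simp]: "finite (W_index n)"
  by (rule finite_subset[of _ "{1..n} \<times> {1..n} \<times> {1..n}"]) (auto simp: W_index_def)

section \<open>The commutator subgroup of the nilpotent product\<close>

text \<open>A group of class two in which the commutators \<open>[e\<^sub>j, e\<^sub>i]\<close> of the unit vectors are the
  independent vectors \<open>v\<^sub>j\<^sub>i\<close>: the multiplication of normal forms, reduced modulo \<open>p\<close>. It shows that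
  the commutators in the nilpotent product satisfy no unexpected relations.\<close>

definition coordinate_group :: "nat \<Rightarrow> nat \<Rightarrow> ((nat \<Rightarrow> int) \<times> (nat \<times> nat \<Rightarrow> int)) monoid" where
  "coordinate_group p n =
     \<lparr>carrier = range (\<lambda>a. reduce p UNIV a) \<times> range (\<lambda>b. reduce p (V_index n) b),
      monoid.mult = (\<lambda>(a, b) (a', b'). (reduce p UNIV (\<lambda>i. a i + a' i),
        reduce p (V_index n) (\<lambda>(j, i). b (j, i) + b' (j, i) + a j * a' i))),
      one = (reduce p UNIV (\<lambda>i. 0), reduce p (V_index n) (\<lambda>s. 0))\<rparr>"

definition coords :: "nat \<Rightarrow> nat \<Rightarrow> (nat \<Rightarrow> int) \<Rightarrow> (nat \<times> nat \<Rightarrow> int) \<Rightarrow> (nat \<Rightarrow> int) \<times> (nat \<times> nat \<Rightarrow> int)"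
  where "coords p n a b = (reduce p UNIV a, reduce p (V_index n) b)"

lemma coords_eq_iff:
  "coords p n a b = coords p n a' b' \<longleftrightarrow>
    (\<forall>i. int p dvd a i - a' i) \<and> (\<forall>(j, i)\<in>V_index n. int p dvd b (j, i) - b' (j, i))"
  by (auto simp: coords_def reduce_eq_iff)

lemma coords_mult:
  "coords p n a b \<otimes>\<^bsub>coordinate_group p n\<^esub> coords p n a' b' =
    coords p n (\<lambda>i. a i + a' i) (\<lambda>(j, i). b (j, i) + b' (j, i) + a j * a' i)"
proof -
  have "(x mod m + y mod m + u mod m * (w mod m)) mod m = (x + y + u * w) mod m" for x y u w m :: int
    by (intro mod_add_cong mod_mult_cong) simp_all
  then show ?thesis
    by (auto simp: coords_def coordinate_group_def reduce_def fun_eq_iff restrict_def mod_simps)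
qed

lemma carrier_coordinate_group:
  "A \<in> carrier (coordinate_group p n) \<longleftrightarrow> (\<exists>a b. A = coords p n a b)"
  by (auto simp: coords_def coordinate_group_def)

lemma one_coordinate_group: "\<one>\<^bsub>coordinate_group p n\<^esub> = coords p n (\<lambda>i. 0) (\<lambda>s. 0)"
  by (simp add: coords_def coordinate_group_def)

lemma coords_closed [simp]: "coords p n a b \<in> carrier (coordinate_group p n)"
  by (auto simp: carrier_coordinate_group)

lemma coordinate_group: "group (coordinate_group p n)"
proof (rule groupI)
  fix A B C assume "A \<in> carrier (coordinate_group p n)" "B \<in> carrier (coordinate_group p n)"
    "C \<in> carrier (coordinate_group p n)"
  then obtain a b a' b' a'' b'' where
    "A = coords p n a b" "B = coords p n a' b'" "C = coords p n a'' b''"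
    by (metis carrier_coordinate_group)
  then show "A \<otimes>\<^bsub>coordinate_group p n\<^esub> B \<otimes>\<^bsub>coordinate_group p n\<^esub> C =
      A \<otimes>\<^bsub>coordinate_group p n\<^esub> (B \<otimes>\<^bsub>coordinate_group p n\<^esub> C)"
    by (simp add: coords_mult coords_eq_iff algebra_simps)
next
  fix A assume "A \<in> carrier (coordinate_group p n)"
  then obtain a b where A: "A = coords p n a b" by (metis carrier_coordinate_group)
  show "\<one>\<^bsub>coordinate_group p n\<^esub> \<otimes>\<^bsub>coordinate_group p n\<^esub> A = A"
    by (simp add: A one_coordinate_group coords_mult coords_eq_iff)
  have "coords p n (\<lambda>i. - a i) (\<lambda>(j, i). a j * a i - b (j, i)) \<otimes>\<^bsub>coordinate_group p n\<^esub> A =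
      \<one>\<^bsub>coordinate_group p n\<^esub>"
    by (simp add: A one_coordinate_group coords_mult coords_eq_iff)
  then show "\<exists>B\<in>carrier (coordinate_group p n). B \<otimes>\<^bsub>coordinate_group p n\<^esub> A = \<one>\<^bsub>coordinate_group p n\<^esub>"
    by (meson coords_closed)
next
  fix A B assume "A \<in> carrier (coordinate_group p n)" "B \<in> carrier (coordinate_group p n)"
  then obtain a b a' b' where "A = coords p n a b" "B = coords p n a' b'"
    by (metis carrier_coordinate_group)
  then show "A \<otimes>\<^bsub>coordinate_group p n\<^esub> B \<in> carrier (coordinate_group p n)"
    by (simp add: coords_mult)
qed (simp add: one_coordinate_group)

lemma commutator_coords:
  "group_commutator (coordinate_group p n) (coords p n a b) (coords p n a' b') =
    coords p n (\<lambda>i. 0) (\<lambda>(j, i). a j * a' i - a' j * a i)"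
  by (rule group.commutator_unique[OF coordinate_group])
    (auto simp: coords_mult coords_eq_iff algebra_simps)

lemma coordinate_group_class_2: "class_2_group (coordinate_group p n)"
proof -
  interpret group "coordinate_group p n" by (rule coordinate_group)
  show ?thesis
  proof
    fix A B assume "A \<in> carrier (coordinate_group p n)" "B \<in> carrier (coordinate_group p n)"
    then obtain a b a' b' where AB: "A = coords p n a b" "B = coords p n a' b'"
      by (metis carrier_coordinate_group)
    show "group_commutator (coordinate_group p n) A B \<in> group_center (coordinate_group p n)"
    proof (rule group_centerI)
      fix C assume "C \<in> carrier (coordinate_group p n)"
      then obtain a'' b'' where "C = coords p n a'' b''" by (metis carrier_coordinate_group)
      then show "group_commutator (coordinate_group p n) A B \<otimes>\<^bsub>coordinate_group p n\<^esub> C =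
          C \<otimes>\<^bsub>coordinate_group p n\<^esub> group_commutator (coordinate_group p n) A B"
        by (simp add: AB commutator_coords coords_mult coords_eq_iff algebra_simps)
    qed (simp add: AB commutator_coords)
  qed
qed

lemma coords_generator_pow:
  "coords p n (\<lambda>k. if k = r then 1 else 0) (\<lambda>s. 0) [^]\<^bsub>coordinate_group p n\<^esub> (m::nat) =
    coords p n (\<lambda>k. if k = r then int m else 0) (\<lambda>s. 0)"
proof (induction m)
  case 0
  then show ?case by (simp add: one_coordinate_group coords_eq_iff)
next
  case (Suc m)
  then show ?case by (auto simp: coords_mult coords_eq_iff V_index_def)
qed

sublocale cyclic_factors \<subseteq> modulus
  by unfold_locales (rule p_gt_1)

context cyclic_factors
begin

abbreviation "NP' \<equiv> commutator_subgroup NP (carrier NP) (carrier NP)"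
abbreviation "V \<equiv> V_space p n"

lemma V_eq: "V = space (V_index n)"
  by (simp add: V_space_def)

lemma v_basis_eq: "v_basis p n j i = reduce p (V_index n) (\<lambda>s. if s = (j, i) then 1 else 0)"
  using p_gt_1 by (auto simp: v_basis_def basis_vector_def reduce_def R.res_zero_eq R.res_one_eq)

lemma commutators_closed: "{group_commutator NP a b |a b. a \<in> carrier NP \<and> b \<in> carrier NP} \<subseteq> carrier NP"
  by auto

lemma NP'_subgroup: "subgroup NP' NP"
  unfolding commutator_subgroup_def using commutators_closed by (rule NP.generate_is_subgroup)

lemma gen_commutator_NP': "(j, i) \<in> V_index n \<Longrightarrow> group_commutator NP (gen j) (gen i) \<in> NP'"
  unfolding commutator_subgroup_def using NP.pair_closed by (intro generate.incl) blast

lemma commutator_product_NP': "commutator_product NP gen n b \<in> NP'"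
  unfolding commutator_product_def using NP.subgroup_int_pow_closed[OF NP'_subgroup] gen_commutator_NP'
  by (intro list_mult_in_subgroup[OF NP'_subgroup]) auto

text \<open>Commutators of normal forms are products of powers of the \<open>[x\<^sub>j, x\<^sub>i]\<close>, by bilinearity.\<close>

lemma NP'_eq: "NP' = range (commutator_product NP gen n)"
proof
  have "subgroup (range (commutator_product NP gen n)) NP"
  proof (rule NP.subgroupI)
    fix A assume "A \<in> range (commutator_product NP gen n)"
    then obtain b where "A = commutator_product NP gen n b" by blast
    then have "inv\<^bsub>NP\<^esub> A = commutator_product NP gen n (\<lambda>s. - b s)"
      by (intro NP.inv_equality) (simp_all flip: NP.commutator_product_add)
    then show "inv\<^bsub>NP\<^esub> A \<in> range (commutator_product NP gen n)" by blast
  next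
    fix A B
    assume A: "A \<in> range (commutator_product NP gen n)" and B: "B \<in> range (commutator_product NP gen n)"
    from A obtain b where "A = commutator_product NP gen n b" by blast
    moreover from B obtain b' where "B = commutator_product NP gen n b'" by blast
    ultimately have "A \<otimes>\<^bsub>NP\<^esub> B = commutator_product NP gen n (\<lambda>s. b s + b' s)"
      by (simp add: NP.commutator_product_add)
    then show "A \<otimes>\<^bsub>NP\<^esub> B \<in> range (commutator_product NP gen n)"
      by (simp only: rangeI)
  qed auto
  moreover have "{group_commutator NP a b |a b. a \<in> carrier NP \<and> b \<in> carrier NP}
      \<subseteq> range (commutator_product NP gen n)"
  proof clarify
    fix A B assume "A \<in> carrier NP" "B \<in> carrier NP"
    then obtain a b a' b' where "A = normal_form NP gen n a b" "B = normal_form NP gen n a' b'"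
      using NP_normal_form by metis
    then show "group_commutator NP A B \<in> range (commutator_product NP gen n)"
      using NP.commutator_normal_form by blast
  qed
  ultimately show "NP' \<subseteq> range (commutator_product NP gen n)"
    unfolding commutator_subgroup_def by (intro NP.generate_subgroup_incl)
qed (use commutator_product_NP' in blast)

lemma commutator_product_reduce:
  "commutator_product NP gen n b = commutator_product NP gen n b'"
  if "reduce p (V_index n) b = reduce p (V_index n) b'"
  using that NP.normal_form_mod[OF gen_pow, of "\<lambda>i. 0" "\<lambda>i. 0" b b']
  by (auto simp: NP.normal_form_central reduce_eq_iff)

text \<open>This applies both to the isomorphism that is constructed below and to the one that is chosen in
  the definition of \<open>commutator_iso\<close>, so the two agree.\<close>

lemma hom_on_commutator_product:
  assumes h: "h \<in> hom (NP\<lparr>carrier := NP'\<rparr>) (add_monoid V)"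
    and basis: "\<And>j i. (j, i) \<in> V_index n \<Longrightarrow>
      h (group_commutator NP (gen j) (gen i)) = v_basis p n j i"
  shows "h (commutator_product NP gen n b) = reduce p (V_index n) b"
proof -
  let ?C = "NP\<lparr>carrier := NP'\<rparr>"
  have C: "group ?C" using NP'_subgroup by (rule NP.subgroup_imp_group)
  have "group (add_monoid V)"
    using abelian_group.a_group[OF abelian_group_space] by (simp add: V_eq)
  then interpret h: group_hom ?C "add_monoid V" h
    using C h by (simp add: group_hom_def group_hom_axioms_def)
  have "h (commutator_product NP gen n b) =
      h (list_mult ?C (\<lambda>(j, i). group_commutator NP (gen j) (gen i) [^]\<^bsub>?C\<^esub> b (j, i)) (index_pairs n))"
    unfolding commutator_product_def list_mult_update_carrier
    using NP.int_pow_consistent[OF NP'_subgroup] gen_commutator_NP'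
    by (intro arg_cong[of _ _ h] list_mult_cong) auto
  also have "\<dots> = list_mult (add_monoid V)
      (\<lambda>s. h (case s of (j, i) \<Rightarrow> group_commutator NP (gen j) (gen i) [^]\<^bsub>?C\<^esub> b (j, i))) (index_pairs n)"
    using gen_commutator_NP' h.G.int_pow_closed by (intro h.hom_list_mult) auto
  also have "\<dots> = list_mult (add_monoid V)
      (\<lambda>t. reduce p (V_index n) (\<lambda>s. b t * (if s = t then 1 else 0))) (index_pairs n)"
    using gen_commutator_NP'
    by (intro list_mult_cong) (auto simp: h.hom_int_pow basis v_basis_eq int_pow_space V_eq)
  also have "\<dots> = reduce p (V_index n) (\<lambda>s. \<Sum>t\<leftarrow>index_pairs n. b t * (if s = t then 1 else 0))"
    unfolding V_eq by (rule list_mult_space)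
  also have "\<dots> = reduce p (V_index n) b"
    by (auto simp: reduce_eq_iff sum_list_distinct_conv_sum_set[OF distinct_index_pairs]
        if_distrib[of "\<lambda>x. _ * x"] cong: if_cong)
  finally show ?thesis .
qed

text \<open>The universal property maps the nilpotent product to the coordinate group. On the commutator
  subgroup only the second coordinate is left; it takes \<open>\<Prod> [x\<^sub>j, x\<^sub>i]\<^bsup>b\<^esup>\<close> to \<open>b\<close> modulo \<open>p\<close>, and
  the product depends on no more than that.\<close>

lemma commutator_iso_exists:
  "\<exists>h. h \<in> iso (NP\<lparr>carrier := NP'\<rparr>) (add_monoid V) \<and>
    (\<forall>(j, i)\<in>V_index n. h (group_commutator NP (gen j) (gen i)) = v_basis p n j i)"
proof -
  let ?E = "coordinate_group p n"
  interpret E: class_2_group ?E by (rule coordinate_group_class_2)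
  define q where "q r = coords p n (\<lambda>k. if k = r then 1 else 0) (\<lambda>s. 0)" for r
  have "q i [^]\<^bsub>?E\<^esub> p = \<one>\<^bsub>?E\<^esub>" for i
    unfolding q_def coords_generator_pow one_coordinate_group by (simp add: coords_eq_iff)
  then obtain \<theta> where \<theta>: "\<theta> \<in> hom NP ?E" "\<And>i. i \<in> {1..n} \<Longrightarrow> \<theta> (gen i) = q i"
    using NP_universal[OF E.class_2_group_axioms, of q] by (auto simp: q_def)
  interpret \<theta>: group_hom NP ?E \<theta>
    using \<theta> NP_group E.is_group by (simp add: group_hom_def group_hom_axioms_def)
  define T where "T = range (coords p n (\<lambda>i. 0))"
  have T: "subgroup T ?E"
  proof (rule E.subgroupI)
    fix A assume "A \<in> T"
    then obtain b where "A = coords p n (\<lambda>i. 0) b" by (auto simp: T_def)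
    then have "inv\<^bsub>?E\<^esub> A = coords p n (\<lambda>i. 0) (\<lambda>s. - b s)"
      by (intro E.inv_equality) (auto simp: coords_mult one_coordinate_group coords_eq_iff)
    then show "inv\<^bsub>?E\<^esub> A \<in> T" by (simp add: T_def)
  qed (auto simp: T_def coords_mult)
  have in_T: "\<theta> A \<in> T" if A: "A \<in> NP'" for A
  proof -
    obtain b where b: "A = commutator_product NP gen n b" using A by (auto simp: NP'_eq)
    have "\<theta> A = commutator_product ?E (\<theta> \<circ> gen) n b"
      unfolding b using NP.x_closed by (intro \<theta>.hom_commutator_product) auto
    also have "\<dots> \<in> T"
      unfolding commutator_product_def
    proof (rule list_mult_in_subgroup[OF T], clarsimp)
      fix j i assume "(j, i) \<in> V_index n"
      then have "group_commutator ?E (\<theta> (gen j)) (\<theta> (gen i)) \<in> T"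
        using index_bounds \<theta>(2) by (auto simp: q_def commutator_coords T_def)
      then show "group_commutator ?E (\<theta> (gen j)) (\<theta> (gen i)) [^]\<^bsub>?E\<^esub> b (j, i) \<in> T"
        by (rule E.subgroup_int_pow_closed[OF T])
    qed
    finally show ?thesis .
  qed
  define h where "h A = snd (\<theta> A)" for A
  have h_hom: "h \<in> hom (NP\<lparr>carrier := NP'\<rparr>) (add_monoid V)"
  proof (rule homI)
    fix A assume "A \<in> carrier (NP\<lparr>carrier := NP'\<rparr>)"
    then show "h A \<in> carrier (add_monoid V)"
      using in_T[of A] by (auto simp: T_def h_def coords_def V_eq)
  next
    fix A B assume "A \<in> carrier (NP\<lparr>carrier := NP'\<rparr>)" "B \<in> carrier (NP\<lparr>carrier := NP'\<rparr>)"
    then have AB: "A \<in> NP'" "B \<in> NP'" by auto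
    then obtain b b' where bb: "\<theta> A = coords p n (\<lambda>i. 0) b" "\<theta> B = coords p n (\<lambda>i. 0) b'"
      using in_T[OF AB(1)] in_T[OF AB(2)] unfolding T_def by blast
    have "\<theta> (A \<otimes>\<^bsub>NP\<^esub> B) = \<theta> A \<otimes>\<^bsub>?E\<^esub> \<theta> B"
      using AB subgroup.mem_carrier[OF NP'_subgroup] by (intro \<theta>.hom_mult) auto
    then show "h (A \<otimes>\<^bsub>NP\<lparr>carrier := NP'\<rparr>\<^esub> B) = h A \<otimes>\<^bsub>add_monoid V\<^esub> h B"
      by (simp add: h_def bb coords_mult V_eq) (simp add: coords_def add_space case_prod_unfold)
  qed
  have basis: "h (group_commutator NP (gen j) (gen i)) = v_basis p n j i" if ji: "(j, i) \<in> V_index n" for j i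
  proof -
    have "\<theta> (group_commutator NP (gen j) (gen i)) = group_commutator ?E (q j) (q i)"
      using \<theta>(2) index_bounds[OF ji] NP.pair_closed[OF ji] by (simp add: \<theta>.hom_commutator)
    then show ?thesis
      unfolding q_def commutator_coords h_def using ji
      by (simp add: coords_def v_basis_eq reduce_eq_iff) (auto simp: V_index_def)
  qed
  note value_h = hom_on_commutator_product[OF h_hom basis]
  have "bij_betw h NP' (carrier V)"
    unfolding bij_betw_def
  proof
    show "inj_on h NP'"
      unfolding NP'_eq
    proof (rule inj_onI)
      fix A B
      assume A: "A \<in> range (commutator_product NP gen n)" and B: "B \<in> range (commutator_product NP gen n)"
        and AB: "h A = h B"
      from A obtain b where 1: "A = commutator_product NP gen n b" by blast
      from B obtain b' where 2: "B = commutator_product NP gen n b'" by blast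
      show "A = B" using AB unfolding 1 2 by (intro commutator_product_reduce) (simp add: value_h)
    qed
    have "v \<in> h ` NP'" if "v \<in> carrier V" for v
    proof (rule image_eqI)
      show "v = h (commutator_product NP gen n v)"
        using that by (simp add: value_h reduce_id V_eq)
    qed (rule commutator_product_NP')
    then show "h ` NP' = carrier V"
      using hom_carrier[OF h_hom] by auto
  qed
  then have "h \<in> iso (NP\<lparr>carrier := NP'\<rparr>) (add_monoid V)" using h_hom by (simp add: iso_def)
  then show ?thesis using basis by blast
qed

lemma commutator_iso_value:
  "commutator_iso p n (commutator_product NP gen n b) = reduce p (V_index n) b"
proof -
  have "commutator_iso p n \<in> iso (NP\<lparr>carrier := NP'\<rparr>) (add_monoid V) \<and>
    (\<forall>(j, i)\<in>V_index n. commutator_iso p n (group_commutator NP (gen j) (gen i)) = v_basis p n j i)"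
    unfolding commutator_iso_def by (rule someI_ex[OF commutator_iso_exists])
  then show ?thesis
    by (intro hom_on_commutator_product) (auto simp: iso_def)
qed

end

section \<open>The subspace determined by a group\<close>

lemma normal_form_cong:
  assumes "\<And>i. i \<in> {1..n} \<Longrightarrow> x i = y i"
  shows "normal_form G x n a b = normal_form G y n a b"
proof -
  have "ordered_product G x n a = ordered_product G y n a"
    unfolding ordered_product_def using assms by (intro list_mult_cong) (simp del: upt_Suc)
  moreover have "commutator_product G x n b = commutator_product G y n b"
    unfolding commutator_product_def
  proof (intro list_mult_cong, clarify)
    fix j i assume "(j, i) \<in> set (index_pairs n)"
    then have "x j = y j" "x i = y i" using assms index_bounds[of j i n] by auto
    then show "group_commutator G (x j) (x i) [^]\<^bsub>G\<^esub> b (j, i) =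
        group_commutator G (y j) (y i) [^]\<^bsub>G\<^esub> b (j, i)" by simp
  qed
  ultimately show ?thesis unfolding normal_form_def by (rule arg_cong2)
qed

text \<open>Minimal generation forces the kernel of the natural map into the commutator subgroup, where the
  isomorphism with \<open>V\<close> reads off the exponents of the \<open>[x\<^sub>j, x\<^sub>i]\<close>.\<close>

lemma determined_subspace_eq:
  assumes p: "Factorial_Ring.prime p" and G: "group G"
    and class_2: "nilpotent_of_class_at_most G 2"
    and exponent: "\<And>y. y \<in> carrier G \<Longrightarrow> y [^]\<^bsub>G\<^esub> p = \<one>\<^bsub>G\<^esub>"
    and minimal: "minimally_generated_by G n g"
  shows "determined_subspace p n G g =
    {v \<in> carrier (V_space p n). commutator_product G g n v = \<one>\<^bsub>G\<^esub>}"
proof -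
  interpret cyclic_factors p n by (rule cyclic_factors.intro) (rule prime_gt_1_nat[OF p])
  interpret G: class_2_group G using G class_2 by (rule class_2_groupI)
  interpret G: class_2_family G g n
    using minimal by unfold_locales (auto simp: minimally_generated_by_def)
  let ?\<eta> = "natural_map p n G g"
  have "\<exists>h \<in> hom NP G. \<forall>i\<in>{1..n}. h (gen i) = g i"
    using G.x_closed by (intro NP_universal G.class_2_group_axioms exponent)
  then have "\<exists>h. h \<in> hom NP G \<and> (\<forall>i\<in>{1..n}. h (gen i) = g i)" by (simp only: Bex_def)
  then have "?\<eta> \<in> hom NP G \<and> (\<forall>i\<in>{1..n}. ?\<eta> (gen i) = g i)"
    unfolding natural_map_def by (rule someI_ex)
  then have \<eta>: "?\<eta> \<in> hom NP G" "\<And>i. i \<in> {1..n} \<Longrightarrow> ?\<eta> (gen i) = g i" by auto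
  interpret \<eta>: group_hom NP G ?\<eta>
    using \<eta>(1) NP_group G by (simp add: group_hom_def group_hom_axioms_def)
  have gen_closed: "gen ` {1..n} \<subseteq> carrier NP" using NP.x_closed by blast
  have natural: "?\<eta> (normal_form NP gen n a b) = normal_form G g n a b" for a b
  proof -
    have "?\<eta> (normal_form NP gen n a b) = normal_form G (?\<eta> \<circ> gen) n a b"
      using gen_closed
      by (simp add: normal_form_def \<eta>.hom_ordered_product \<eta>.hom_commutator_product)
    also have "\<dots> = normal_form G g n a b" using \<eta>(2) by (intro normal_form_cong) simp
    finally show ?thesis .
  qed
  have G_mod: "commutator_product G g n b = commutator_product G g n b'"
    if "reduce p (V_index n) b = reduce p (V_index n) b'" for b b'
    using that G.normal_form_mod[of p "\<lambda>i. 0" "\<lambda>i. 0" b b'] exponent G.x_closed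
    by (auto simp: G.normal_form_central reduce_eq_iff)
  have kernel: "kernel NP G ?\<eta> = {commutator_product NP gen n b |b. commutator_product G g n b = \<one>\<^bsub>G\<^esub>}"
  proof (intro equalityI subsetI)
    fix A assume "A \<in> kernel NP G ?\<eta>"
    then have A: "A \<in> carrier NP" "?\<eta> A = \<one>\<^bsub>G\<^esub>" by (auto simp: kernel_def)
    obtain a b where ab: "A = normal_form NP gen n a b" using NP_normal_form A by blast
    then have rel: "normal_form G g n a b = \<one>\<^bsub>G\<^esub>" using A natural by simp
    then have a: "int p dvd a i" if "i \<in> {1..n}" for i
      using G.minimal_generation_exponents[OF p exponent minimal _ that] by blast
    have "A = normal_form NP gen n (\<lambda>i. 0) b"
      unfolding ab using a by (intro NP.normal_form_mod[OF gen_pow]) simp_all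
    moreover have "normal_form G g n (\<lambda>i. 0) b = \<one>\<^bsub>G\<^esub>"
      unfolding rel[symmetric] using a G.x_closed exponent
      by (intro G.normal_form_mod[where p = p]) simp_all
    ultimately show "A \<in> {commutator_product NP gen n b |b. commutator_product G g n b = \<one>\<^bsub>G\<^esub>}"
      by (auto simp: NP.normal_form_central G.normal_form_central)
  next
    fix A assume "A \<in> {commutator_product NP gen n b |b. commutator_product G g n b = \<one>\<^bsub>G\<^esub>}"
    then obtain b where "A = commutator_product NP gen n b" "commutator_product G g n b = \<one>\<^bsub>G\<^esub>" by blast
    then show "A \<in> kernel NP G ?\<eta>"
      using natural[of "\<lambda>i. 0" b] by (simp add: kernel_def NP.normal_form_central G.normal_form_central)
  qed
  show ?thesis
  proof (intro equalityI subsetI)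
    fix v assume "v \<in> determined_subspace p n G g"
    then obtain b where b: "v = reduce p (V_index n) b" "commutator_product G g n b = \<one>\<^bsub>G\<^esub>"
      by (auto simp: determined_subspace_def kernel commutator_iso_value)
    then have "commutator_product G g n v = \<one>\<^bsub>G\<^esub>"
      using G_mod[of v b] reduce_id[of v "V_index n"] by (simp add: b(1))
    then show "v \<in> {v \<in> carrier V. commutator_product G g n v = \<one>\<^bsub>G\<^esub>}"
      using b by (simp add: V_eq)
  next
    fix v assume "v \<in> {v \<in> carrier V. commutator_product G g n v = \<one>\<^bsub>G\<^esub>}"
    then have v: "v \<in> carrier V" "commutator_product G g n v = \<one>\<^bsub>G\<^esub>" by auto
    then have "v = commutator_iso p n (commutator_product NP gen n v)"
      by (simp add: commutator_iso_value reduce_id V_eq)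
    then show "v \<in> determined_subspace p n G g"
      unfolding determined_subspace_def kernel using v by blast
  qed
qed


section \<open>The maps between the coordinate spaces\<close>

definition phi_basis :: "nat \<Rightarrow> nat \<times> nat \<Rightarrow> nat \<times> nat \<times> nat \<Rightarrow> int" where
  "phi_basis r = (\<lambda>(j, i) s. if i \<le> r then of_bool (s = (j, i, r))
     else of_bool (s = (j, r, i)) - of_bool (s = (i, r, j)))"

text \<open>Integer representatives, so that sums need not be taken in the residue ring.\<close>

definition phi_int :: "nat \<Rightarrow> nat \<Rightarrow> (nat \<times> nat \<Rightarrow> int) \<Rightarrow> nat \<times> nat \<times> nat \<Rightarrow> int" where
  "phi_int n r v s = (\<Sum>t\<in>V_index n. v t * phi_basis r t s)"

context modulus
begin

lemma W_eq: "W_space p n = space (W_index n)"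
  by (simp add: W_space_def)

lemma w_basis_eq: "w_basis p n j i k = reduce p (W_index n) (\<lambda>s. of_bool (s = (j, i, k)))"
  using p_gt_1 by (auto simp: w_basis_def basis_vector_def reduce_def R.res_zero_eq R.res_one_eq)

lemma phi_map_eq: "phi_map p n r v = reduce p (W_index n) (phi_int n r v)"
proof -
  have "(\<lambda>t. v t \<odot>\<^bsub>W_space p n\<^esub> (case t of (j, i) \<Rightarrow> if i \<le> r then w_basis p n j i r
      else w_basis p n j r i \<ominus>\<^bsub>W_space p n\<^esub> w_basis p n i r j)) =
    (\<lambda>t. reduce p (W_index n) (\<lambda>s. v t * phi_basis r t s))"
    by (rule ext) (simp add: W_eq w_basis_eq minus_space smult_space phi_basis_def split: prod.split)
  then show ?thesis
    unfolding phi_map_def linear_extension_def phi_int_def W_eq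
    by (simp add: finsum_space)
qed

lemma phi_in_Y:
  "v \<in> U \<Longrightarrow> r \<in> {1..n} \<Longrightarrow> phi_map p n r v \<in> Y_space p n U"
  unfolding Y_space_def by (rule subsetD[OF hull_subset]) blast

lemma Y_minimal:
  assumes "submodule T (residue_ring (int p)) (W_space p n)"
    and "\<And>r v. r \<in> {1..n} \<Longrightarrow> v \<in> U \<Longrightarrow> phi_map p n r v \<in> T"
  shows "Y_space p n U \<subseteq> T"
  unfolding Y_space_def using assms by (intro hull_minimal) auto

lemma submodule_Y: "submodule (Y_space p n U) (residue_ring (int p)) (W_space p n)"
proof -
  interpret W: module "residue_ring (int p)" "W_space p n"
    unfolding W_eq by (rule module_space)
  let ?S = "\<lambda>T. submodule T (residue_ring (int p)) (W_space p n) \<and> (\<Union>r\<in>{1..n}. phi_map p n r ` U) \<subseteq> T"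
  have in_Y: "w \<in> Y_space p n U \<longleftrightarrow> (\<forall>T. ?S T \<longrightarrow> w \<in> T)" for w
    unfolding Y_space_def hull_def by blast
  have "Y_space p n U \<subseteq> carrier (W_space p n)"
    by (rule Y_minimal[OF W.carrier_is_submodule]) (simp add: phi_map_eq W_eq)
  then show ?thesis
  proof (rule W.submoduleI)
    show "\<zero>\<^bsub>W_space p n\<^esub> \<in> Y_space p n U"
      unfolding in_Y
    proof (intro allI impI)
      fix T assume "?S T"
      then have "subgroup T (add_monoid (W_space p n))" using submodule.axioms(1) by blast
      then show "\<zero>\<^bsub>W_space p n\<^esub> \<in> T" using subgroup.one_closed by fastforce
    qed
  next
    fix w assume "w \<in> Y_space p n U"
    then show "\<ominus>\<^bsub>W_space p n\<^esub> w \<in> Y_space p n U"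
      unfolding in_Y using W.submoduleE(3) by blast
  next
    fix w w' assume "w \<in> Y_space p n U" "w' \<in> Y_space p n U"
    then show "w \<oplus>\<^bsub>W_space p n\<^esub> w' \<in> Y_space p n U"
      unfolding in_Y using W.submoduleE(5) by blast
  next
    fix a w assume "a \<in> carrier (residue_ring (int p))" "w \<in> Y_space p n U"
    then show "a \<odot>\<^bsub>W_space p n\<^esub> w \<in> Y_space p n U"
      unfolding in_Y using W.submoduleE(4) by blast
  qed
qed

lemma Y_carrier: "Y_space p n U \<subseteq> carrier (space (W_index n))"
  using module.submoduleE(1)[OF module_space, of "Y_space p n U" "W_index n"] submodule_Y W_eq by metis

end

section \<open>Products of central powers\<close>

definition power_product :: "('a, 'm) monoid_scheme \<Rightarrow> ('s \<Rightarrow> 'a) \<Rightarrow> 's list \<Rightarrow> ('s \<Rightarrow> int) \<Rightarrow> 'a" where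
  "power_product G c xs f = list_mult G (\<lambda>s. c s [^]\<^bsub>G\<^esub> f s) xs"

context group
begin

lemma centralizer_subgroup:
  assumes c: "c \<in> carrier G"
  shows "subgroup {x \<in> carrier G. c \<otimes> x = x \<otimes> c} G"
proof (rule subgroupI)
  fix x assume "x \<in> {x \<in> carrier G. c \<otimes> x = x \<otimes> c}"
  then have x: "x \<in> carrier G" "c \<otimes> x = x \<otimes> c" by auto
  have "c \<otimes> inv x = inv x \<otimes> (x \<otimes> c) \<otimes> inv x"
    using x(1) c by (simp add: word_simps)
  also have "\<dots> = inv x \<otimes> (c \<otimes> x) \<otimes> inv x" by (simp only: x(2))
  also have "\<dots> = inv x \<otimes> c" using x(1) c by (simp add: word_simps)
  finally show "inv x \<in> {x \<in> carrier G. c \<otimes> x = x \<otimes> c}" using x by simp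
next
  fix x y assume "x \<in> {x \<in> carrier G. c \<otimes> x = x \<otimes> c}" "y \<in> {x \<in> carrier G. c \<otimes> x = x \<otimes> c}"
  then have xy: "x \<in> carrier G" "c \<otimes> x = x \<otimes> c" "y \<in> carrier G" "c \<otimes> y = y \<otimes> c" by auto
  have "c \<otimes> (x \<otimes> y) = x \<otimes> (c \<otimes> y)" using xy(1,2,3) c by (simp flip: m_assoc)
  also have "\<dots> = (x \<otimes> y) \<otimes> c" using xy c by (simp add: m_assoc)
  finally show "x \<otimes> y \<in> {x \<in> carrier G. c \<otimes> x = x \<otimes> c}" using xy by simp
qed (use c in auto)

lemma commutator_list_mult_left:
  assumes "z \<in> carrier G" "\<And>i. i \<in> set xs \<Longrightarrow> f i \<in> carrier G"
    and "\<And>i. i \<in> set xs \<Longrightarrow> group_commutator G (f i) z \<in> group_center G"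
  shows "group_commutator G (list_mult G f xs) z = list_mult G (\<lambda>i. group_commutator G (f i) z) xs"
  using assms by (induction xs) (simp_all add: commutator_mult_left)

lemma commutator_int_pow_left:
  assumes "c \<in> carrier G" "z \<in> carrier G" "group_commutator G c z \<in> group_center G"
  shows "group_commutator G (c [^] (k::int)) z = group_commutator G c z [^] k"
proof -
  have nat: "group_commutator G (c [^] (m::nat)) z = group_commutator G c z [^] m" for m
  proof (induction m)
    case (Suc m)
    have "group_commutator G c z [^] m \<in> group_center G"
      using center_int_pow[OF assms(3), of "int m"] by (simp add: int_pow_int)
    with Suc show ?case using assms by (simp add: commutator_mult_left)
  qed (use assms in simp)
  have central: "group_commutator G (c [^] (m::nat)) z \<in> group_center G" for m
    unfolding nat using center_int_pow[OF assms(3), of "int m"] by (simp add: int_pow_int)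
  have neg: "group_commutator G (inv (c [^] (m::nat))) z = inv (group_commutator G c z [^] m)" for m
  proof -
    have "group_commutator G c z [^] m \<otimes> group_commutator G (inv (c [^] m)) z =
        group_commutator G (c [^] m \<otimes> inv (c [^] m)) z"
      using assms central[of m] by (subst commutator_mult_left) (simp_all add: nat)
    also have "\<dots> = \<one>" using assms by simp
    finally show ?thesis using assms by (metis commutator_closed inv_closed inv_equality inv_inv nat_pow_closed)
  qed
  show ?thesis
    by (cases k rule: int_cases4) (simp_all add: int_pow_int nat int_pow_neg_int neg assms)
qed

lemma power_product_central:
  assumes "\<And>s. s \<in> set xs \<Longrightarrow> c s \<in> group_center G"
  shows "power_product G c xs f \<in> group_center G"
  unfolding power_product_def using assms by (intro list_mult_central center_int_pow)

lemma power_product_add: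
  assumes "\<And>s. s \<in> set xs \<Longrightarrow> c s \<in> group_center G"
  shows "power_product G c xs (\<lambda>s. f s + f' s) = power_product G c xs f \<otimes> power_product G c xs f'"
proof -
  have "power_product G c xs (\<lambda>s. f s + f' s) = list_mult G (\<lambda>s. c s [^] f s \<otimes> c s [^] f' s) xs"
    unfolding power_product_def using assms by (intro list_mult_cong) (simp add: int_pow_mult)
  also have "\<dots> = power_product G c xs f \<otimes> power_product G c xs f'"
    unfolding power_product_def using assms by (intro list_mult_distrib) (simp_all add: center_int_pow)
  finally show ?thesis .
qed

lemma power_product_scale:
  assumes "\<And>s. s \<in> set xs \<Longrightarrow> c s \<in> group_center G"
  shows "power_product G c xs (\<lambda>s. k * f s) = power_product G c xs f [^] k"
proof -
  have "power_product G c xs (\<lambda>s. k * f s) = list_mult G (\<lambda>s. (c s [^] f s) [^] k) xs"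
    unfolding power_product_def using assms by (intro list_mult_cong) (simp add: int_pow_pow mult.commute)
  also have "\<dots> = power_product G c xs f [^] k"
    unfolding power_product_def using assms by (intro list_mult_int_pow center_int_pow)
  finally show ?thesis .
qed

lemma power_product_zero [simp]: "power_product G c xs (\<lambda>s. 0) = \<one>"
  unfolding power_product_def by (rule list_mult_one) simp

lemma power_product_single:
  assumes "distinct xs" "t \<in> set xs" "c t \<in> carrier G"
  shows "power_product G c xs (\<lambda>s. of_bool (s = t)) = c t"
proof -
  have "power_product G c xs (\<lambda>s. of_bool (s = t)) = c t [^] (of_bool (t = t) :: int)"
    unfolding power_product_def using assms by (intro list_mult_single) auto
  then show ?thesis using assms by simp
qed

lemma power_product_sum_list:
  assumes "\<And>s. s \<in> set xs \<Longrightarrow> c s \<in> group_center G"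
  shows "power_product G c xs (\<lambda>s. \<Sum>t\<leftarrow>ts. v t * B t s) = list_mult G (\<lambda>t. power_product G c xs (B t) [^] v t) ts"
  by (induction ts) (simp_all add: power_product_add power_product_scale assms)

lemma power_product_mod:
  assumes "\<And>s. s \<in> set xs \<Longrightarrow> c s \<in> carrier G" "\<And>s. s \<in> set xs \<Longrightarrow> c s [^] p = \<one>"
    and "\<And>s. s \<in> set xs \<Longrightarrow> int p dvd f s - f' s"
  shows "power_product G c xs f = power_product G c xs f'"
  unfolding power_product_def
proof (rule list_mult_cong)
  fix s assume s: "s \<in> set xs"
  obtain m where "f s = int p * m + f' s"
    using assms(3)[OF s] by (auto simp: dvd_def algebra_simps)
  moreover have "c s [^] (int p * m) = \<one>"
    using assms(1,2)[OF s] by (metis int_pow_int int_pow_one int_pow_pow)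
  ultimately show "c s [^] f s = c s [^] f' s"
    using assms(1)[OF s] by (simp add: int_pow_mult)
qed

end

section \<open>Capability forces the equality of subspaces\<close>

lemma central_extension_map:
  assumes G: "group G" and H: "group H" and iso: "G \<cong> H Mod group_center H"
  obtains q where "q \<in> hom H G" "q ` carrier H = carrier G"
    "\<And>x. x \<in> carrier H \<Longrightarrow> q x = \<one>\<^bsub>G\<^esub> \<longleftrightarrow> x \<in> group_center H"
proof -
  let ?Z = "group_center H" and ?Q = "H Mod group_center H"
  interpret H: group H by fact
  interpret Z: normal ?Z H using center_normal[OF H] .
  have "?Q \<cong> G" using iso G group.iso_sym by blast
  then obtain \<eta> where \<eta>: "\<eta> \<in> iso ?Q G" by (auto simp: is_iso_def)
  then have \<eta>_hom: "\<eta> \<in> hom ?Q G" and \<eta>_bij: "bij_betw \<eta> (carrier ?Q) (carrier G)"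
    by (auto simp: iso_def)
  define q where "q = \<eta> \<circ> (\<lambda>x. ?Z #>\<^bsub>H\<^esub> x)"
  have coset: "?Z #>\<^bsub>H\<^esub> x \<in> carrier ?Q" if "x \<in> carrier H" for x
    using that by (auto simp: carrier_FactGroup)
  show ?thesis
  proof
    show "q \<in> hom H G"
      unfolding q_def by (rule hom_compose[OF Z.r_coset_hom_Mod \<eta>_hom])
    show "q ` carrier H = carrier G"
      using \<eta>_bij unfolding q_def image_comp[symmetric] carrier_FactGroup[symmetric] bij_betw_def
      by blast
    fix x assume x: "x \<in> carrier H"
    have "\<eta> \<one>\<^bsub>?Q\<^esub> = \<one>\<^bsub>G\<^esub>"
      using \<eta>_hom Z.factorgroup_is_group G by (rule hom_one)
    moreover have "\<one>\<^bsub>?Q\<^esub> \<in> carrier ?Q"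
      using Z.factorgroup_is_group by (simp add: group.is_monoid monoid.one_closed del: one_FactGroup)
    ultimately have "q x = \<one>\<^bsub>G\<^esub> \<longleftrightarrow> ?Z #>\<^bsub>H\<^esub> x = \<one>\<^bsub>?Q\<^esub>"
      using \<eta>_bij coset[OF x] by (metis bij_betw_imp_inj_on comp_apply inj_on_eq_iff q_def)
    also have "\<dots> \<longleftrightarrow> x \<in> ?Z"
      using H.coset_join1[OF _ x Z.subgroup_axioms] H.coset_join2[OF x Z.subgroup_axioms] by auto
    finally show "q x = \<one>\<^bsub>G\<^esub> \<longleftrightarrow> x \<in> ?Z" .
  qed
qed

text \<open>The commutators of products of the \<open>[h\<^sub>j, h\<^sub>i]\<close> with the \<open>h\<^sub>r\<close> are governed by \<open>\<phi>\<^sub>r\<close>, whatever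
  the group \<open>H\<close> with \<open>G \<cong> H/Z(H)\<close> is. Hence centrality of such a product, which is the condition
  \<open>v \<in> X\<close>, follows already from \<open>v \<in> Z\<^sub>X\<close>.\<close>

lemma capable_imp_subspace_closed:
  fixes G :: "('a, 'm) monoid_scheme"
  assumes p: "Factorial_Ring.prime p" and G: "group G"
    and class_2: "nilpotent_of_class_at_most G 2"
    and exponent: "\<And>y. y \<in> carrier G \<Longrightarrow> y [^]\<^bsub>G\<^esub> p = \<one>\<^bsub>G\<^esub>"
    and generators: "g ` {1..n} \<subseteq> carrier G" "generate G (g ` {1..n}) = carrier G"
    and n_pos: "0 < n" and capable: "capable G"
    and U: "U = {v \<in> carrier (V_space p n). commutator_product G g n v = \<one>\<^bsub>G\<^esub>}"
  shows "Z_space p n U \<subseteq> U"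
proof -
  interpret modulus p by (rule modulus.intro) (rule prime_gt_1_nat[OF p])
  interpret G: class_2_group G using G class_2 by (rule class_2_groupI)
  obtain H :: "('a \<times> bool) list monoid" where H: "group H" "G \<cong> H Mod group_center H"
    using capable by (auto simp: capable_def)
  obtain q where q: "q \<in> hom H G" "q ` carrier H = carrier G"
    "\<And>x. x \<in> carrier H \<Longrightarrow> q x = \<one>\<^bsub>G\<^esub> \<longleftrightarrow> x \<in> group_center H"
    using central_extension_map[OF G H] by blast
  interpret H: group H by (rule H(1))
  interpret q: group_hom H G q
    using q(1) H(1) G by (simp add: group_hom_def group_hom_axioms_def)
  interpret H: class_3_group H
  proof
    fix x y z assume xyz: "x \<in> carrier H" "y \<in> carrier H" "z \<in> carrier H"
    have "group_commutator G (group_commutator G (q x) (q y)) (q z) = \<one>\<^bsub>G\<^esub>"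
      using xyz G.commutator_central[of "q x" "q y"] G.center_commutes
      by (simp add: G.commutator_eq_one_iff)
    then show "group_commutator H (group_commutator H x y) z \<in> group_center H"
      using xyz by (simp flip: q(3) add: q.hom_commutator)
  qed
  have "\<exists>x. x \<in> carrier H \<and> q x = g i" if "i \<in> {1..n}" for i
    using that generators(1) q(2) by (metis imageE image_subset_iff)
  then obtain h where h: "\<And>i. i \<in> {1..n} \<Longrightarrow> h i \<in> carrier H \<and> q (h i) = g i" by metis
  have pair: "h j \<in> carrier H" "h i \<in> carrier H" if "(j, i) \<in> V_index n" for j i
    using h index_bounds[OF that] by blast+
  define D where "D = (\<lambda>(j, i, k). H.triple (h j) (h i) (h k))"
  have D: "D s \<in> group_center H" if "s \<in> W_index n" for s
  proof -
    obtain j i k where s: "s = (j, i, k)" by (cases s) auto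
    then have "j \<in> {1..n}" "i \<in> {1..n}" "k \<in> {1..n}" using that by (auto simp: W_index_def)
    then show ?thesis using h by (simp add: s D_def H.triple_commutator_central)
  qed
  have D_pow: "D s [^]\<^bsub>H\<^esub> p = \<one>\<^bsub>H\<^esub>" if "s \<in> W_index n" for s
  proof -
    obtain j i k where s: "s = (j, i, k)" by (cases s) auto
    then have "j \<in> {1..n}" "i \<in> {1..n}" "k \<in> {1..n}" using that by (auto simp: W_index_def)
    then have c: "h j \<in> carrier H" "h i \<in> carrier H" "h k \<in> carrier H" using h by blast+
    let ?c = "group_commutator H (h j) (h i)"
    \<comment> \<open>The \<open>p\<close>-th power of a lift need not be trivial, but it is central.\<close>
    have "q (h k [^]\<^bsub>H\<^esub> p) = \<one>\<^bsub>G\<^esub>" using c exponent by (simp add: q.hom_nat_pow)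
    then have "h k [^]\<^bsub>H\<^esub> p \<in> group_center H" using c q(3) by simp
    then have "group_commutator H ?c (h k [^]\<^bsub>H\<^esub> p) = \<one>\<^bsub>H\<^esub>"
      using c H.center_commutes[of "h k [^]\<^bsub>H\<^esub> p" ?c] by (simp add: H.commutator_eq_one_iff)
    then show ?thesis
      using c H.commutator_int_pow_right[of ?c "h k" "int p"] H.triple_commutator_central
      by (simp add: s D_def int_pow_int)
  qed
  obtain ws where ws: "set ws = W_index n" "distinct ws"
    using finite_distinct_list[OF finite_W_index] by blast
  define \<psi> where "\<psi> = power_product H D ws"
  have D_ws: "D s \<in> group_center H" if "s \<in> set ws" for s using that D ws by blast
  have \<psi>_central: "\<psi> f \<in> group_center H" for f
    unfolding \<psi>_def using D_ws by (rule H.power_product_central)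
  have \<psi>_reduce: "\<psi> (reduce p (W_index n) f) = \<psi> f" for f
    unfolding \<psi>_def using D_ws D_pow ws dvd_reduce_diff[of _ "W_index n" p f]
    by (intro H.power_product_mod[where p = p]) (auto simp: dvd_diff_commute)
  have \<psi>_basis: "\<psi> (phi_basis r (j, i)) = D (j, i, r)" if ji: "(j, i) \<in> V_index n" and r: "r \<in> {1..n}" for j i r
  proof (cases "i \<le> r")
    case True
    then have "(j, i, r) \<in> W_index n" using ji r by (auto simp: V_index_def W_index_def)
    then have "power_product H D ws (\<lambda>s. of_bool (s = (j, i, r))) = D (j, i, r)"
      using ws D by (intro H.power_product_single) auto
    then show ?thesis using True by (simp add: \<psi>_def phi_basis_def)
  next
    case False
    then have W: "(j, r, i) \<in> W_index n" "(i, r, j) \<in> W_index n"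
      using ji r by (auto simp: V_index_def W_index_def)
    have c: "h j \<in> carrier H" "h i \<in> carrier H" "h r \<in> carrier H" using h r pair[OF ji] by blast+
    have "\<psi> (phi_basis r (j, i)) =
        power_product H D ws (\<lambda>s. of_bool (s = (j, r, i)) + (-1) * of_bool (s = (i, r, j)))"
      using False by (simp add: \<psi>_def phi_basis_def)
    also have "\<dots> = power_product H D ws (\<lambda>s. of_bool (s = (j, r, i))) \<otimes>\<^bsub>H\<^esub>
        power_product H D ws (\<lambda>s. of_bool (s = (i, r, j))) [^]\<^bsub>H\<^esub> (-1 :: int)"
      using D_ws by (simp only: H.power_product_add H.power_product_scale)
    also have "\<dots> = D (j, r, i) \<otimes>\<^bsub>H\<^esub> inv\<^bsub>H\<^esub> D (i, r, j)"
      using W ws D by (simp add: H.power_product_single H.int_pow_neg)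
    also have "\<dots> = D (j, i, r)"
    proof -
      \<comment> \<open>The second case in the definition of \<open>\<phi>\<^sub>r\<close> is the Jacobi identity.\<close>
      have "H.triple (h j) (h i) (h r) \<otimes>\<^bsub>H\<^esub> H.triple (h i) (h r) (h j) =
          inv\<^bsub>H\<^esub> H.triple (h r) (h j) (h i)"
        using H.jacobi[OF c] c by (intro H.inv_equality[symmetric]) auto
      also have "\<dots> = H.triple (h j) (h r) (h i)"
        using c by (simp add: H.triple_swap[of "h r" "h j"])
      finally have "H.triple (h j) (h r) (h i) =
          H.triple (h j) (h i) (h r) \<otimes>\<^bsub>H\<^esub> H.triple (h i) (h r) (h j)" ..
      then show ?thesis using c by (simp add: D_def H.m_assoc)
    qed
    finally show ?thesis .
  qed
  let ?c = "commutator_product H h n"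
  have c_closed: "?c v \<in> carrier H" for v
    unfolding commutator_product_def using pair by (intro H.list_mult_closed) auto
  have c_commutator: "group_commutator H (?c v) (h r) = \<psi> (phi_int n r v)" if r: "r \<in> {1..n}" for v r
  proof -
    have hr: "h r \<in> carrier H" using h r by blast
    let ?f = "\<lambda>(j, i). group_commutator H (h j) (h i) [^]\<^bsub>H\<^esub> v (j, i)"
    have power: "group_commutator H (group_commutator H (h j) (h i) [^]\<^bsub>H\<^esub> v (j, i)) (h r) = D (j, i, r) [^]\<^bsub>H\<^esub> v (j, i)"
      if "(j, i) \<in> V_index n" for j i
      using pair[OF that] hr by (simp add: D_def H.commutator_int_pow_left H.triple_commutator_central)
    have D_r: "D (j, i, r) \<in> group_center H" if "(j, i) \<in> V_index n" for j i
      using pair[OF that] hr by (simp add: D_def H.triple_commutator_central)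
    have "group_commutator H (?c v) (h r) = list_mult H (\<lambda>t. group_commutator H (?f t) (h r)) (index_pairs n)"
      unfolding commutator_product_def using pair hr power D_r
      by (intro H.commutator_list_mult_left) (auto simp: H.center_int_pow)
    also have "\<dots> = list_mult H (\<lambda>t. \<psi> (phi_basis r t) [^]\<^bsub>H\<^esub> v t) (index_pairs n)"
      using power r by (intro list_mult_cong) (auto simp: \<psi>_basis)
    also have "\<dots> = \<psi> (\<lambda>s. \<Sum>t\<leftarrow>index_pairs n. v t * phi_basis r t s)"
      unfolding \<psi>_def using D_ws by (rule H.power_product_sum_list[symmetric])
    also have "(\<lambda>s. \<Sum>t\<leftarrow>index_pairs n. v t * phi_basis r t s) = phi_int n r v"
      by (simp add: fun_eq_iff phi_int_def sum_list_distinct_conv_sum_set[OF distinct_index_pairs])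
    finally show ?thesis .
  qed
  have q_c: "q (?c v) = commutator_product G g n v" for v
  proof -
    have "q (?c v) = commutator_product G (q \<circ> h) n v"
      using h by (intro q.hom_commutator_product) auto
    also have "\<dots> = commutator_product G g n v"
      unfolding commutator_product_def
    proof (intro list_mult_cong, clarify)
      fix j i assume "(j, i) \<in> set (index_pairs n)"
      then have "q (h j) = g j" "q (h i) = g i" using h index_bounds[of j i n] by auto
      then show "group_commutator G ((q \<circ> h) j) ((q \<circ> h) i) [^]\<^bsub>G\<^esub> v (j, i) =
          group_commutator G (g j) (g i) [^]\<^bsub>G\<^esub> v (j, i)" by simp
    qed
    finally show ?thesis .
  qed
  have in_U: "v \<in> U \<longleftrightarrow> v \<in> carrier (V_space p n) \<and> ?c v \<in> group_center H" for v
    using q(3)[OF c_closed[of v]] q_c[of v] by (simp add: U)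
  define T where "T = {w \<in> carrier (W_space p n). \<psi> w = \<one>\<^bsub>H\<^esub>}"
  interpret W: module "residue_ring (int p)" "W_space p n"
    unfolding W_eq by (rule module_space)
  have T_reduce: "reduce p (W_index n) f \<in> T \<longleftrightarrow> \<psi> f = \<one>\<^bsub>H\<^esub>" for f
    by (simp add: T_def W_eq \<psi>_reduce)
  have \<psi>_add: "\<psi> (\<lambda>s. f s + f' s) = \<psi> f \<otimes>\<^bsub>H\<^esub> \<psi> f'" for f f'
    unfolding \<psi>_def using D_ws by (rule H.power_product_add)
  have \<psi>_scale: "\<psi> (\<lambda>s. k * f s) = \<psi> f [^]\<^bsub>H\<^esub> k" for f k
    unfolding \<psi>_def using D_ws by (rule H.power_product_scale)
  have TE: "\<exists>f. w = reduce p (W_index n) f \<and> \<psi> f = \<one>\<^bsub>H\<^esub>" if "w \<in> T" for w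
    using that T_reduce reduce_id[of w "W_index n"] by (metis (no_types, lifting) T_def W_eq mem_Collect_eq)
  have "submodule T (residue_ring (int p)) (W_space p n)"
  proof (rule W.submoduleI)
    show "T \<subseteq> carrier (W_space p n)" by (auto simp: T_def)
    show "\<zero>\<^bsub>W_space p n\<^esub> \<in> T"
      unfolding W_eq zero_space T_reduce by (simp add: \<psi>_def)
    fix w assume w: "w \<in> T"
    then obtain f where f: "w = reduce p (W_index n) f" "\<psi> f = \<one>\<^bsub>H\<^esub>" using TE by blast
    have "\<ominus>\<^bsub>W_space p n\<^esub> w = reduce p (W_index n) (\<lambda>s. (-1) * f s)"
      using W.minus_equality[of "reduce p (W_index n) (\<lambda>s. (-1) * f s)" w]
      by (simp add: f(1) W_eq add_space zero_space)
    then show "\<ominus>\<^bsub>W_space p n\<^esub> w \<in> T"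
      by (simp only: T_reduce \<psi>_scale f(2) H.int_pow_one)
    fix a
    show "a \<odot>\<^bsub>W_space p n\<^esub> w \<in> T"
      unfolding f(1) W_eq smult_space T_reduce \<psi>_scale f(2) by simp
    fix w' assume "w' \<in> T"
    then obtain f' where f': "w' = reduce p (W_index n) f'" "\<psi> f' = \<one>\<^bsub>H\<^esub>" using TE by blast
    show "w \<oplus>\<^bsub>W_space p n\<^esub> w' \<in> T"
      unfolding f(1) f'(1) W_eq add_space T_reduce \<psi>_add f(2) f'(2) by simp
  qed
  moreover have "phi_map p n r v \<in> T" if r: "r \<in> {1..n}" and v: "v \<in> U" for r v
  proof -
    have "group_commutator H (?c v) (h r) = \<one>\<^bsub>H\<^esub>"
      using v h r c_closed H.center_commutes[of "?c v" "h r"]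
      by (simp add: in_U H.commutator_eq_one_iff)
    then show ?thesis by (simp add: phi_map_eq T_reduce c_commutator[OF r])
  qed
  ultimately have YT: "Y_space p n U \<subseteq> T" by (rule Y_minimal)
  show ?thesis
  proof
    fix v assume v: "v \<in> Z_space p n U"
    then have v_Z: "v \<in> carrier (V_space p n) \<and> phi_map p n r v \<in> Y_space p n U" if "r \<in> {1..n}" for r
      using that by (simp add: Z_space_def)
    moreover have "1 \<in> {1..n}" using n_pos by simp
    ultimately have v_V: "v \<in> carrier (V_space p n)"
      and v_Y: "\<And>r. r \<in> {1..n} \<Longrightarrow> phi_map p n r v \<in> Y_space p n U"
      by blast+
    \<comment> \<open>The centralizer of \<open>c(v)\<close> contains \<open>Z(H)\<close> and maps onto \<open>G\<close>, so it is all of \<open>H\<close>.\<close>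
    define L where "L = {x \<in> carrier H. ?c v \<otimes>\<^bsub>H\<^esub> x = x \<otimes>\<^bsub>H\<^esub> ?c v}"
    have L: "subgroup L H"
      unfolding L_def using c_closed by (rule H.centralizer_subgroup)
    have "h r \<in> L" if r: "r \<in> {1..n}" for r
    proof -
      have "phi_map p n r v \<in> T" using v_Y[OF r] YT by blast
      then have "group_commutator H (?c v) (h r) = \<one>\<^bsub>H\<^esub>"
        by (simp add: phi_map_eq T_reduce c_commutator[OF r])
      then show ?thesis using h[OF r] c_closed by (simp add: L_def H.commutator_eq_one_iff)
    qed
    then have "g i \<in> q ` L" if "i \<in> {1..n}" for i
      using that h by (metis imageI)
    then have "generate G (g ` {1..n}) \<subseteq> q ` L"
      using q.subgroup_img_is_subgroup[OF L] by (intro G.generate_subgroup_incl) auto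
    then have surj: "carrier G \<subseteq> q ` L" by (simp add: generators)
    have "?c v \<in> group_center H"
    proof (rule group_centerI[OF c_closed])
      fix x assume x: "x \<in> carrier H"
      then obtain l where l: "l \<in> L" "q x = q l" using surj q.hom_closed by blast
      then have lH: "l \<in> carrier H" by (simp add: L_def)
      have "q (x \<otimes>\<^bsub>H\<^esub> inv\<^bsub>H\<^esub> l) = \<one>\<^bsub>G\<^esub>" using x l lH by simp
      then have "x \<otimes>\<^bsub>H\<^esub> inv\<^bsub>H\<^esub> l \<in> group_center H"
        using q(3)[of "x \<otimes>\<^bsub>H\<^esub> inv\<^bsub>H\<^esub> l"] x lH by blast
      then have "x \<otimes>\<^bsub>H\<^esub> inv\<^bsub>H\<^esub> l \<in> L"
        using H.center_commutes[of "x \<otimes>\<^bsub>H\<^esub> inv\<^bsub>H\<^esub> l" "?c v"] x lH c_closed by (simp add: L_def)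
      then have "x \<otimes>\<^bsub>H\<^esub> inv\<^bsub>H\<^esub> l \<otimes>\<^bsub>H\<^esub> l \<in> L" using l L by (simp add: subgroup.m_closed)
      then have "x \<in> L" using x lH by (simp add: H.m_assoc)
      then show "?c v \<otimes>\<^bsub>H\<^esub> x = x \<otimes>\<^bsub>H\<^esub> ?c v" by (simp add: L_def)
    qed
    then show "v \<in> U" using v_V in_U by blast
  qed
qed


section \<open>Groups that are capable because of a congruence\<close>

text \<open>The witness is the quotient of \<open>K\<close> by the congruence. The last hypothesis says that its centre
  is the image of the kernel of \<open>q\<close>, so the quotient by the centre is again \<open>G\<close>. Stating the
  hypotheses for a congruence instead of a normal subgroup avoids inverses in \<open>K\<close>.\<close>

lemma capable_of_congruence:
  fixes G :: "('a, 'm) monoid_scheme" and K :: "('b, 'k) monoid_scheme"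
  assumes G: "group G" and K: "group K" and q: "q \<in> hom K G" "q ` carrier K = carrier G"
    and refl: "\<And>u. u \<in> carrier K \<Longrightarrow> R u u"
    and sym: "\<And>u v. u \<in> carrier K \<Longrightarrow> v \<in> carrier K \<Longrightarrow> R u v \<Longrightarrow> R v u"
    and trans: "\<And>u v w. u \<in> carrier K \<Longrightarrow> v \<in> carrier K \<Longrightarrow> w \<in> carrier K \<Longrightarrow>
      R u v \<Longrightarrow> R v w \<Longrightarrow> R u w"
    and mult: "\<And>u v u' v'. u \<in> carrier K \<Longrightarrow> v \<in> carrier K \<Longrightarrow> u' \<in> carrier K \<Longrightarrow> v' \<in> carrier K \<Longrightarrow>
      R u u' \<Longrightarrow> R v v' \<Longrightarrow> R (u \<otimes>\<^bsub>K\<^esub> v) (u' \<otimes>\<^bsub>K\<^esub> v')"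
    and central: "\<And>k. k \<in> carrier K \<Longrightarrow>
      q k = \<one>\<^bsub>G\<^esub> \<longleftrightarrow> (\<forall>x\<in>carrier K. R (k \<otimes>\<^bsub>K\<^esub> x) (x \<otimes>\<^bsub>K\<^esub> k))"
  shows "capable G"
proof -
  interpret K: group K by fact
  interpret q: group_hom K G q
    using q(1) K G by (simp add: group_hom_def group_hom_axioms_def)
  define M where "M = {m \<in> carrier K. R m \<one>\<^bsub>K\<^esub>}"
  have left: "R (u \<otimes>\<^bsub>K\<^esub> v) (u \<otimes>\<^bsub>K\<^esub> v')" if "u \<in> carrier K" "v \<in> carrier K" "v' \<in> carrier K" "R v v'" for u v v'
    using that by (intro mult refl)
  have right: "R (v \<otimes>\<^bsub>K\<^esub> u) (v' \<otimes>\<^bsub>K\<^esub> u)" if "u \<in> carrier K" "v \<in> carrier K" "v' \<in> carrier K" "R v v'" for u v v'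
    using that by (intro mult refl)
  have M_sub: "subgroup M K"
  proof (rule K.subgroupI)
    fix m assume m: "m \<in> M"
    then have "R (inv\<^bsub>K\<^esub> m \<otimes>\<^bsub>K\<^esub> m) (inv\<^bsub>K\<^esub> m \<otimes>\<^bsub>K\<^esub> \<one>\<^bsub>K\<^esub>)" by (intro left) (auto simp: M_def)
    then have "R \<one>\<^bsub>K\<^esub> (inv\<^bsub>K\<^esub> m)" using m by (simp add: M_def)
    then show "inv\<^bsub>K\<^esub> m \<in> M" using m sym by (simp add: M_def)
  next
    fix m m' assume m: "m \<in> M" "m' \<in> M"
    then have "R (m \<otimes>\<^bsub>K\<^esub> m') (\<one>\<^bsub>K\<^esub> \<otimes>\<^bsub>K\<^esub> \<one>\<^bsub>K\<^esub>)" by (intro mult) (auto simp: M_def)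
    then show "m \<otimes>\<^bsub>K\<^esub> m' \<in> M" using m by (simp add: M_def)
  qed (use refl[OF K.one_closed] in \<open>auto simp: M_def\<close>)
  have M_normal: "M \<lhd> K"
  proof (rule K.normal_invI[OF M_sub])
    fix x m assume x: "x \<in> carrier K" and m: "m \<in> M"
    then have "R (x \<otimes>\<^bsub>K\<^esub> m \<otimes>\<^bsub>K\<^esub> inv\<^bsub>K\<^esub> x) (x \<otimes>\<^bsub>K\<^esub> \<one>\<^bsub>K\<^esub> \<otimes>\<^bsub>K\<^esub> inv\<^bsub>K\<^esub> x)"
      by (intro left right) (auto simp: M_def)
    then show "x \<otimes>\<^bsub>K\<^esub> m \<otimes>\<^bsub>K\<^esub> inv\<^bsub>K\<^esub> x \<in> M" using x m by (simp add: M_def)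
  qed
  have MD: "m \<in> carrier K" "R m \<one>\<^bsub>K\<^esub>" if "m \<in> M" for m using that by (simp_all add: M_def)
  have MI: "m \<in> M" if "m \<in> carrier K" "R m \<one>\<^bsub>K\<^esub>" for m using that by (simp add: M_def)
  interpret M: normal M K by (rule M_normal)
  let ?L = "K Mod M"
  have L: "group ?L" by (rule M.factorgroup_is_group)
  have coset_eq: "M #>\<^bsub>K\<^esub> u = M #>\<^bsub>K\<^esub> v \<longleftrightarrow> R u v" if uv: "u \<in> carrier K" "v \<in> carrier K" for u v
  proof
    assume "M #>\<^bsub>K\<^esub> u = M #>\<^bsub>K\<^esub> v"
    then have "u \<in> M #>\<^bsub>K\<^esub> v" using K.rcos_self[OF uv(1) M_sub] by simp
    then obtain m where m: "m \<in> M" "u = m \<otimes>\<^bsub>K\<^esub> v" unfolding r_coset_def by blast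
    then have "R (m \<otimes>\<^bsub>K\<^esub> v) (\<one>\<^bsub>K\<^esub> \<otimes>\<^bsub>K\<^esub> v)" using uv by (intro right) (auto dest: MD)
    then show "R u v" using m uv by simp
  next
    assume "R u v"
    then have "R (u \<otimes>\<^bsub>K\<^esub> inv\<^bsub>K\<^esub> v) (v \<otimes>\<^bsub>K\<^esub> inv\<^bsub>K\<^esub> v)" using uv by (intro right) auto
    then have "u \<otimes>\<^bsub>K\<^esub> inv\<^bsub>K\<^esub> v \<in> M" using uv by (intro MI) simp_all
    then have "u \<otimes>\<^bsub>K\<^esub> inv\<^bsub>K\<^esub> v \<otimes>\<^bsub>K\<^esub> v \<in> M #>\<^bsub>K\<^esub> v" unfolding r_coset_def by blast
    then have "u \<in> M #>\<^bsub>K\<^esub> v" using uv by (simp add: K.m_assoc)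
    from K.repr_independence[OF this uv(2) M_sub] show "M #>\<^bsub>K\<^esub> u = M #>\<^bsub>K\<^esub> v" ..
  qed
  have q_M: "q m = \<one>\<^bsub>G\<^esub>" if m: "m \<in> M" for m
  proof -
    have "R (m \<otimes>\<^bsub>K\<^esub> x) (x \<otimes>\<^bsub>K\<^esub> m)" if x: "x \<in> carrier K" for x
    proof (rule trans)
      show "R (m \<otimes>\<^bsub>K\<^esub> x) (\<one>\<^bsub>K\<^esub> \<otimes>\<^bsub>K\<^esub> x)" using m x by (intro right) (auto dest: MD)
      have "R (x \<otimes>\<^bsub>K\<^esub> m) (x \<otimes>\<^bsub>K\<^esub> \<one>\<^bsub>K\<^esub>)" using m x by (intro left) (auto dest: MD)
      then show "R (\<one>\<^bsub>K\<^esub> \<otimes>\<^bsub>K\<^esub> x) (x \<otimes>\<^bsub>K\<^esub> m)" using x MD(1)[OF m] by (simp add: sym)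
    qed (use x MD(1)[OF m] in auto)
    then show ?thesis using MD(1)[OF m] central by blast
  qed
  have "q u = q v" if "u \<in> carrier K" "v \<in> carrier K" "M #>\<^bsub>K\<^esub> u = M #>\<^bsub>K\<^esub> v" for u v
  proof -
    have "u \<in> M #>\<^bsub>K\<^esub> v" using that K.rcos_self[OF that(1) M_sub] by simp
    then obtain m where m: "m \<in> M" "u = m \<otimes>\<^bsub>K\<^esub> v" unfolding r_coset_def by blast
    have "m \<in> carrier K" using m(1) by (rule MD(1))
    then show ?thesis using m q_M[OF m(1)] that by simp
  qed
  then obtain q' where q': "q' \<in> hom ?L G" "\<And>u. u \<in> carrier K \<Longrightarrow> q' (M #>\<^bsub>K\<^esub> u) = q u"
    using FactGroup_universal[OF q(1) M_normal] by blast
  have "G \<cong> ?L Mod group_center ?L"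
  proof (rule central_quotient_iso[OF L G q'(1)])
    show "q' ` carrier ?L = carrier G"
      using q(2) q'(2) by (auto simp: carrier_FactGroup image_image)
    fix A assume "A \<in> carrier ?L"
    then obtain k where k: "k \<in> carrier K" "A = M #>\<^bsub>K\<^esub> k" by (auto simp: carrier_FactGroup)
    have "q' A = \<one>\<^bsub>G\<^esub> \<longleftrightarrow> (\<forall>x\<in>carrier K. R (k \<otimes>\<^bsub>K\<^esub> x) (x \<otimes>\<^bsub>K\<^esub> k))"
      using k q'(2) central by simp
    also have "\<dots> \<longleftrightarrow> (\<forall>x\<in>carrier K. A \<otimes>\<^bsub>?L\<^esub> (M #>\<^bsub>K\<^esub> x) = (M #>\<^bsub>K\<^esub> x) \<otimes>\<^bsub>?L\<^esub> A)"
      using k by (simp add: M.rcos_sum coset_eq)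
    also have "\<dots> \<longleftrightarrow> A \<in> group_center ?L"
    proof -
      have "A \<in> (\<lambda>x. M #>\<^bsub>K\<^esub> x) ` carrier K" using k by (rule_tac image_eqI)
      then show ?thesis
        unfolding group_center_def carrier_FactGroup by (simp only: mem_Collect_eq ball_simps simp_thms)
    qed
    finally show "q' A = \<one>\<^bsub>G\<^esub> \<longleftrightarrow> A \<in> group_center ?L" .
  qed
  then show ?thesis using L by (intro capableI)
qed

section \<open>A group of class three in the truncated tensor algebra\<close>

text \<open>The triple \<open>(a, b, c)\<close> stands for
  \<open>1 + \<Sum> a\<^sub>i X\<^sub>i + \<Sum> b\<^sub>i\<^sub>j X\<^sub>i X\<^sub>j + \<Sum> c\<^sub>i\<^sub>j\<^sub>k X\<^sub>i X\<^sub>j X\<^sub>k\<close> modulo all monomials of degree four. The carrier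
  consists of those elements that satisfy the quadratic shuffle relations, as all products of the
  \<open>1 + X\<^sub>i\<close> do. They make \<open>b\<close> skew-symmetric modulo \<open>p\<close> whenever \<open>a\<close> vanishes modulo \<open>p\<close> and \<open>p\<close>
  is odd. Without them an element like \<open>1 + X\<^sub>i X\<^sub>i\<close>, whose normal form is trivial, need not be central
  in the quotient.\<close>

definition magnus_group ::
    "((nat \<Rightarrow> int) \<times> (nat \<times> nat \<Rightarrow> int) \<times> (nat \<times> nat \<times> nat \<Rightarrow> int)) monoid" where
  "magnus_group =
     \<lparr>carrier = {(a, b, c). \<forall>i j. b (i, j) + b (j, i) = a i * a j - (if i = j then a i else 0)},
      monoid.mult = (\<lambda>(a, b, c) (a', b', c').
        (\<lambda>i. a i + a' i, \<lambda>(i, j). b (i, j) + b' (i, j) + a i * a' j,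
         \<lambda>(i, j, k). c (i, j, k) + c' (i, j, k) + a i * b' (j, k) + b (i, j) * a' k)),
      one = (\<lambda>i. 0, \<lambda>s. 0, \<lambda>s. 0)\<rparr>"

lemma magnus_mult:
  "(a, b, c) \<otimes>\<^bsub>magnus_group\<^esub> (a', b', c') =
     (\<lambda>i. a i + a' i, \<lambda>(i, j). b (i, j) + b' (i, j) + a i * a' j,
      \<lambda>(i, j, k). c (i, j, k) + c' (i, j, k) + a i * b' (j, k) + b (i, j) * a' k)"
  by (simp add: magnus_group_def)

lemma magnus_carrier:
  "(a, b, c) \<in> carrier magnus_group \<longleftrightarrow>
    (\<forall>i j. b (i, j) + b (j, i) = a i * a j - (if i = j then a i else 0))"
  by (simp add: magnus_group_def)

lemma magnus_one: "\<one>\<^bsub>magnus_group\<^esub> = (\<lambda>i. 0, \<lambda>s. 0, \<lambda>s. 0)"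
  by (simp add: magnus_group_def)

lemma group_magnus: "group magnus_group"
proof (rule groupI)
  fix u v assume "u \<in> carrier magnus_group" "v \<in> carrier magnus_group"
  moreover obtain a b c a' b' c' where "u = (a, b, c)" "v = (a', b', c')" by (metis prod_cases3)
  ultimately have u: "u = (a, b, c)" "v = (a', b', c')"
    and rel: "b (i, j) + b (j, i) = a i * a j - (if i = j then a i else 0)"
      "b' (i, j) + b' (j, i) = a' i * a' j - (if i = j then a' i else 0)" for i j
    by (simp_all add: magnus_carrier)
  have "b (i, j) + b' (i, j) + a i * a' j + (b (j, i) + b' (j, i) + a j * a' i) =
      (a i + a' i) * (a j + a' j) - (if i = j then a i + a' i else 0)" for i j
  proof -
    have "b (i, j) + b' (i, j) + a i * a' j + (b (j, i) + b' (j, i) + a j * a' i) =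
        (b (i, j) + b (j, i)) + (b' (i, j) + b' (j, i)) + a i * a' j + a j * a' i" by simp
    also have "\<dots> = (a i + a' i) * (a j + a' j) - (if i = j then a i + a' i else 0)"
      unfolding rel by (simp add: algebra_simps)
    finally show ?thesis .
  qed
  then show "u \<otimes>\<^bsub>magnus_group\<^esub> v \<in> carrier magnus_group"
    unfolding u magnus_mult magnus_carrier by simp
next
  fix u v w :: "(nat \<Rightarrow> int) \<times> (nat \<times> nat \<Rightarrow> int) \<times> (nat \<times> nat \<times> nat \<Rightarrow> int)"
  obtain a b c a' b' c' a'' b'' c''
    where "u = (a, b, c)" "v = (a', b', c')" "w = (a'', b'', c'')" by (metis prod_cases3)
  then show "u \<otimes>\<^bsub>magnus_group\<^esub> v \<otimes>\<^bsub>magnus_group\<^esub> w = u \<otimes>\<^bsub>magnus_group\<^esub> (v \<otimes>\<^bsub>magnus_group\<^esub> w)"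
    by (simp add: magnus_mult fun_eq_iff algebra_simps)
next
  fix u assume "u \<in> carrier magnus_group"
  moreover obtain a b c where u: "u = (a, b, c)" by (metis prod_cases3)
  ultimately have rel: "b (i, j) + b (j, i) = a i * a j - (if i = j then a i else 0)" for i j
    by (simp add: magnus_carrier)
  let ?v = "(\<lambda>i. - a i, \<lambda>(i, j). a i * a j - b (i, j),
    \<lambda>(i, j, k). a i * b (j, k) + b (i, j) * a k - a i * a j * a k - c (i, j, k))"
  have "?v \<in> carrier magnus_group"
    unfolding magnus_carrier
  proof (intro allI)
    fix i j
    show "(\<lambda>(i, j). a i * a j - b (i, j)) (i, j) + (\<lambda>(i, j). a i * a j - b (i, j)) (j, i) =
        - a i * - a j - (if i = j then - a i else 0)"
      using rel[of i j] by (auto simp: mult.commute split: if_splits)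
  qed
  moreover have "?v \<otimes>\<^bsub>magnus_group\<^esub> u = \<one>\<^bsub>magnus_group\<^esub>"
    unfolding u magnus_mult magnus_one by (auto simp: fun_eq_iff algebra_simps)
  ultimately show "\<exists>v\<in>carrier magnus_group. v \<otimes>\<^bsub>magnus_group\<^esub> u = \<one>\<^bsub>magnus_group\<^esub>" by blast
  show "\<one>\<^bsub>magnus_group\<^esub> \<otimes>\<^bsub>magnus_group\<^esub> u = u"
    unfolding u magnus_mult magnus_one by (auto simp: fun_eq_iff)
qed (simp add: magnus_one magnus_carrier)

section \<open>Embedding the triple commutators into the tensor algebra\<close>

text \<open>Under this map \<open>w\<^sub>j\<^sub>i\<^sub>k\<close> becomes the Lie bracket \<open>[[X\<^sub>j, X\<^sub>i], X\<^sub>k]\<close>.\<close>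

definition lie_tensor :: "nat \<Rightarrow> (nat \<times> nat \<times> nat \<Rightarrow> int) \<Rightarrow> nat \<Rightarrow> nat \<Rightarrow> nat \<Rightarrow> int" where
  "lie_tensor n w i j k = (let w' = (\<lambda>s. if s \<in> W_index n then w s else 0)
     in w' (i, j, k) - w' (j, i, k) - w' (j, k, i) + w' (k, j, i))"

definition skew_extension :: "(nat \<times> nat \<Rightarrow> int) \<Rightarrow> nat \<Rightarrow> nat \<Rightarrow> int" where
  "skew_extension v j i = (if i < j then v (j, i) else if j < i then - v (i, j) else 0)"

lemma phi_basis_apply:
  assumes "i < j" "i \<le> k"
  shows "phi_basis r (j', i') (j, i, k) = of_bool ((j', i') = (j, i)) * of_bool (k = r) +
      of_bool ((j', i') = (j, k)) * of_bool (i = r \<and> r < k) - of_bool ((j', i') = (k, j)) * of_bool (i = r)"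
proof (cases "i' \<le> r")
  case True
  then have a: "\<not> (i' = k \<and> r < k)" "\<not> (i' = j \<and> i = r)" using assms by linarith+
  have "phi_basis r (j', i') (j, i, k) = of_bool ((j, i, k) = (j', i', r))"
    unfolding phi_basis_def prod.case by (simp only: True if_True)
  then show ?thesis
    using a by (cases "i' = k"; cases "i' = j"; cases "k = r"; cases "i = r") auto
next
  case False
  then have a: "\<not> (i' = i \<and> k = r)" using assms by linarith
  have "phi_basis r (j', i') (j, i, k) = of_bool ((j, i, k) = (j', r, i')) - of_bool ((j, i, k) = (i', r, j'))"
    unfolding phi_basis_def prod.case by (simp only: False if_False)
  then show ?thesis
    using a False by (cases "i' = i"; cases "i' = k"; cases "i' = j"; cases "k = r"; cases "i = r") auto
qed

lemma phi_int_apply: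
  assumes "(j, i, k) \<in> W_index n"
  shows "phi_int n r v (j, i, k) = (if k = r then v (j, i) else 0) +
    (if i = r \<and> r < k \<and> k < j then v (j, k) else 0) - (if i = r \<and> j < k then v (k, j) else 0)"
proof -
  have bounds: "1 \<le> i" "i < j" "j \<le> n" "i \<le> k" "k \<le> n" using assms by (auto simp: W_index_def)
  have basis: "phi_basis r t (j, i, k) = of_bool (t = (j, i)) * of_bool (k = r) +
      of_bool (t = (j, k)) * of_bool (i = r \<and> r < k) - of_bool (t = (k, j)) * of_bool (i = r)" for t
    using phi_basis_apply[OF bounds(2,4), of r "fst t" "snd t"] by simp
  have delta: "(\<Sum>t\<in>V_index n. v t * (of_bool (t = t0) * x)) = (if t0 \<in> V_index n then v t0 * x else 0)"
    for t0 and x :: int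
  proof -
    have "(\<Sum>t\<in>V_index n. v t * (of_bool (t = t0) * x)) = (\<Sum>t\<in>V_index n. if t = t0 then v t * x else 0)"
      by (intro sum.cong) auto
    then show ?thesis by simp
  qed
  have "phi_int n r v (j, i, k) = (if (j, i) \<in> V_index n then v (j, i) * of_bool (k = r) else 0) +
      (if (j, k) \<in> V_index n then v (j, k) * of_bool (i = r \<and> r < k) else 0) -
      (if (k, j) \<in> V_index n then v (k, j) * of_bool (i = r) else 0)"
    unfolding phi_int_def basis distrib_left right_diff_distrib sum.distrib sum_subtractf delta by simp
  also have "(j, i) \<in> V_index n" "(j, k) \<in> V_index n \<longleftrightarrow> k < j" "(k, j) \<in> V_index n \<longleftrightarrow> j < k"
    using bounds by (auto simp: V_index_def)
  then have "(if (j, i) \<in> V_index n then v (j, i) * of_bool (k = r) else 0) +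
      (if (j, k) \<in> V_index n then v (j, k) * of_bool (i = r \<and> r < k) else 0) -
      (if (k, j) \<in> V_index n then v (k, j) * of_bool (i = r) else 0) =
    (if k = r then v (j, i) else 0) +
    (if i = r \<and> r < k \<and> k < j then v (j, k) else 0) - (if i = r \<and> j < k then v (k, j) else 0)"
    by auto
  finally show ?thesis .
qed

text \<open>Identify \<open>v\<^sub>j\<^sub>i\<close> with \<open>[X\<^sub>j, X\<^sub>i]\<close>. Then \<open>\<phi>\<^sub>r\<close> is the Lie bracket with \<open>X\<^sub>r\<close>, written in the
  basis \<open>w\<^sub>j\<^sub>i\<^sub>k\<close>, which takes the Jacobi identity when \<open>r < i\<close>.\<close>

lemma lie_tensor_phi:
  assumes "i \<in> {1..n}" "j \<in> {1..n}" "k \<in> {1..n}" "r \<in> {1..n}"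
  shows "lie_tensor n (phi_int n r v) i j k =
    (if k = r then skew_extension v i j else 0) - (if i = r then skew_extension v j k else 0)"
proof -
  define P where "P x y z = (if y < x \<and> y \<le> z then (if z = r then v (x, y) else 0) +
    (if y = r \<and> r < z \<and> z < x then v (x, z) else 0) - (if y = r \<and> x < z then v (z, x) else 0) else 0)"
    for x y z
  have P: "(if (x, y, z) \<in> W_index n then phi_int n r v (x, y, z) else 0) = P x y z"
    if "x \<in> {1..n}" "y \<in> {1..n}" "z \<in> {1..n}" for x y z
  proof -
    have "(x, y, z) \<in> W_index n \<longleftrightarrow> y < x \<and> y \<le> z" using that by (auto simp: W_index_def)
    then show ?thesis by (simp add: phi_int_apply P_def)
  qed
  have "lie_tensor n (phi_int n r v) i j k = P i j k - P j i k - P j k i + P k j i"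
    using assms by (simp only: lie_tensor_def Let_def P)
  also have "\<dots> = (if k = r then skew_extension v i j else 0) - (if i = r then skew_extension v j k else 0)"
    unfolding P_def skew_extension_def
    by (cases i j rule: linorder_cases; cases j k rule: linorder_cases; cases i k rule: linorder_cases;
        cases "i = r"; cases "k = r"; simp)
  finally show ?thesis .
qed

text \<open>The monomial \<open>X\<^sub>i X\<^sub>j X\<^sub>k\<close> occurs in the tensor of a single \<open>w\<^sub>j\<^sub>i\<^sub>k\<close> with \<open>i < j\<close> and \<open>i \<le> k\<close>. Its
  coefficient, \<open>-1\<close> or \<open>-2\<close>, is invertible modulo every odd \<open>p\<close>.\<close>

lemma lie_tensor_coefficient:
  assumes "(j, i, k) \<in> W_index n"
  shows "lie_tensor n w i j k = (if k = i then - 2 * w (j, i, k) else - w (j, i, k))"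
  using assms by (auto simp: lie_tensor_def Let_def W_index_def)

lemma lie_tensor_add: "lie_tensor n (\<lambda>s. f s + f' s) i j k = lie_tensor n f i j k + lie_tensor n f' i j k"
  by (simp add: lie_tensor_def Let_def)

lemma lie_tensor_scale: "lie_tensor n (\<lambda>s. m * f s) i j k = m * lie_tensor n f i j k"
  by (simp add: lie_tensor_def Let_def algebra_simps)

lemma lie_tensor_zero: "lie_tensor n (\<lambda>s. 0) i j k = 0"
  by (simp add: lie_tensor_def Let_def)

lemma lie_tensor_reduce: "int p dvd lie_tensor n f i j k - lie_tensor n (reduce p (W_index n) f) i j k"
proof -
  let ?d = "\<lambda>s. (if s \<in> W_index n then f s else 0) - (if s \<in> W_index n then reduce p (W_index n) f s else 0)"
  have d: "int p dvd ?d s" for s by (simp add: dvd_reduce_diff)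
  have "lie_tensor n f i j k - lie_tensor n (reduce p (W_index n) f) i j k =
      ?d (i, j, k) - ?d (j, i, k) - ?d (j, k, i) + ?d (k, j, i)"
    by (simp only: lie_tensor_def Let_def)
  then show ?thesis using d by (metis dvd_add dvd_diff)
qed


section \<open>Equality of subspaces forces capability\<close>

text \<open>The integral tensors whose reduction modulo \<open>p\<close> lies in the image of \<open>Y\<^sub>X\<close>; they are divided
  out in degree three.\<close>

definition Y_tensor :: "nat \<Rightarrow> nat \<Rightarrow> (nat \<times> nat \<Rightarrow> int) set \<Rightarrow> (nat \<times> nat \<times> nat \<Rightarrow> int) set" where
  "Y_tensor p n U = {c. \<exists>y\<in>Y_space p n U. \<forall>i\<in>{1..n}. \<forall>j\<in>{1..n}. \<forall>k\<in>{1..n}.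
     int p dvd c (i, j, k) - lie_tensor n y i j k}"

context modulus
begin

lemma Y_tensor_change:
  assumes "c \<in> Y_tensor p n U"
    and "\<And>i j k. i \<in> {1..n} \<Longrightarrow> j \<in> {1..n} \<Longrightarrow> k \<in> {1..n} \<Longrightarrow> int p dvd c' (i, j, k) - c (i, j, k)"
  shows "c' \<in> Y_tensor p n U"
proof -
  from assms(1) obtain y where y: "y \<in> Y_space p n U" "\<And>i j k. i \<in> {1..n} \<Longrightarrow> j \<in> {1..n} \<Longrightarrow>
      k \<in> {1..n} \<Longrightarrow> int p dvd c (i, j, k) - lie_tensor n y i j k"
    unfolding Y_tensor_def by blast
  have "int p dvd c' (i, j, k) - lie_tensor n y i j k" if "i \<in> {1..n}" "j \<in> {1..n}" "k \<in> {1..n}" for i j k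
    using dvd_add[OF assms(2)[OF that] y(2)[OF that]] by simp
  then show ?thesis unfolding Y_tensor_def using y(1) by blast
qed

lemma Y_tensor_lie:
  assumes "reduce p (W_index n) f \<in> Y_space p n U"
    and "\<And>i j k. i \<in> {1..n} \<Longrightarrow> j \<in> {1..n} \<Longrightarrow> k \<in> {1..n} \<Longrightarrow> int p dvd c (i, j, k) - lie_tensor n f i j k"
  shows "c \<in> Y_tensor p n U"
proof -
  have "int p dvd c (i, j, k) - lie_tensor n (reduce p (W_index n) f) i j k"
    if "i \<in> {1..n}" "j \<in> {1..n}" "k \<in> {1..n}" for i j k
    using dvd_add[OF assms(2)[OF that] lie_tensor_reduce[of p n f i j k]] by simp
  then show ?thesis unfolding Y_tensor_def using assms(1) by blast
qed

lemma Y_tensorE: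
  assumes "c \<in> Y_tensor p n U"
  obtains f where "reduce p (W_index n) f \<in> Y_space p n U"
    "\<forall>i\<in>{1..n}. \<forall>j\<in>{1..n}. \<forall>k\<in>{1..n}. int p dvd c (i, j, k) - lie_tensor n f i j k"
proof -
  from assms obtain y where y: "y \<in> Y_space p n U" "\<And>i j k. i \<in> {1..n} \<Longrightarrow> j \<in> {1..n} \<Longrightarrow>
      k \<in> {1..n} \<Longrightarrow> int p dvd c (i, j, k) - lie_tensor n y i j k"
    unfolding Y_tensor_def by blast
  have "reduce p (W_index n) y = y" by (rule reduce_id[OF subsetD[OF Y_carrier y(1)]])
  then have "reduce p (W_index n) y \<in> Y_space p n U" using y(1) by simp
  moreover have "\<forall>i\<in>{1..n}. \<forall>j\<in>{1..n}. \<forall>k\<in>{1..n}. int p dvd c (i, j, k) - lie_tensor n y i j k"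
    using y(2) by blast
  ultimately show ?thesis by (rule that)
qed

lemma Y_closed:
  shows "reduce p (W_index n) (\<lambda>s. 0) \<in> Y_space p n U"
    and "reduce p (W_index n) f \<in> Y_space p n U \<Longrightarrow> reduce p (W_index n) f' \<in> Y_space p n U \<Longrightarrow>
      reduce p (W_index n) (\<lambda>s. f s + f' s) \<in> Y_space p n U"
    and "reduce p (W_index n) f \<in> Y_space p n U \<Longrightarrow> reduce p (W_index n) (\<lambda>s. m * f s) \<in> Y_space p n U"
proof -
  interpret W: module "residue_ring (int p)" "space (W_index n)" by (rule module_space)
  have Y: "submodule (Y_space p n U) (residue_ring (int p)) (space (W_index n))"
    using submodule_Y by (simp add: W_eq)
  show zero: "reduce p (W_index n) (\<lambda>s. 0) \<in> Y_space p n U"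
    using subgroup.one_closed[OF submodule.axioms(1)[OF Y]] by (simp add: zero_space)
  show "reduce p (W_index n) (\<lambda>s. f s + f' s) \<in> Y_space p n U"
    if "reduce p (W_index n) f \<in> Y_space p n U" "reduce p (W_index n) f' \<in> Y_space p n U"
    using W.submoduleE(5)[OF Y that] by (simp add: add_space)
  show "reduce p (W_index n) (\<lambda>s. m * f s) \<in> Y_space p n U" if f: "reduce p (W_index n) f \<in> Y_space p n U"
  proof -
    have "m mod int p \<in> carrier (residue_ring (int p))"
      using p_gt_1 by (simp add: R.res_carrier_eq)
    from W.submoduleE(4)[OF Y this f]
    have "reduce p (W_index n) (\<lambda>s. m mod int p * f s) \<in> Y_space p n U" by (simp add: smult_space)
    then show ?thesis by (simp add: reduce_def mod_simps)
  qed
qed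

lemma Y_tensor_zero: "(\<lambda>s. 0) \<in> Y_tensor p n U"
  by (rule Y_tensor_lie[OF Y_closed(1)]) (simp add: lie_tensor_zero)

lemma Y_tensor_add:
  assumes "c \<in> Y_tensor p n U" "c' \<in> Y_tensor p n U"
  shows "(\<lambda>s. c s + c' s) \<in> Y_tensor p n U"
proof -
  obtain f where f: "reduce p (W_index n) f \<in> Y_space p n U"
    "\<forall>i\<in>{1..n}. \<forall>j\<in>{1..n}. \<forall>k\<in>{1..n}. int p dvd c (i, j, k) - lie_tensor n f i j k"
    by (rule Y_tensorE[OF assms(1)])
  obtain f' where f': "reduce p (W_index n) f' \<in> Y_space p n U"
    "\<forall>i\<in>{1..n}. \<forall>j\<in>{1..n}. \<forall>k\<in>{1..n}. int p dvd c' (i, j, k) - lie_tensor n f' i j k"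
    by (rule Y_tensorE[OF assms(2)])
  show ?thesis
  proof (rule Y_tensor_lie[OF Y_closed(2)[OF f(1) f'(1)]])
    fix i j k assume "i \<in> {1..n}" "j \<in> {1..n}" "k \<in> {1..n}"
    from dvd_add[OF f(2)[rule_format, OF this] f'(2)[rule_format, OF this]]
    show "int p dvd c (i, j, k) + c' (i, j, k) - lie_tensor n (\<lambda>s. f s + f' s) i j k"
      by (simp only: lie_tensor_add add_diff_add)
  qed
qed

lemma Y_tensor_scale:
  assumes "c \<in> Y_tensor p n U"
  shows "(\<lambda>s. m * c s) \<in> Y_tensor p n U"
proof -
  obtain f where f: "reduce p (W_index n) f \<in> Y_space p n U"
    "\<forall>i\<in>{1..n}. \<forall>j\<in>{1..n}. \<forall>k\<in>{1..n}. int p dvd c (i, j, k) - lie_tensor n f i j k"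
    by (rule Y_tensorE[OF assms(1)])
  show ?thesis
  proof (rule Y_tensor_lie[OF Y_closed(3)[OF f(1)]])
    fix i j k assume "i \<in> {1..n}" "j \<in> {1..n}" "k \<in> {1..n}"
    from dvd_mult[OF f(2)[rule_format, OF this], of m]
    show "int p dvd m * c (i, j, k) - lie_tensor n (\<lambda>s. m * f s) i j k"
      by (simp only: lie_tensor_scale right_diff_distrib)
  qed
qed

lemma Y_tensor_sum:
  assumes "finite A" "\<And>r. r \<in> A \<Longrightarrow> c r \<in> Y_tensor p n U"
  shows "(\<lambda>s. \<Sum>r\<in>A. m r * c r s) \<in> Y_tensor p n U"
  using assms by (induction A) (simp_all add: Y_tensor_zero Y_tensor_add Y_tensor_scale)

text \<open>This is where \<open>p\<close> has to be odd: the coefficients of a tensor then determine the vector in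
  \<open>W\<close> modulo \<open>p\<close>.\<close>

lemma reduce_in_Y_iff:
  assumes p: "odd p"
    and c: "\<And>i j k. i \<in> {1..n} \<Longrightarrow> j \<in> {1..n} \<Longrightarrow> k \<in> {1..n} \<Longrightarrow> int p dvd c (i, j, k) - lie_tensor n f i j k"
  shows "c \<in> Y_tensor p n U \<longleftrightarrow> reduce p (W_index n) f \<in> Y_space p n U"
proof
  assume "c \<in> Y_tensor p n U"
  then obtain f' where f': "reduce p (W_index n) f' \<in> Y_space p n U"
    "\<forall>i\<in>{1..n}. \<forall>j\<in>{1..n}. \<forall>k\<in>{1..n}. int p dvd c (i, j, k) - lie_tensor n f' i j k"
    by (rule Y_tensorE)
  have "int p dvd f s - f' s" if s: "s \<in> W_index n" for s
  proof -
    obtain j i k where jik: "s = (j, i, k)" by (rule prod_cases3)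
    then have "i \<in> {1..n}" "j \<in> {1..n}" "k \<in> {1..n}" using s by (auto simp: W_index_def)
    from dvd_diff[OF f'(2)[rule_format, OF this] c[OF this]]
    have d: "int p dvd lie_tensor n f i j k - lie_tensor n f' i j k" by simp
    show ?thesis
    proof (cases "k = i")
      case False
      then have "int p dvd - (f s - f' s)"
        using d s by (simp add: jik lie_tensor_coefficient algebra_simps)
      then show ?thesis by (simp only: dvd_minus_iff)
    next
      case True
      then have "int p dvd - 2 * (f s - f' s)"
        using d s by (simp add: jik lie_tensor_coefficient algebra_simps)
      moreover have "coprime (int p) (- 2)"
        using p by simp
      ultimately show ?thesis by (metis coprime_dvd_mult_right_iff)
    qed
  qed
  then have "reduce p (W_index n) f = reduce p (W_index n) f'" by (simp add: reduce_eq_iff)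
  then show "reduce p (W_index n) f \<in> Y_space p n U" using f'(1) by simp
qed (use c in \<open>auto intro: Y_tensor_lie\<close>)

end

definition magnus_congruent ::
    "nat \<Rightarrow> nat \<Rightarrow> (nat \<times> nat \<Rightarrow> int) set \<Rightarrow>
     (nat \<Rightarrow> int) \<times> (nat \<times> nat \<Rightarrow> int) \<times> (nat \<times> nat \<times> nat \<Rightarrow> int) \<Rightarrow>
     (nat \<Rightarrow> int) \<times> (nat \<times> nat \<Rightarrow> int) \<times> (nat \<times> nat \<times> nat \<Rightarrow> int) \<Rightarrow> bool" where
  "magnus_congruent p n U = (\<lambda>(a, b, c) (a', b', c').
     (\<forall>i\<in>{1..n}. int p dvd a i - a' i) \<and>
     (\<forall>i\<in>{1..n}. \<forall>j\<in>{1..n}. int p dvd b (i, j) - b' (i, j)) \<and>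
     (\<lambda>s. c s - c' s) \<in> Y_tensor p n U)"

lemma dvd_mult_diff:
  fixes m :: "'a :: comm_ring_1"
  assumes "m dvd x - x'" "m dvd y - y'"
  shows "m dvd x * y - x' * y'"
proof -
  have "x * y - x' * y' = (x - x') * y + x' * (y - y')" by (simp add: algebra_simps)
  then show ?thesis using assms by simp
qed

context modulus
begin

lemma magnus_congruent_sym:
  assumes "magnus_congruent p n U u v" shows "magnus_congruent p n U v u"
proof -
  obtain a b c a' b' c' where uv: "u = (a, b, c)" "v = (a', b', c')" by (metis prod_cases3)
  have "(\<lambda>s. (-1) * (c s - c' s)) \<in> Y_tensor p n U"
    using assms by (intro Y_tensor_scale) (simp add: uv magnus_congruent_def)
  then show ?thesis using assms by (simp add: uv magnus_congruent_def dvd_diff_commute)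
qed

lemma magnus_congruent_trans:
  assumes "magnus_congruent p n U u v" "magnus_congruent p n U v w" shows "magnus_congruent p n U u w"
proof -
  obtain a b c where u: "u = (a, b, c)" by (rule prod_cases3)
  obtain a' b' c' where v: "v = (a', b', c')" by (rule prod_cases3)
  obtain a'' b'' c'' where w: "w = (a'', b'', c'')" by (rule prod_cases3)
  have "(\<lambda>s. (c s - c' s) + (c' s - c'' s)) \<in> Y_tensor p n U"
    using assms by (intro Y_tensor_add) (simp_all add: u v w magnus_congruent_def)
  moreover have "int p dvd a i - a'' i" if "i \<in> {1..n}" for i
    using assms that dvd_add[of "int p" "a i - a' i" "a' i - a'' i"]
    by (simp add: u v w magnus_congruent_def)
  moreover have "int p dvd b (i, j) - b'' (i, j)" if "i \<in> {1..n}" "j \<in> {1..n}" for i j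
    using assms that dvd_add[of "int p" "b (i, j) - b' (i, j)" "b' (i, j) - b'' (i, j)"]
    by (simp add: u v w magnus_congruent_def)
  ultimately show ?thesis by (simp add: u w magnus_congruent_def)
qed

lemma magnus_congruent_mult:
  assumes "magnus_congruent p n U u u'" "magnus_congruent p n U v v'"
  shows "magnus_congruent p n U (u \<otimes>\<^bsub>magnus_group\<^esub> v) (u' \<otimes>\<^bsub>magnus_group\<^esub> v')"
proof -
  obtain a b c where u: "u = (a, b, c)" by (rule prod_cases3)
  obtain a' b' c' where u': "u' = (a', b', c')" by (rule prod_cases3)
  obtain d e f where v: "v = (d, e, f)" by (rule prod_cases3)
  obtain d' e' f' where v': "v' = (d', e', f')" by (rule prod_cases3)
  have a: "int p dvd a i - a' i" "int p dvd d i - d' i" if "i \<in> {1..n}" for i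
    using assms that by (simp_all add: u u' v v' magnus_congruent_def)
  have b: "int p dvd b (i, j) - b' (i, j)" "int p dvd e (i, j) - e' (i, j)"
    if "i \<in> {1..n}" "j \<in> {1..n}" for i j
    using assms that by (simp_all add: u u' v v' magnus_congruent_def)
  have c: "(\<lambda>s. (c s - c' s) + (f s - f' s)) \<in> Y_tensor p n U"
    using assms by (intro Y_tensor_add) (simp_all add: u u' v v' magnus_congruent_def)
  have 1: "int p dvd (a i + d i) - (a' i + d' i)" if "i \<in> {1..n}" for i
    using dvd_add[OF a(1)[OF that] a(2)[OF that]] by (simp add: algebra_simps)
  have 2: "int p dvd (b (i, j) + e (i, j) + a i * d j) - (b' (i, j) + e' (i, j) + a' i * d' j)"
    if "i \<in> {1..n}" "j \<in> {1..n}" for i j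
    using dvd_add[OF dvd_add[OF b(1)[OF that] b(2)[OF that]] dvd_mult_diff[OF a(1)[OF that(1)] a(2)[OF that(2)]]]
    by (simp add: algebra_simps)
  have 3: "(\<lambda>s. (case s of (i, j, k) \<Rightarrow> c (i, j, k) + f (i, j, k) + a i * e (j, k) + b (i, j) * d k) -
     (case s of (i, j, k) \<Rightarrow> c' (i, j, k) + f' (i, j, k) + a' i * e' (j, k) + b' (i, j) * d' k)) \<in> Y_tensor p n U"
  proof (rule Y_tensor_change[OF c])
    fix i j k assume ijk: "i \<in> {1..n}" "j \<in> {1..n}" "k \<in> {1..n}"
    show "int p dvd (case (i, j, k) of (i, j, k) \<Rightarrow> c (i, j, k) + f (i, j, k) + a i * e (j, k) + b (i, j) * d k) -
     (case (i, j, k) of (i, j, k) \<Rightarrow> c' (i, j, k) + f' (i, j, k) + a' i * e' (j, k) + b' (i, j) * d' k) -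
     ((c (i, j, k) - c' (i, j, k)) + (f (i, j, k) - f' (i, j, k)))"
      using dvd_add[OF dvd_mult_diff[OF a(1)[OF ijk(1)] b(2)[OF ijk(2,3)]]
          dvd_mult_diff[OF b(1)[OF ijk(1,2)] a(2)[OF ijk(3)]]]
      by (simp add: algebra_simps)
  qed
  show ?thesis
    unfolding u u' v v' magnus_mult magnus_congruent_def using 1 2 3 by simp
qed

end

text \<open>The witness is \<open>magnus_group\<close> modulo \<open>magnus_congruent\<close>. Its commutators with the generators
  detect the linear part modulo \<open>p\<close>, and then, for a skew-symmetric quadratic part \<open>v\<close>, they are
  the tensors of \<open>\<phi>\<^sub>r(v)\<close>. So the central elements are those with \<open>v \<in> Z\<^sub>X\<close>, and \<open>Z\<^sub>X = X\<close>
  identifies them with the kernel of the map onto \<open>G\<close>.\<close>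

lemma subspace_closed_imp_capable:
  fixes G :: "('a, 'm) monoid_scheme"
  assumes p: "Factorial_Ring.prime p" "odd p" and G: "group G"
    and class_2: "nilpotent_of_class_at_most G 2"
    and exponent: "\<And>y. y \<in> carrier G \<Longrightarrow> y [^]\<^bsub>G\<^esub> p = \<one>\<^bsub>G\<^esub>"
    and minimal: "minimally_generated_by G n g" and n: "1 < n"
    and U: "U = {v \<in> carrier (V_space p n). commutator_product G g n v = \<one>\<^bsub>G\<^esub>}"
    and closed: "Z_space p n U \<subseteq> U"
  shows "capable G"
proof -
  interpret modulus p by (rule modulus.intro) (rule prime_gt_1_nat[OF p(1)])
  interpret G: class_2_group G using G class_2 by (rule class_2_groupI)
  interpret G: class_2_family G g n
    using minimal by unfold_locales (auto simp: minimally_generated_by_def)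
  have generated: "generate G (g ` {1..n}) = carrier G"
    using minimal by (simp add: minimally_generated_by_def)
  let ?K = magnus_group
  define q where "q = (\<lambda>(a, b, c :: nat \<times> nat \<times> nat \<Rightarrow> int). normal_form G g n a b)"
  have pow: "g i [^]\<^bsub>G\<^esub> p = \<one>\<^bsub>G\<^esub>" if "i \<in> {1..n}" for i using that exponent G.x_closed by blast
  have q_hom: "q \<in> hom ?K G"
  proof (rule homI)
    fix u v :: "(nat \<Rightarrow> int) \<times> (nat \<times> nat \<Rightarrow> int) \<times> (nat \<times> nat \<times> nat \<Rightarrow> int)"
    obtain a b c where u: "u = (a, b, c)" by (rule prod_cases3)
    obtain a' b' c' where v: "v = (a', b', c')" by (rule prod_cases3)
    show "q u \<in> carrier G" by (simp add: u q_def)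
    show "q (u \<otimes>\<^bsub>?K\<^esub> v) = q u \<otimes>\<^bsub>G\<^esub> q v"
      by (simp add: u v q_def magnus_mult G.normal_form_mult)
  qed
  have q_surj: "q ` carrier ?K = carrier G"
  proof
    show "q ` carrier ?K \<subseteq> carrier G" by (rule hom_carrier[OF q_hom])
    show "carrier G \<subseteq> q ` carrier ?K"
    proof
      fix y assume "y \<in> carrier G"
      then obtain a b where y: "y = normal_form G g n a b"
        using G.generate_normal_form generated by blast
      \<comment> \<open>The entries on and above the diagonal do not affect the image in \<open>G\<close>; they are chosen to
        satisfy the shuffle relations.\<close>
      define b' where "b' = (\<lambda>(i, j). if j < i then b (i, j) else if i < j then a i * a j - b (j, i)
        else (a i * (a i - 1)) div 2)"
      have "b' (i, j) + b' (j, i) = a i * a j - (if i = j then a i else 0)" for i j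
      proof (cases "i = j")
        case True
        have "2 * ((a i * (a i - 1)) div 2) = a i * (a i - 1)" by simp
        then show ?thesis using True by (simp add: b'_def algebra_simps)
      next
        case False
        then show ?thesis by (auto simp: b'_def mult.commute)
      qed
      then have K: "(a, b', \<lambda>s. 0) \<in> carrier ?K" by (simp add: magnus_carrier)
      have "commutator_product G g n b' = commutator_product G g n b"
        by (rule commutator_product_cong) (auto simp: b'_def V_index_def)
      then have "y = q (a, b', \<lambda>s. 0)" by (simp add: y q_def normal_form_def)
      then show "y \<in> q ` carrier ?K" using K by (rule image_eqI)
    qed
  qed
  let ?R = "magnus_congruent p n U"
  show ?thesis
  proof (rule capable_of_congruence[OF G group_magnus q_hom q_surj, where R = ?R])
    fix u v w u' v' :: "(nat \<Rightarrow> int) \<times> (nat \<times> nat \<Rightarrow> int) \<times> (nat \<times> nat \<times> nat \<Rightarrow> int)"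
    show "?R u u"
      by (cases u rule: prod_cases3) (simp add: magnus_congruent_def Y_tensor_zero)
    show "?R u v \<Longrightarrow> ?R v u" by (rule magnus_congruent_sym)
    show "?R u v \<Longrightarrow> ?R v w \<Longrightarrow> ?R u w" by (rule magnus_congruent_trans)
    show "?R u u' \<Longrightarrow> ?R v v' \<Longrightarrow> ?R (u \<otimes>\<^bsub>?K\<^esub> v) (u' \<otimes>\<^bsub>?K\<^esub> v')" by (rule magnus_congruent_mult)
  next
    fix u assume u_K: "u \<in> carrier ?K"
    obtain a b c where u: "u = (a, b, c)" by (rule prod_cases3)
    have shuffle: "b (i, j) + b (j, i) = a i * a j - (if i = j then a i else 0)" for i j
      using u_K by (simp add: u magnus_carrier)
    define v where "v = reduce p (V_index n) b"
    define d where "d r = (\<lambda>(i, j, k). (if k = r then b (i, j) else 0) - (if i = r then b (j, k) else 0))" for r :: nat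
    \<comment> \<open>Once the linear part vanishes modulo \<open>p\<close>, the quadratic part is skew-symmetric, so its
      bracket with \<open>X\<^sub>r\<close> is the tensor of \<open>\<phi>\<^sub>r\<close>.\<close>
    have d: "d r \<in> Y_tensor p n U \<longleftrightarrow> phi_map p n r v \<in> Y_space p n U"
      if a: "\<And>i. i \<in> {1..n} \<Longrightarrow> int p dvd a i" and r: "r \<in> {1..n}" for r
    proof -
      have skew: "int p dvd b (i, j) - skew_extension v i j" if ij: "i \<in> {1..n}" "j \<in> {1..n}" for i j
      proof (cases i j rule: linorder_cases)
        case greater
        then have "(i, j) \<in> V_index n" using ij by (auto simp: V_index_def)
        then show ?thesis using greater dvd_reduce_diff[of "(i, j)" "V_index n" p b]
          by (simp add: skew_extension_def v_def)
      next
        case less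
        then have "(j, i) \<in> V_index n" using ij by (auto simp: V_index_def)
        then have "int p dvd a i * a j - (b (j, i) - v (j, i))"
          using a[OF ij(1)] dvd_reduce_diff[of "(j, i)" "V_index n" p b] by (simp add: v_def)
        also have "a i * a j - (b (j, i) - v (j, i)) = b (i, j) - skew_extension v i j"
          using shuffle[of i j] less by (simp add: skew_extension_def)
        finally show ?thesis .
      next
        case equal
        have "2 * b (i, i) = a i * a i - a i" using shuffle[of i i] by simp
        then have "int p dvd 2 * b (i, i)" using a[OF ij(1)] by simp
        moreover have "coprime (int p) 2" using p(2) by simp
        ultimately have "int p dvd b (i, i)" by (simp add: coprime_dvd_mult_right_iff)
        then show ?thesis using equal by (simp add: skew_extension_def)
      qed
      have "int p dvd d r (i, j, k) - lie_tensor n (phi_int n r v) i j k"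
        if ijk: "i \<in> {1..n}" "j \<in> {1..n}" "k \<in> {1..n}" for i j k
      proof -
        have "int p dvd (if k = r then b (i, j) - skew_extension v i j else 0) - (if i = r then b (j, k) - skew_extension v j k else 0)"
          using skew ijk by (intro dvd_diff) auto
        also have "(if k = r then b (i, j) - skew_extension v i j else 0) - (if i = r then b (j, k) - skew_extension v j k else 0) =
            d r (i, j, k) - lie_tensor n (phi_int n r v) i j k"
          using ijk r by (simp add: d_def lie_tensor_phi)
        finally show ?thesis .
      qed
      then show ?thesis
        unfolding phi_map_eq by (rule reduce_in_Y_iff[OF p(2)])
    qed
    have q_u: "q u = commutator_product G g n v" if a: "\<And>i. i \<in> {1..n} \<Longrightarrow> int p dvd a i"
      unfolding u q_def prod.case G.normal_form_central[symmetric]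
      using a dvd_reduce_diff[of _ "V_index n" p b]
      by (intro G.normal_form_mod[OF pow]) (auto simp: v_def)
    have v_V: "v \<in> carrier (V_space p n)" by (simp add: v_def V_space_def)
    show "q u = \<one>\<^bsub>G\<^esub> \<longleftrightarrow> (\<forall>x\<in>carrier ?K. ?R (u \<otimes>\<^bsub>?K\<^esub> x) (x \<otimes>\<^bsub>?K\<^esub> u))"
    proof (intro iffI ballI)
      assume q1: "q u = \<one>\<^bsub>G\<^esub>"
      have a: "int p dvd a i" if "i \<in> {1..n}" for i
        using G.minimal_generation_exponents[OF p(1) exponent minimal _ that, of a b] q1
        by (simp add: u q_def)
      have "v \<in> U" using q1 q_u[OF a] v_V by (simp add: U)
      then have d_Y: "d r \<in> Y_tensor p n U" if "r \<in> {1..n}" for r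
        using d[OF a that] phi_in_Y that by blast
      \<comment> \<open>Up to multiples of \<open>p\<close>, the commutator with \<open>x\<close> depends only on the linear part of \<open>x\<close>,
        and linearly so.\<close>
      fix x :: "(nat \<Rightarrow> int) \<times> (nat \<times> nat \<Rightarrow> int) \<times> (nat \<times> nat \<times> nat \<Rightarrow> int)"
      obtain a' b' c' where x: "x = (a', b', c')" by (rule prod_cases3)
      have sum: "(\<lambda>s. \<Sum>r\<in>{1..n}. a' r * d r s) \<in> Y_tensor p n U"
        using d_Y by (intro Y_tensor_sum) auto
      have sum_eq: "(\<Sum>r\<in>{1..n}. a' r * d r (i, j, k)) = b (i, j) * a' k - a' i * b (j, k)"
        if ijk: "i \<in> {1..n}" "j \<in> {1..n}" "k \<in> {1..n}" for i j k
      proof -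
        have "(\<Sum>r\<in>{1..n}. a' r * d r (i, j, k)) =
            (\<Sum>r\<in>{1..n}. (if k = r then b (i, j) * a' r else 0) - (if i = r then a' r * b (j, k) else 0))"
          by (intro sum.cong) (auto simp: d_def algebra_simps)
        also have "\<dots> = b (i, j) * a' k - a' i * b (j, k)"
          using ijk by (simp add: sum_subtractf)
        finally show ?thesis .
      qed
      have "(\<lambda>s. (case s of (i, j, k) \<Rightarrow> c (i, j, k) + c' (i, j, k) + a i * b' (j, k) + b (i, j) * a' k) -
          (case s of (i, j, k) \<Rightarrow> c' (i, j, k) + c (i, j, k) + a' i * b (j, k) + b' (i, j) * a k)) \<in> Y_tensor p n U"
      proof (rule Y_tensor_change[OF sum])
        fix i j k assume ijk: "i \<in> {1..n}" "j \<in> {1..n}" "k \<in> {1..n}"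
        have "int p dvd a i * b' (j, k) - b' (i, j) * a k"
          using a[OF ijk(1)] a[OF ijk(3)] by simp
        then show "int p dvd (case (i, j, k) of (i, j, k) \<Rightarrow> c (i, j, k) + c' (i, j, k) + a i * b' (j, k) + b (i, j) * a' k) -
          (case (i, j, k) of (i, j, k) \<Rightarrow> c' (i, j, k) + c (i, j, k) + a' i * b (j, k) + b' (i, j) * a k) -
          (\<Sum>r\<in>{1..n}. a' r * d r (i, j, k))"
          unfolding sum_eq[OF ijk] by (simp add: algebra_simps)
      qed
      moreover have "int p dvd b (i, j) + b' (i, j) + a i * a' j - (b' (i, j) + b (i, j) + a' i * a j)"
        if "i \<in> {1..n}" "j \<in> {1..n}" for i j
        using a[OF that(1)] a[OF that(2)] by simp
      ultimately show "?R (u \<otimes>\<^bsub>?K\<^esub> x) (x \<otimes>\<^bsub>?K\<^esub> u)"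
        unfolding u x magnus_mult magnus_congruent_def by simp
    next
      assume central: "\<forall>x\<in>carrier ?K. ?R (u \<otimes>\<^bsub>?K\<^esub> x) (x \<otimes>\<^bsub>?K\<^esub> u)"
      define E where "E r = (\<lambda>i :: nat. if i = r then 1 else 0 :: int, \<lambda>s :: nat \<times> nat. 0 :: int,
        \<lambda>s :: nat \<times> nat \<times> nat. 0 :: int)" for r
      have E: "?R (u \<otimes>\<^bsub>?K\<^esub> E r) (E r \<otimes>\<^bsub>?K\<^esub> u)" for r
        using central by (simp add: E_def magnus_carrier)
      have a: "int p dvd a i" if i: "i \<in> {1..n}" for i
      proof -
        \<comment> \<open>The coefficient of \<open>X\<^sub>i X\<^sub>r\<close> in the commutator with a different generator \<open>x\<^sub>r\<close> is \<open>a\<^sub>i\<close>;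
          there is one because \<open>n > 1\<close>.\<close>
        define r where "r = (if i = 1 then 2 else 1 :: nat)"
        have r: "r \<in> {1..n}" "r \<noteq> i" using n by (auto simp: r_def)
        have "\<forall>i\<in>{1..n}. \<forall>j\<in>{1..n}. int p dvd a i * (if j = r then 1 else 0) - (if i = r then 1 else 0) * a j"
          using E[of r] by (simp add: u E_def magnus_mult magnus_congruent_def)
        from this[rule_format, OF i r(1)] show ?thesis using r(2) by simp
      qed
      have "phi_map p n r v \<in> Y_space p n U" if r: "r \<in> {1..n}" for r
      proof -
        note congruent = E[of r, unfolded u E_def magnus_mult magnus_congruent_def prod.case]
        have "d r \<in> Y_tensor p n U"
          by (rule Y_tensor_change[OF conjunct2[OF conjunct2[OF congruent]]]) (simp add: d_def)
        then show ?thesis using d[OF a r] by simp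
      qed
      then have "v \<in> Z_space p n U" using v_V by (simp add: Z_space_def)
      then have "v \<in> U" using closed by blast
      then show "q u = \<one>\<^bsub>G\<^esub>" using q_u[OF a] by (simp add: U)
    qed
  qed
qed

theorem theorem3p6:
  fixes G :: "('a, 'm) monoid_scheme" and p n :: nat and g :: "nat \<Rightarrow> 'a"
    and XG :: "(nat \<times> nat \<Rightarrow> int) set"
  assumes "Factorial_Ring.prime p" and "odd p"
    and "group G" and "finite (carrier G)"
    and "nilpotent_of_class_at_most G 2" and "has_exponent G p"
    and "n > 1" and "minimally_generated_by G n g"
    and "XG = determined_subspace p n G g"
  shows "capable G \<longleftrightarrow> XG = Z_space p n XG"
proof -
  interpret modulus p by (rule modulus.intro) (rule prime_gt_1_nat[OF assms(1)])
  have exponent: "y [^]\<^bsub>G\<^esub> p = \<one>\<^bsub>G\<^esub>" if "y \<in> carrier G" for y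
    using assms(6) that by (simp add: has_exponent_def)
  have XG: "XG = {v \<in> carrier (V_space p n). commutator_product G g n v = \<one>\<^bsub>G\<^esub>}"
    unfolding assms(9) using assms(1,3,5) exponent assms(8) by (rule determined_subspace_eq)
  have "XG \<subseteq> Z_space p n XG"
  proof
    fix v assume "v \<in> XG"
    then show "v \<in> Z_space p n XG"
      unfolding Z_space_def using phi_in_Y by (auto simp: XG)
  qed
  moreover have "Z_space p n XG \<subseteq> XG" if "capable G"
    using assms(7,8) that
    by (intro capable_imp_subspace_closed[OF assms(1,3,5) exponent _ _ _ _ XG])
      (auto simp: minimally_generated_by_def)
  moreover have "capable G" if "Z_space p n XG \<subseteq> XG"
    using subspace_closed_imp_capable[OF assms(1-3,5) exponent assms(8,7) XG that] .
  ultimately show ?thesis by blast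
qed

end
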